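(* For a caterpillar $G$ it can be decided in linear time whether $G$ is a unit disk contact graph, where arbitrary embeddings are allowed. Moreover, if $G$ is a unit disk contact graph, a unit disk contact representation of $G$ can be constructed in linear time (on a Real RAM).
   Context: A caterpillar is a tree for which a path remains after removing all leaves. A disk contact representation of a graph $G=(V,E)$ is a set of interior-disjoint closed disks in the plane together with a bijection between $V$ and the disks such that two disks touch if and only if the corresponding vertices are adjacent. A graph is a unit disk contact graph (UDC graph) if it has a disk contact representation in which all disks have the same radius; such a representation is a unit disk contact representation. "Arbitrary embeddings allowed" means the representation need not induce any prescribed planar embedding. The Real RAM model assumes that basic arithmetic operations, including square roots and trigonometric functions, on real numbers take constant time. *)

theory Defs
  imports "HOL-Analysis.Analysis"
begin

section \<open>Simple graphs on vertex set {0..<n}\<close>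

text \<open>A graph is given by n and a set E of ordered pairs, symmetric and
irreflexive; the unordered edge {u,v} is represented by (u,v) and (v,u).\<close>

definition graph_on :: "nat \<Rightarrow> (nat \<times> nat) set \<Rightarrow> bool" where
  "graph_on n E \<longleftrightarrow> E \<subseteq> {0..<n} \<times> {0..<n} \<and> sym E \<and> (\<forall>x. (x, x) \<notin> E)"

definition connected_graph :: "nat \<Rightarrow> (nat \<times> nat) set \<Rightarrow> bool" where
  "connected_graph n E \<longleftrightarrow> n \<ge> 1 \<and> (\<forall>u<n. \<forall>v<n. (u, v) \<in> E\<^sup>*)"

text \<open>A cycle: distinct vertices v0,...,vk (k \<ge> 2), consecutive ones adjacent,
and vk adjacent to v0.\<close>
definition has_cycle :: "(nat \<times> nat) set \<Rightarrow> bool" where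
  "has_cycle E \<longleftrightarrow> (\<exists>vs. length vs \<ge> 3 \<and> distinct vs \<and>
      (\<forall>i. Suc i < length vs \<longrightarrow> (vs ! i, vs ! Suc i) \<in> E) \<and> (last vs, hd vs) \<in> E)"

definition is_tree :: "nat \<Rightarrow> (nat \<times> nat) set \<Rightarrow> bool" where
  "is_tree n E \<longleftrightarrow> graph_on n E \<and> connected_graph n E \<and> \<not> has_cycle E"

definition degree :: "(nat \<times> nat) set \<Rightarrow> nat \<Rightarrow> nat" where
  "degree E v = card {u. (v, u) \<in> E}"

text \<open>The graph with vertex set V and edge set E (restricted to V) is a path:
its vertices can be listed without repetition so that two vertices are adjacent
iff they are consecutive. (The empty graph counts as a path.)\<close>
definition is_path_graph :: "nat set \<Rightarrow> (nat \<times> nat) set \<Rightarrow> bool" where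
  "is_path_graph V E \<longleftrightarrow> (\<exists>xs. distinct xs \<and> set xs = V \<and>
     (\<forall>u\<in>V. \<forall>v\<in>V. (u, v) \<in> E \<longleftrightarrow>
        (\<exists>i. Suc i < length xs \<and> ((xs ! i = u \<and> xs ! Suc i = v) \<or> (xs ! i = v \<and> xs ! Suc i = u)))))"

text \<open>Caterpillar: a tree such that removing all leaves (degree-1 vertices) leaves a path.\<close>
definition caterpillar :: "nat \<Rightarrow> (nat \<times> nat) set \<Rightarrow> bool" where
  "caterpillar n E \<longleftrightarrow> is_tree n E \<and> is_path_graph {v. v < n \<and> degree E v \<noteq> 1} E"

section \<open>(Unit) disk contact representations in the plane real \<times> real\<close>

definition disk_contact_rep :: "nat \<Rightarrow> (nat \<times> nat) set \<Rightarrow> (nat \<Rightarrow> (real \<times> real) set) \<Rightarrow> bool" where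
  "disk_contact_rep n E D \<longleftrightarrow>
     (\<forall>v<n. \<exists>c r. r > 0 \<and> D v = cball c r) \<and>
     inj_on D {0..<n} \<and>
     (\<forall>u<n. \<forall>v<n. u \<noteq> v \<longrightarrow> interior (D u) \<inter> interior (D v) = {}) \<and>
     (\<forall>u<n. \<forall>v<n. u \<noteq> v \<longrightarrow> (D u \<inter> D v \<noteq> {} \<longleftrightarrow> (u, v) \<in> E))"

definition unit_disk_contact_rep :: "nat \<Rightarrow> (nat \<times> nat) set \<Rightarrow> (nat \<Rightarrow> real \<times> real) \<Rightarrow> real \<Rightarrow> bool" where
  "unit_disk_contact_rep n E c r \<longleftrightarrow> r > 0 \<and> disk_contact_rep n E (\<lambda>v. cball (c v) r)"

definition UDC_graph :: "nat \<Rightarrow> (nat \<times> nat) set \<Rightarrow> bool" where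
  "UDC_graph n E \<longleftrightarrow> (\<exists>c r. unit_disk_contact_rep n E c r)"

section \<open>A Real RAM\<close>

text \<open>Memory cells hold reals; each instruction costs one step. Constants are integers.
Indirect addressing is only allowed with natural-number-valued addresses,
division by zero and square roots of negatives make the machine fail.\<close>

datatype instr =
    LoadConst nat int
  | Add nat nat nat | Sub nat nat nat | Mul nat nat nat | Div nat nat nat
  | Sqrt nat nat | Sin nat nat | Cos nat nat | Arctan nat nat
  | LoadInd nat nat    (* dst, address register: m dst := m (m a) *)
  | StoreInd nat nat   (* address register, src: m (m a) := m src *)
  | JmpLe nat nat nat  (* if m a \<le> m b then goto t else next *)
  | Halt

type_synonym mem = "nat \<Rightarrow> real"
type_synonym config = "nat \<times> mem"

fun step :: "instr \<Rightarrow> nat \<Rightarrow> mem \<Rightarrow> config option" where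
  "step (LoadConst d k) pc m = Some (Suc pc, m(d := of_int k))"
| "step (Add d a b) pc m = Some (Suc pc, m(d := m a + m b))"
| "step (Sub d a b) pc m = Some (Suc pc, m(d := m a - m b))"
| "step (Mul d a b) pc m = Some (Suc pc, m(d := m a * m b))"
| "step (Div d a b) pc m = (if m b = 0 then None else Some (Suc pc, m(d := m a / m b)))"
| "step (Sqrt d a) pc m = (if m a < 0 then None else Some (Suc pc, m(d := sqrt (m a))))"
| "step (Sin d a) pc m = Some (Suc pc, m(d := sin (m a)))"
| "step (Cos d a) pc m = Some (Suc pc, m(d := cos (m a)))"
| "step (Arctan d a) pc m = Some (Suc pc, m(d := arctan (m a)))"
| "step (LoadInd d a) pc m =
     (if m a \<in> \<nat> then Some (Suc pc, m(d := m (nat \<lfloor>m a\<rfloor>))) else None)"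
| "step (StoreInd a s) pc m =
     (if m a \<in> \<nat> then Some (Suc pc, m(nat \<lfloor>m a\<rfloor> := m s)) else None)"
| "step (JmpLe a b t) pc m = Some (if m a \<le> m b then t else Suc pc, m)"
| "step Halt pc m = None"

fun run :: "instr list \<Rightarrow> nat \<Rightarrow> config \<Rightarrow> config option" where
  "run P 0 c = Some c"
| "run P (Suc k) (pc, m) =
     (if pc < length P then (case step (P ! pc) pc m of None \<Rightarrow> None | Some c' \<Rightarrow> run P k c')
      else None)"

text \<open>P started on memory m0 halts after at most t steps with final memory m.\<close>
definition halts_within :: "instr list \<Rightarrow> mem \<Rightarrow> nat \<Rightarrow> mem \<Rightarrow> bool" where
  "halts_within P m0 t m \<longleftrightarrow>
     (\<exists>k\<le>t. \<exists>pc. run P k (0, m0) = Some (pc, m) \<and> pc < length P \<and> P ! pc = Halt)"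

section \<open>Input / output encoding\<close>

text \<open>es lists every (unordered) edge of E exactly once, in some orientation.\<close>
definition edge_list_of :: "(nat \<times> nat) set \<Rightarrow> (nat \<times> nat) list \<Rightarrow> bool" where
  "edge_list_of E es \<longleftrightarrow> distinct (map (\<lambda>(u, v). {u, v}) es) \<and>
     (\<forall>u v. (u, v) \<in> E \<longleftrightarrow> (u, v) \<in> set es \<or> (v, u) \<in> set es)"

text \<open>Input memory: cell 0 holds n, cells 1+2i and 2+2i the endpoints of edge i, rest 0.\<close>
definition input_mem :: "nat \<Rightarrow> (nat \<times> nat) list \<Rightarrow> mem" where
  "input_mem n es = (\<lambda>j. if j = 0 then real n
      else if j \<le> 2 * length es then
        (if odd j then real (fst (es ! ((j - 1) div 2))) else real (snd (es ! ((j - 2) div 2))))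
      else 0)"

text \<open>Output: cell 0 holds 1 (UDC) or 0 (not UDC); in the positive case the
centers of radius-1 disks are (m (1+2v), m (2+2v)) for v < n.\<close>
definition output_centers :: "mem \<Rightarrow> nat \<Rightarrow> real \<times> real" where
  "output_centers m v = (m (1 + 2 * v), m (2 + 2 * v))"

end

(* Scale disks so that touching centers have distance 1. List the non-leaves of the caterpillar as
   the spine v_1, ..., v_k. Around a vertex, neighbours are more than pi/3 apart, so degrees are at
   most 5. After a vertex of degree 5 the neighbours of the next spine vertex are confined to a
   sector of angle less than pi. If that vertex has degree at least 4, the same holds one step
   further: either its neighbours on both sides of the spine bound the new sector, or the sector
   is extended by pi/3 on the side without leaves and loses pi/3 on the other side. A sector of
   angle less than pi has no room for the four further neighbours of another vertex of degree 5.
   Hence between two vertices of degree 5 there is a vertex of degree at most 3.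

   Conversely, draw the spine on a slightly bent arc near a line of the triangular lattice and hang
   leaves in directions close to 2 pi/3, pi/3 and -pi/3, each drifting a little from vertex to vertex.
   The only positions that collide are direction pi/3 at one vertex and 2 pi/3 at the next, and a
   greedy left-to-right choice avoids them under the condition above.

   The spine is traversed without adjacency lists: every spine vertex has at most two spine
   neighbours, so the next one is their sum minus the previous one. *)

theory Submission
  imports Defs
begin

section \<open>Unit vectors in the plane\<close>

text \<open>Confinement has to survive at a vertex without a leaf on one side, where no new disk
  bounds the sector. It is therefore stated for two positions at unit distance from a spine disk,
  occupied or not, that no later neighbour may overlap. An unoccupied one is justified by a covering
  fact: its open unit disk lies in the union of the open unit disks around three positions that are
  already blocked.

  The bend is forced by pairs of places that have distance exactly 1 in the straight lattice
  although their disks must not touch. A bend of 3 \<eta> per vertex gives this slack on the outer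
  side, while the leaves on the inner side drift the other way.

  Both halves fit together because \<open>narrow\<close> has two readings: confinement in an
  arbitrary drawing, and occupation of the place \<open>Front\<close> of the preceding vertex in the
  greedy drawing.

  On the machine, every edge and every vertex must be handled in constant time. Each spine vertex
  stores its slot angles in a row together with a pointer to the next free slot, so one pass over
  the oriented edges places all leaves.\<close>

lemma norm_cis_diff_sq: "(norm (cis a - cis b))\<^sup>2 = 2 - 2 * cos (a - b)"
proof -
  have "(norm (cis a - cis b))\<^sup>2 = (cos a - cos b)\<^sup>2 + (sin a - sin b)\<^sup>2"
    by (simp add: cmod_power2)
  also have "\<dots> = (cos a^2 + sin a^2) + (cos b^2 + sin b^2) - 2 * (cos a * cos b + sin a * sin b)"
    by algebra
  also have "\<dots> = 2 - 2 * cos (a - b)" by (simp add: cos_diff)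
  finally show ?thesis .
qed

text \<open>For a disk at 0, a neighbour at \<open>cis a\<close> and its neighbour at
  \<open>cis a + cis b\<close>, this measures the distance to the place \<open>cis c\<close>.
  Sum-to-product formulas factor the excess over 1. It vanishes for the rhombi \<open>a = c\<close>
  and \<open>b = c\<close>, so its sign tells on which side of a touching position a disk
  lies.\<close>

lemma norm_cis_rhombus_sq:
  "(norm (cis a + cis b - cis c))\<^sup>2 = 1 + 8 * cos ((a - b)/2) * sin ((a - c)/2) * sin ((b - c)/2)"
proof -
  have 1: "sin ((a - c)/2) * sin ((b - c)/2) = (cos ((a - b)/2) - cos ((a + b)/2 - c))/2"
  proof -
    have "(a - c)/2 - (b - c)/2 = (a - b)/2" "(a - c)/2 + (b - c)/2 = (a + b)/2 - c"
      by (simp_all add: field_simps)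
    then show ?thesis by (simp only: sin_times_sin)
  qed
  have 2: "cos ((a - b)/2) * cos ((a - b)/2) = (1 + cos (a - b))/2"
    by (simp only: cos_times_cos diff_self cos_zero field_sum_of_halves)
  have 3: "cos ((a - b)/2) * cos ((a + b)/2 - c) = (cos (a - c) + cos (b - c))/2"
  proof -
    have "(a - b)/2 - ((a + b)/2 - c) = - (b - c)" "(a - b)/2 + ((a + b)/2 - c) = a - c"
      by (simp_all add: field_simps)
    then show ?thesis by (simp only: cos_times_cos cos_minus add.commute)
  qed
  have "(norm (cis a + cis b - cis c))\<^sup>2 =
      (cos a + cos b - cos c)\<^sup>2 + (sin a + sin b - sin c)\<^sup>2"
    by (simp add: cmod_power2)
  also have "\<dots> = (cos a^2 + sin a^2) + (cos b^2 + sin b^2) + (cos c^2 + sin c^2)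
      + 2 * (cos a * cos b + sin a * sin b) - 2 * (cos a * cos c + sin a * sin c)
      - 2 * (cos b * cos c + sin b * sin c)"
    by algebra
  also have "\<dots> = 3 + 2 * cos (a - b) - 2 * cos (a - c) - 2 * cos (b - c)"
    by (simp add: cos_diff)
  also have "\<dots> = 1 + 4 * (cos ((a - b)/2) * cos ((a - b)/2) - cos ((a - b)/2) * cos ((a + b)/2 - c))"
    unfolding 2 3 by (simp add: field_simps)
  also have "\<dots> = 1 + 8 * cos ((a - b)/2) * (sin ((a - c)/2) * sin ((b - c)/2))"
    unfolding 1 by (simp add: field_simps)
  finally show ?thesis by simp
qed

section \<open>Distances compared with 1, and sets of separated angles\<close>

lemma sq_ge_1: "x \<ge> 0 \<Longrightarrow> (x \<ge> (1::real)) \<longleftrightarrow> x\<^sup>2 \<ge> 1"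
  using abs_le_square_iff[of 1 x] by simp

lemma sq_gt_1: "x \<ge> 0 \<Longrightarrow> (x > (1::real)) \<longleftrightarrow> x\<^sup>2 > 1"
  using abs_le_square_iff[of x 1] by (simp add: not_le[symmetric])

lemma norm_ge_1_iff: "norm z \<ge> 1 \<longleftrightarrow> (norm z)\<^sup>2 \<ge> 1"
  by (rule sq_ge_1) simp

lemma norm_gt_1_iff: "norm z > 1 \<longleftrightarrow> (norm z)\<^sup>2 > 1"
  by (rule sq_gt_1) simp

lemma cos_gt_half: "\<bar>x\<bar> < pi/3 \<Longrightarrow> cos x > 1/2"
  using cos_monotone_0_pi[of "\<bar>x\<bar>" "pi/3"] by (simp add: cos_60)

lemma cos_ge_half: "\<bar>x\<bar> \<le> pi/3 \<Longrightarrow> cos x \<ge> 1/2"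
  using cos_monotone_0_pi_le[of "\<bar>x\<bar>" "pi/3"] by (simp add: cos_60)

lemma cis_sep_ge: assumes "norm (cis a - cis b) \<ge> 1" shows "\<bar>a - b\<bar> \<ge> pi/3"
  using cos_gt_half[of "a - b"] assms unfolding norm_ge_1_iff norm_cis_diff_sq by argo

lemma cis_sep_gt: assumes "norm (cis a - cis b) > 1" shows "\<bar>a - b\<bar> > pi/3"
  using cos_ge_half[of "a - b"] assms unfolding norm_gt_1_iff norm_cis_diff_sq by argo

text \<open>Induction on the cardinality: removing the maximum gives up at least one gap of size
  \<open>c\<close>.\<close>

lemma separated_spread:
  fixes T :: "real set"
  assumes "finite T" "card T = Suc m" "\<And>x y. x \<in> T \<Longrightarrow> y \<in> T \<Longrightarrow> x \<noteq> y \<Longrightarrow> \<bar>x - y\<bar> \<ge> c"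
  shows "Max T - Min T \<ge> m * c"
  using assms
proof (induction m arbitrary: T)
  case 0
  then obtain x where "T = {x}" by (metis card_1_singletonE One_nat_def)
  then show ?case by simp
next
  case (Suc m)
  let ?M = "Max T" let ?T = "T - {?M}"
  have ne: "T \<noteq> {}" using Suc.prems by auto
  have M: "?M \<in> T" using Suc.prems ne by simp
  have c: "card ?T = Suc m" "finite ?T" using Suc.prems M by auto
  have ne': "?T \<noteq> {}" using c by (metis card.empty nat.distinct(1))
  have 1: "Max ?T - Min ?T \<ge> m * c" using c Suc.prems(3) by (intro Suc.IH) auto
  have mT: "Max ?T \<in> ?T" "Min ?T \<in> ?T" using Max_in[OF c(2) ne'] Min_in[OF c(2) ne'] by simp_all
  have "?M - Max ?T \<ge> c" using Suc.prems(3)[OF M, of "Max ?T"] mT Suc.prems(1)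
    by (metis Diff_iff Max_ge abs_of_nonneg diff_ge_0_iff_ge insertCI)
  moreover have "Min T \<le> Min ?T" using Suc.prems(1) ne' by (intro Min_antimono) auto
  ultimately show ?case using 1 by (simp add: algebra_simps)
qed

text \<open>A finite set has a smallest gap, which still exceeds \<open>c\<close>. The weak version
  applied to this gap gives the strict bound.\<close>

lemma separated_spread_gt:
  fixes T :: "real set"
  assumes "finite T" "card T = Suc m" "m > 0" "\<And>x y. x \<in> T \<Longrightarrow> y \<in> T \<Longrightarrow> x \<noteq> y \<Longrightarrow> \<bar>x - y\<bar> > c"
  shows "Max T - Min T > m * c"
proof -
  let ?D = "{\<bar>x - y\<bar> | x y. x \<in> T \<and> y \<in> T \<and> x \<noteq> y}"
  have fin: "finite ?D"
    by (rule finite_subset[of _ "(\<lambda>(x,y). \<bar>x - y\<bar>) ` (T \<times> T)"]) (use assms(1) in auto)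
  have ne: "?D \<noteq> {}"
  proof -
    obtain x where x: "x \<in> T" using assms by (metis card.empty nat.distinct(1) ex_in_conv)
    moreover have "card (T - {x}) = m" using x assms by simp
    ultimately obtain y where "y \<in> T - {x}" using assms(3) by (metis card.empty ex_in_conv less_numeral_extra(3))
    then show ?thesis using x by auto
  qed
  have "Max T - Min T \<ge> m * Min ?D"
    by (rule separated_spread[OF assms(1,2)]) (use fin in \<open>auto intro!: Min_le\<close>)
  moreover have "Min ?D > c" using fin ne assms(4) by (subst Min_gr_iff) auto
  ultimately show ?thesis using assms(3) by (smt (verit) mult_strict_left_mono of_nat_0_less_iff)
qed

text \<open>Reducing the angle to the interval around \<open>t\<close> makes the half-angle cosine positive, so the
  sign of the product formula for the rhombus is the sign of its last two factors.\<close>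

lemma window_lower:
  assumes t: "\<phi> + pi/3 \<le> t" "t \<le> \<phi> + 2*pi/3" and u: "\<bar>u - t\<bar> < pi"
    and n: "norm (cis t + cis u - cis \<phi>) \<ge> 1"
  shows "\<phi> \<le> u"
proof (rule ccontr)
  assume "\<not> \<phi> \<le> u"
  have "cos ((t - u)/2) > 0" by (rule cos_gt_zero_pi) (use u in \<open>auto simp: abs_if split: if_splits\<close>)
  moreover have "sin ((t - \<phi>)/2) > 0" using t pi_gt_zero by (intro sin_gt_zero; argo)
  moreover have "sin ((\<phi> - u)/2) > 0" using t u \<open>\<not> \<phi> \<le> u\<close> pi_gt_zero by (intro sin_gt_zero; argo)
  ultimately have "cos ((t - u)/2) * sin ((t - \<phi>)/2) * sin ((\<phi> - u)/2) > 0" by simp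
  moreover have "sin ((u - \<phi>)/2) = - sin ((\<phi> - u)/2)"
    by (metis minus_diff_eq minus_divide_left sin_minus)
  ultimately show False
    using norm_cis_rhombus_sq[of t u \<phi>] n[unfolded norm_ge_1_iff] by simp
qed

lemma window_upper:
  assumes t: "\<phi> - 2*pi/3 \<le> t" "t \<le> \<phi> - pi/3" and u: "\<bar>u - t\<bar> < pi"
    and n: "norm (cis t + cis u - cis \<phi>) \<ge> 1"
  shows "u \<le> \<phi>"
proof -
  have "norm (cis (-t) + cis (-u) - cis (-\<phi>)) = norm (cnj (cis t + cis u - cis \<phi>))"
    by (simp add: cis_cnj)
  then have "norm (cis (-t) + cis (-u) - cis (-\<phi>)) \<ge> 1" using n by (simp only: complex_mod_cnj)
  from window_lower[OF _ _ _ this] show ?thesis using t u by (simp add: abs_minus_commute)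
qed

text \<open>The open unit disk around \<open>cis \<alpha> + cis (-pi/3)\<close> is covered by those
  around 0, 1 and \<open>cis \<alpha>\<close>. In the extreme cases this point is 1 itself
  (\<open>\<alpha> = pi/3\<close>) or 0 (\<open>\<alpha> = 2*pi/3\<close>). The lemma lets old disks
  block a direction in which no new disk has been placed.\<close>

lemma cover_normalized:
  fixes w :: complex
  assumes a: "pi/3 \<le> \<alpha>" "\<alpha> \<le> 2*pi/3"
    and w: "norm w \<ge> 1" "norm (w - 1) \<ge> 1" "norm (w - cis \<alpha>) \<ge> 1"
  shows "norm (w - (cis \<alpha> + cis (-pi/3))) \<ge> 1"
proof (rule ccontr)
  assume neg: "\<not> ?thesis"
  \<comment> \<open>Polar coordinates about \<open>1 + cis \<alpha>\<close>, a common point of the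
    circles around 1, \<open>cis \<alpha>\<close> and the new position. In these coordinates each
    circle reads \<open>\<rho> = 2 * cos (\<omega> - \<beta>)\<close>, with \<open>\<beta>\<close>
    equal to \<open>\<alpha>\<close>, 0 and pi/3. Lying in a disk becomes a comparison of cosines,
    which traps \<open>\<omega>\<close> between pi/6 and \<open>(pi/3+\<alpha>)/2\<close>.\<close>
  define u where "u = 1 + cis \<alpha> - w"
  obtain \<rho> \<omega> :: real where u: "u = of_real \<rho> * cis \<omega>" and \<rho>: "\<rho> \<ge> 0" and \<omega>: "-pi < \<omega>" "\<omega> \<le> pi"
    using that[of "norm u" "Arg u"] rcis_cmod_Arg[of u] mpi_less_Arg[of u] Arg_le_pi[of u]
    unfolding rcis_def by simp
  have nsq: "(norm (\<rho> * cis \<omega> - cis \<beta>))\<^sup>2 = \<rho>\<^sup>2 - 2 * \<rho> * cos (\<omega> - \<beta>) + 1" for \<beta>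
  proof -
    have "(norm (\<rho> * cis \<omega> - cis \<beta>))\<^sup>2 = (\<rho> * cos \<omega> - cos \<beta>)\<^sup>2 + (\<rho> * sin \<omega> - sin \<beta>)\<^sup>2"
      by (simp add: cmod_power2)
    also have "\<dots> = \<rho>\<^sup>2 * (cos \<omega>^2 + sin \<omega>^2) + (cos \<beta>^2 + sin \<beta>^2) - 2 * \<rho> * (cos \<omega> * cos \<beta> + sin \<omega> * sin \<beta>)"
      by algebra
    finally show ?thesis by (simp add: cos_diff)
  qed
  have e60: "cis (-pi/3) = 1 - cis (pi/3)"
    by (simp add: complex_eq_iff cos_60 sin_60)
  have "\<rho> * cis \<omega> - cis (pi/3) = - (w - (cis \<alpha> + cis (-pi/3)))"
    unfolding u[symmetric] u_def e60 by simp
  then have "norm (\<rho> * cis \<omega> - cis (pi/3)) < 1"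
    using neg by (simp only: norm_minus_cancel not_le)
  then have "\<rho>\<^sup>2 - 2 * \<rho> * cos (\<omega> - pi/3) < 0"
    unfolding not_le[symmetric] norm_ge_1_iff nsq by simp
  then have "\<rho> * (\<rho> - 2 * cos (\<omega> - pi/3)) < 0" by (simp add: power2_eq_square algebra_simps)
  then have \<rho>pos: "\<rho> > 0" and r60: "\<rho> < 2 * cos (\<omega> - pi/3)" using \<rho> by (auto simp: mult_less_0_iff)
  have "norm (\<rho> * cis \<omega> - cis 0) \<ge> 1"
    using w(3) unfolding u[symmetric] u_def by (simp add: norm_minus_commute algebra_simps)
  then have "\<rho>\<^sup>2 - 2 * \<rho> * cos \<omega> \<ge> 0"
    unfolding norm_ge_1_iff nsq by simp
  then have "\<rho> * (\<rho> - 2 * cos \<omega>) \<ge> 0" by (simp add: power2_eq_square algebra_simps)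
  then have r0: "\<rho> \<ge> 2 * cos \<omega>" using \<rho>pos by (simp add: zero_le_mult_iff)
  have "norm (\<rho> * cis \<omega> - cis \<alpha>) \<ge> 1"
    using w(2) unfolding u[symmetric] u_def by (simp add: norm_minus_commute algebra_simps)
  then have "\<rho>\<^sup>2 - 2 * \<rho> * cos (\<omega> - \<alpha>) \<ge> 0"
    unfolding norm_ge_1_iff nsq by simp
  then have "\<rho> * (\<rho> - 2 * cos (\<omega> - \<alpha>)) \<ge> 0" by (simp add: power2_eq_square algebra_simps)
  then have ra: "\<rho> \<ge> 2 * cos (\<omega> - \<alpha>)" using \<rho>pos by (simp add: zero_le_mult_iff)
  have cp: "cos (\<omega> - pi/3) > 0" using r60 \<rho>pos by linarith
  have om: "-pi/6 < \<omega>" "\<omega> < 5*pi/6"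
  proof -
    have *: "cos x \<le> 0" if "pi/2 \<le> x" "x \<le> 3*pi/2" for x
      using cos_ge_zero[of "x - pi"] cos_minus_pi[of x] that by simp
    show "-pi/6 < \<omega>"
    proof (rule ccontr)
      assume "\<not> -pi/6 < \<omega>"
      then have "cos (pi/3 - \<omega>) \<le> 0" using \<omega> by (intro *; argo)
      then show False using cp cos_minus[of "\<omega> - pi/3"] by simp
    qed
    show "\<omega> < 5*pi/6"
    proof (rule ccontr)
      assume "\<not> \<omega> < 5*pi/6"
      then have "cos (\<omega> - pi/3) \<le> 0" using \<omega> pi_gt_zero by (intro *; argo)
      then show False using cp by simp
    qed
  qed
  have "cos (\<omega> - pi/3) - cos \<omega> = 2 * sin (\<omega> - pi/6) * sin (pi/6)"
    by (subst cos_diff_cos) (simp add: field_simps)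
  then have s1: "sin (\<omega> - pi/6) > 0" using r60 r0 by (simp add: sin_30)
  have o1: "\<omega> > pi/6"
  proof (rule ccontr)
    assume "\<not> \<omega> > pi/6"
    then have "sin (pi/6 - \<omega>) \<ge> 0" using om by (intro sin_ge_zero; argo)
    then show False using s1 sin_minus[of "\<omega> - pi/6"] by simp
  qed
  have "cos (\<omega> - pi/3) - cos (\<omega> - \<alpha>) = 2 * sin (\<omega> - (pi/3+\<alpha>)/2) * sin ((pi/3 - \<alpha>)/2)"
    by (subst cos_diff_cos) (simp add: field_simps)
  also have "sin ((pi/3 - \<alpha>)/2) = - sin ((\<alpha> - pi/3)/2)"
    by (metis minus_diff_eq minus_divide_left sin_minus)
  also have "sin (\<omega> - (pi/3+\<alpha>)/2) = - sin ((pi/3+\<alpha>)/2 - \<omega>)"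
    by (metis minus_diff_eq sin_minus)
  finally have "sin ((pi/3+\<alpha>)/2 - \<omega>) * sin ((\<alpha> - pi/3)/2) > 0" using r60 ra by simp
  moreover have "sin ((\<alpha> - pi/3)/2) \<ge> 0" using a pi_gt_zero by (intro sin_ge_zero; argo)
  ultimately have s2: "sin ((pi/3+\<alpha>)/2 - \<omega>) > 0" by (metis linorder_not_less mult_nonpos_nonneg)
  have o2: "\<omega> < (pi/3+\<alpha>)/2"
  proof (rule ccontr)
    assume "\<not> \<omega> < (pi/3+\<alpha>)/2"
    then have "sin (\<omega> - (pi/3+\<alpha>)/2) \<ge> 0" using om a pi_gt_zero by (intro sin_ge_zero; argo)
    then show False using s2 sin_minus[of "\<omega> - (pi/3+\<alpha>)/2"] by simp
  qed
  text \<open>On the ray of direction \<open>\<omega>\<close>, the point \<open>w\<close> lies between two points of the unit disk around the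
    origin, the first of them in its interior.\<close>
  define w0 where "w0 = cis \<alpha> - cis (2*\<omega>)"
  define w1 where "w1 = cis \<alpha> + cis (-pi/3) - cis (2*\<omega> - pi/3)"
  have dbl: "2 * cos (\<omega> - \<beta>) * cis \<omega> = cis \<beta> + cis (2*\<omega> - \<beta>)" for \<beta>
  proof -
    have "cis \<beta> + cis (2*\<omega> - \<beta>) = cis \<omega> * (cis (\<beta> - \<omega>) + cis (\<omega> - \<beta>))"
      by (simp add: cis_mult distrib_left)
    also have "cis (\<beta> - \<omega>) + cis (\<omega> - \<beta>) = 2 * cos (\<omega> - \<beta>)"
      by (simp add: complex_eq_iff sin_diff cos_diff)
    finally show ?thesis by (simp add: mult.commute)
  qed
  have w0: "w0 = 1 + cis \<alpha> - 2 * cos \<omega> * cis \<omega>" using dbl[of 0] by (simp add: w0_def)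
  have w1: "w1 = 1 + cis \<alpha> - 2 * cos (\<omega> - pi/3) * cis \<omega>"
    unfolding w1_def dbl e60 by simp
  have n0: "norm w0 < 1"
  proof -
    have "cos (\<alpha> - 2*\<omega>) > 1/2" using o1 o2 a by (intro cos_gt_half, unfold abs_less_iff) argo
    then show ?thesis unfolding w0_def not_le[symmetric] norm_ge_1_iff norm_cis_diff_sq by linarith
  qed
  have n1: "norm w1 \<le> 1"
  proof -
    have "cos ((\<alpha> - -pi/3)/2) \<ge> 0" using a pi_gt_zero by (intro cos_ge_zero) (simp_all add: field_simps)
    moreover have "sin ((\<alpha> - (2*\<omega> - pi/3))/2) \<ge> 0" using o1 o2 a pi_gt_zero by (intro sin_ge_zero; argo)
    moreover have "sin (\<omega>) \<ge> 0" using o1 o2 a pi_gt_zero by (intro sin_ge_zero; argo)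
    ultimately have "cos ((\<alpha> - -pi/3)/2) * sin ((\<alpha> - (2*\<omega> - pi/3))/2) * sin ((-pi/3 - (2*\<omega> - pi/3))/2) \<le> 0"
      by (simp add: mult_nonneg_nonneg)
    then have "(norm w1)\<^sup>2 \<le> 1" unfolding w1_def norm_cis_rhombus_sq by (simp add: mult_ac)
    then show ?thesis using norm_gt_1_iff[of w1] by linarith
  qed
  \<comment> \<open>Since \<open>\<rho>\<close> is strictly below the larger bound,
    \<open>l < 1\<close>. So \<open>w0\<close>, the endpoint strictly inside the unit disk, has
    positive weight.\<close>
  define l where "l = (\<rho> - 2 * cos \<omega>) / (2 * cos (\<omega> - pi/3) - 2 * cos \<omega>)"
  have l: "0 \<le> l" "l < 1" using r0 r60 by (auto simp: l_def field_simps)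
  have "\<rho> = (1 - l) * (2 * cos \<omega>) + l * (2 * cos (\<omega> - pi/3))"
  proof -
    have "l * (2 * cos (\<omega> - pi/3) - 2 * cos \<omega>) = \<rho> - 2 * cos \<omega>" using r0 r60 by (simp add: l_def)
    then show ?thesis by (simp add: algebra_simps)
  qed
  then have r: "complex_of_real \<rho> = (1 - l) * (2 * cos \<omega>) + l * (2 * cos (\<omega> - pi/3))"
    by simp
  have "w = 1 + cis \<alpha> - \<rho> * cis \<omega>" unfolding u[symmetric] u_def by simp
  then have "w = (1 - l) *\<^sub>R w0 + l *\<^sub>R w1"
    unfolding r w0 w1 scaleR_conv_of_real by (simp add: algebra_simps)
  then have "norm w \<le> (1 - l) * norm w0 + l * norm w1"
    using norm_triangle_ineq[of "(1 - l) *\<^sub>R w0" "l *\<^sub>R w1"] l by simp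
  also have "\<dots> < (1 - l) * 1 + l * 1" using n0 n1 l by (intro add_less_le_mono mult_strict_left_mono mult_left_mono) auto
  finally show False using w(1) by simp
qed

text \<open>Translation by \<open>v\<close> and rotation by \<open>\<phi>\<close> reduce this to
  \<open>cover_normalized\<close>; \<open>cover_upper\<close> is the mirror image.\<close>

lemma cover_lower:
  assumes a: "\<phi> + pi/3 \<le> t" "t \<le> \<phi> + 2*pi/3"
    and w: "norm (w - v) \<ge> 1" "norm (w - (v + cis \<phi>)) \<ge> 1" "norm (w - (v + cis t)) \<ge> 1"
  shows "norm (w - (v + cis t + cis (\<phi> - pi/3))) \<ge> 1"
proof -
  define x where "x = (w - v) * cis (-\<phi>)"
  have n: "norm (z * cis (-\<phi>)) = norm z" for z by (simp add: norm_mult)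
  have m: "(w - (v + z)) * cis (-\<phi>) = x - z * cis (-\<phi>)" for z by (simp add: x_def algebra_simps)
  have "norm (x - (cis (t - \<phi>) + cis (-pi/3))) \<ge> 1"
    using a w(1) n[of "w - v"] w(2) n[of "w - (v + cis \<phi>)"] m[of "cis \<phi>"]
      w(3) n[of "w - (v + cis t)"] m[of "cis t"]
    by (intro cover_normalized) (auto simp: x_def[symmetric] cis_mult)
  then show ?thesis using n[of "w - (v + (cis t + cis (\<phi> - pi/3)))"] unfolding m
    by (simp add: distrib_right cis_mult add.assoc)
qed

lemma cover_upper:
  assumes a: "\<phi> - 2*pi/3 \<le> t" "t \<le> \<phi> - pi/3"
    and w: "norm (w - v) \<ge> 1" "norm (w - (v + cis \<phi>)) \<ge> 1" "norm (w - (v + cis t)) \<ge> 1"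
  shows "norm (w - (v + cis t + cis (\<phi> + pi/3))) \<ge> 1"
proof -
  have c: "norm (cnj w - (cnj v + cnj z)) = norm (w - (v + z))" for z
    by (metis complex_cnj_add complex_cnj_diff complex_mod_cnj)
  have c0: "norm (cnj w - cnj v) = norm (w - v)" by (metis complex_cnj_diff complex_mod_cnj)
  have "norm (cnj w - (cnj v + cis (-t) + cis (-\<phi> - pi/3))) \<ge> 1"
    using a w c[of "cis \<phi>"] c[of "cis t"] c0 by (intro cover_lower) (auto simp: cis_cnj)
  then show ?thesis using c[of "cis t + cis (\<phi> + pi/3)"] by (simp add: cis_cnj add.assoc)
qed

section \<open>Necessity\<close>

text \<open>If two disks of equal radius share a point, they share the midpoint of their centres. So
  contact and overlap are conditions on the distance of centres, and injectivity follows from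
  positive distance.\<close>

lemma unit_disk_contact_rep_iff:
  "unit_disk_contact_rep n E c r \<longleftrightarrow> r > 0 \<and> (\<forall>u<n. \<forall>v<n. u \<noteq> v \<longrightarrow>
     (if (u, v) \<in> E then dist (c u) (c v) = 2 * r else dist (c u) (c v) > 2 * r))"
proof (cases "r > 0")
  case True
  have meet: "cball x r \<inter> cball y r \<noteq> {} \<longleftrightarrow> dist x y \<le> 2 * r" for x y :: "real \<times> real"
  proof
    assume "cball x r \<inter> cball y r \<noteq> {}"
    then obtain p where "dist x p \<le> r" "dist y p \<le> r" by auto
    then show "dist x y \<le> 2 * r" using dist_triangle2[of x y p] by simp
  next
    assume "dist x y \<le> 2 * r"
    then have "midpoint x y \<in> cball x r \<inter> cball y r" by (simp add: dist_midpoint)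
    then show "cball x r \<inter> cball y r \<noteq> {}" by blast
  qed
  have disj: "interior (cball x r) \<inter> interior (cball y r) = {} \<longleftrightarrow> dist x y \<ge> 2 * r" for x y :: "real \<times> real"
  proof
    assume *: "interior (cball x r) \<inter> interior (cball y r) = {}"
    show "dist x y \<ge> 2 * r"
    proof (rule ccontr)
      assume "\<not> 2 * r \<le> dist x y"
      then have "midpoint x y \<in> interior (cball x r) \<inter> interior (cball y r)" by (simp add: dist_midpoint)
      then show False using * by blast
    qed
  next
    assume *: "dist x y \<ge> 2 * r"
    show "interior (cball x r) \<inter> interior (cball y r) = {}"
    proof (rule ccontr)
      assume "interior (cball x r) \<inter> interior (cball y r) \<noteq> {}"
      then obtain p where "dist x p < r" "dist y p < r" by auto
      then show False using dist_triangle2[of x y p] * by simp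
    qed
  qed
  show ?thesis
  proof
    assume "unit_disk_contact_rep n E c r"
    then have "\<forall>u<n. \<forall>v<n. u \<noteq> v \<longrightarrow> 2 * r \<le> dist (c u) (c v)"
      and "\<forall>u<n. \<forall>v<n. u \<noteq> v \<longrightarrow> (dist (c u) (c v) \<le> 2 * r \<longleftrightarrow> (u, v) \<in> E)"
      unfolding unit_disk_contact_rep_def disk_contact_rep_def meet disj by blast+
    then show "r > 0 \<and> (\<forall>u<n. \<forall>v<n. u \<noteq> v \<longrightarrow>
     (if (u, v) \<in> E then dist (c u) (c v) = 2 * r else dist (c u) (c v) > 2 * r))"
      using True by (simp add: order_antisym not_le[symmetric])
  next
    assume *: "r > 0 \<and> (\<forall>u<n. \<forall>v<n. u \<noteq> v \<longrightarrow>
     (if (u, v) \<in> E then dist (c u) (c v) = 2 * r else dist (c u) (c v) > 2 * r))"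
    have "inj_on (\<lambda>v. cball (c v) r) {0..<n}"
    proof (rule inj_onI, rule ccontr)
      fix u v assume "u \<in> {0..<n}" "v \<in> {0..<n}" "cball (c u) r = cball (c v) r" "u \<noteq> v"
      then have "c u = c v" using True by (simp add: cball_eq_cball_iff)
      then have "dist (c u) (c v) = 0" by simp
      then show False using * \<open>u \<in> _\<close> \<open>v \<in> _\<close> \<open>u \<noteq> v\<close> True
        by (metis atLeastLessThan_iff less_irrefl mult_pos_pos zero_less_numeral order_less_trans)
    qed
    moreover have "dist (c u) (c v) \<ge> 2 * r" if "u < n" "v < n" "u \<noteq> v" for u v
      using * that by (metis less_imp_le order_refl)
    moreover have "dist (c u) (c v) \<le> 2 * r \<longleftrightarrow> (u, v) \<in> E" if "u < n" "v < n" "u \<noteq> v" for u v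
      using * that by (metis not_le order_refl)
    ultimately show "unit_disk_contact_rep n E c r"
      using True unfolding unit_disk_contact_rep_def disk_contact_rep_def meet disj by blast
  qed
qed (simp add: unit_disk_contact_rep_def)

text \<open>The last clause compares degree with membership only at neighbours of spine vertices.
  This admits the tree with a single edge, where both vertices are leaves and one of them has to
  serve as the spine.\<close>

definition spine :: "nat \<Rightarrow> (nat \<times> nat) set \<Rightarrow> nat list \<Rightarrow> bool" where
  "spine n E xs \<longleftrightarrow> graph_on n E \<and> xs \<noteq> [] \<and> distinct xs \<and> set xs \<subseteq> {..<n} \<and>
     (\<forall>i<length xs. \<forall>j<length xs. (xs ! i, xs ! j) \<in> E \<longleftrightarrow> j = Suc i \<or> i = Suc j) \<and>
     (\<forall>v<n. v \<notin> set xs \<longrightarrow> (\<exists>u\<in>set xs. \<forall>w. (v, w) \<in> E \<longleftrightarrow> w = u)) \<and>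
     (\<forall>u\<in>set xs. \<forall>v. (u, v) \<in> E \<longrightarrow> (v \<in> set xs \<longleftrightarrow> degree E v \<noteq> 1))"

text \<open>When \<open>narrow\<close> holds, the disks placed so far confine the neighbours of the next spine
  disk to a sector of angle less than \<open>\<pi>\<close>; this starts at a vertex of degree 5 and is relaxed
  only by a vertex of degree at most 3.\<close>

fun narrow :: "(nat \<times> nat) set \<Rightarrow> nat list \<Rightarrow> nat \<Rightarrow> bool" where
  "narrow E xs 0 = False"
| "narrow E xs (Suc i) = (degree E (xs ! i) \<ge> 5 \<or> degree E (xs ! i) \<ge> 4 \<and> narrow E xs i)"

definition feasible :: "(nat \<times> nat) set \<Rightarrow> nat list \<Rightarrow> bool" where
  "feasible E xs \<longleftrightarrow> (\<forall>i<length xs. degree E (xs ! i) \<le> 5 \<and> (degree E (xs ! i) \<ge> 5 \<longrightarrow> \<not> narrow E xs i))"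

section \<open>Elementary facts on spines\<close>

lemma spine_nth_lt: "spine n E xs \<Longrightarrow> i < length xs \<Longrightarrow> xs ! i < n"
  unfolding spine_def by (metis lessThan_iff nth_mem subsetD)

lemma spine_edge_lt: "spine n E xs \<Longrightarrow> (u, v) \<in> E \<Longrightarrow> u < n \<and> v < n \<and> u \<noteq> v \<and> (v, u) \<in> E"
  unfolding spine_def graph_on_def sym_def by force

lemma spine_nbr_cases:
  assumes "spine n E xs" "i < length xs" "(xs ! i, y) \<in> E"
  obtains "y \<notin> set xs" "\<And>w. (y, w) \<in> E \<Longrightarrow> w = xs ! i"
  | "Suc i < length xs" "y = xs ! Suc i"
  | j where "i = Suc j" "y = xs ! j"
proof (cases "y \<in> set xs")
  case True
  then obtain j where "j < length xs" "y = xs ! j" by (metis in_set_conv_nth)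
  then show ?thesis using assms that unfolding spine_def by metis
next
  case False
  have "y < n" "(y, xs ! i) \<in> E" using spine_edge_lt[OF assms(1,3)] by auto
  then show ?thesis using False assms that(1) unfolding spine_def by metis
qed

lemma finite_nbrs: "spine n E xs \<Longrightarrow> finite {u. (v, u) \<in> E}"
  by (rule finite_subset[of _ "{..<n}"]) (auto dest: spine_edge_lt)

text \<open>A configuration of disk centers, scaled so that touching disks have distance 1.\<close>

locale unit_drawing =
  fixes n :: nat and E :: "(nat \<times> nat) set" and xs :: "nat list" and z :: "nat \<Rightarrow> complex"
  assumes sp: "spine n E xs"
    and adj: "(u, v) \<in> E \<Longrightarrow> norm (z u - z v) = 1"
    and nonadj: "u < n \<Longrightarrow> v < n \<Longrightarrow> u \<noteq> v \<Longrightarrow> (u, v) \<notin> E \<Longrightarrow> norm (z u - z v) > 1"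
begin

lemma sep: "u < n \<Longrightarrow> v < n \<Longrightarrow> u \<noteq> v \<Longrightarrow> norm (z u - z v) \<ge> 1"
  using adj nonadj by (metis less_imp_le order_refl)

text \<open>A triangle would contradict the shape of a path with leaves attached. The strict
  inequality makes all gaps around a vertex exceed pi/3, and this leaves a sector of less than pi
  beside a vertex of degree 5.\<close>

lemma nbrs_sep:
  assumes i: "i < length xs" and "(xs ! i, y) \<in> E" "(xs ! i, y') \<in> E" "y \<noteq> y'"
  shows "norm (z y - z y') > 1"
proof (rule nonadj)
  show "y < n" "y' < n" using spine_edge_lt[OF sp] assms by blast+
  show "(y, y') \<notin> E"
  proof
    assume e: "(y, y') \<in> E"
    then have e': "(y', y) \<in> E" using spine_edge_lt[OF sp] by blast
    have ne: "y' \<noteq> xs ! i" "y \<noteq> xs ! i" using spine_edge_lt[OF sp] assms by blast+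
    from sp i assms(2) show False
    proof (cases rule: spine_nbr_cases)
      case 1 then show ?thesis using e ne by blast
    next
      case 2 note a = this
      from sp i assms(3) show ?thesis
      proof (cases rule: spine_nbr_cases)
        case 1 then show ?thesis using e' ne by blast
      qed (use a e i assms sp in \<open>auto simp: spine_def\<close>)
    next
      case (3 j) note a = this
      from sp i assms(3) show ?thesis
      proof (cases rule: spine_nbr_cases)
        case 1 then show ?thesis using e' ne by blast
      qed (use a e i assms sp in \<open>auto simp: spine_def\<close>)
    qed
  qed
qed fact

text \<open>Angles are measured counterclockwise from \<open>f\<close> and represented in [0, 2 pi).
  The neighbour \<open>f\<close> then sits at both ends of this interval, so separation from it on
  either side confines all others to the open interval from pi/3 to 5 pi/3.\<close>

lemma star_angles:
  assumes i: "i < length xs" and f: "(xs ! i, f) \<in> E" and t: "z f = z (xs ! i) + cis t"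
  shows "\<exists>\<psi>. (\<forall>y. (xs ! i, y) \<in> E \<longrightarrow> y \<noteq> f \<longrightarrow>
        z y = z (xs ! i) + cis (t + \<psi> y) \<and> pi/3 < \<psi> y \<and> \<psi> y < 5*pi/3) \<and>
      (\<forall>y y'. (xs ! i, y) \<in> E \<longrightarrow> (xs ! i, y') \<in> E \<longrightarrow> y \<noteq> f \<longrightarrow> y' \<noteq> f \<longrightarrow> y \<noteq> y' \<longrightarrow>
        \<bar>\<psi> y - \<psi> y'\<bar> > pi/3)"
proof -
  let ?v = "xs ! i"
  define \<psi> where "\<psi> y = Arg2pi ((z y - z ?v) * cis (-t))" for y
  have r: "0 \<le> \<psi> y" "\<psi> y < 2*pi" for y
    using Arg2pi[of "(z y - z ?v) * cis (-t)"] by (auto simp: \<psi>_def)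
  have 1: "z y = z ?v + cis (t + \<psi> y)" if y: "(?v, y) \<in> E" for y
  proof -
    have n: "norm ((z y - z ?v) * cis (-t)) = 1" using adj[OF y] by (simp add: norm_mult norm_minus_commute)
    have "(z y - z ?v) * cis (-t) = cis (\<psi> y)"
      using Arg2pi_eq[of "(z y - z ?v) * cis (-t)"] n unfolding \<psi>_def[symmetric] by (simp add: cis_conv_exp)
    then have "(z y - z ?v) * (cis (-t) * cis t) = cis (\<psi> y) * cis t" by (metis mult.assoc)
    then show ?thesis by (simp add: cis_mult algebra_simps)
  qed
  show ?thesis
  proof (intro exI[of _ \<psi>] conjI allI impI)
    fix y assume y: "(?v, y) \<in> E" "y \<noteq> f"
    show "z y = z ?v + cis (t + \<psi> y)" by (rule 1) fact
    have g: "norm (cis (t + \<psi> y) - cis t) > 1" using nbrs_sep[OF i y(1) f y(2)] t 1[OF y(1)] by simp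
    show "pi/3 < \<psi> y" using cis_sep_gt[OF g] r[of y] by simp
    have "cis (t + 2*pi) = cis t" by (simp add: complex_eq_iff)
    then have "norm (cis (t + \<psi> y) - cis (t + 2*pi)) > 1" using g by simp
    from cis_sep_gt[OF this] show "\<psi> y < 5*pi/3" using r[of y] by (simp add: abs_if split: if_splits)
  next
    fix y y' assume y: "(?v, y) \<in> E" "(?v, y') \<in> E" "y \<noteq> f" "y' \<noteq> f" "y \<noteq> y'"
    have "norm (cis (t + \<psi> y) - cis (t + \<psi> y')) > 1"
      using nbrs_sep[OF i y(1,2,5)] 1[OF y(1)] 1[OF y(2)] by simp
    from cis_sep_gt[OF this] show "\<bar>\<psi> y - \<psi> y'\<bar> > pi/3" by simp
  qed
qed

lemma nbr_angle: assumes "(u, v) \<in> E" obtains t where "z v = z u + cis t"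
proof -
  have "norm (z v - z u) = 1" using adj[OF assms] by (simp add: norm_minus_commute)
  then have "z v - z u = cis (Arg (z v - z u))" using rcis_cmod_Arg[of "z v - z u"] by (simp add: rcis_def)
  then show thesis using that[of "Arg (z v - z u)"] by (metis add.commute diff_add_cancel)
qed

text \<open>The witnesses are the neighbours of smallest and largest angle among the
  \<open>m + 1\<close> that differ from \<open>f\<close>.\<close>

lemma star_spread:
  assumes i: "i < length xs" and f: "(xs ! i, f) \<in> E" and t: "z f = z (xs ! i) + cis t"
    and d: "degree E (xs ! i) = Suc (Suc m)" "m > 0"
  obtains a b \<alpha> \<beta> where "(xs ! i, a) \<in> E" "a \<noteq> f" "(xs ! i, b) \<in> E" "b \<noteq> f"
    "z a = z (xs ! i) + cis (t + \<alpha>)" "z b = z (xs ! i) + cis (t + \<beta>)"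
    "pi/3 < \<alpha>" "\<alpha> < 5*pi/3" "pi/3 < \<beta>" "\<beta> < 5*pi/3" "\<beta> - \<alpha> > m * (pi/3)"
proof -
  from star_angles[OF i f t] obtain \<psi> where \<psi>:
    "\<And>y. (xs ! i, y) \<in> E \<Longrightarrow> y \<noteq> f \<Longrightarrow> z y = z (xs ! i) + cis (t + \<psi> y)"
    "\<And>y. (xs ! i, y) \<in> E \<Longrightarrow> y \<noteq> f \<Longrightarrow> pi/3 < \<psi> y"
    "\<And>y. (xs ! i, y) \<in> E \<Longrightarrow> y \<noteq> f \<Longrightarrow> \<psi> y < 5*pi/3"
    "\<And>y y'. (xs ! i, y) \<in> E \<Longrightarrow> (xs ! i, y') \<in> E \<Longrightarrow> y \<noteq> f \<Longrightarrow> y' \<noteq> f \<Longrightarrow> y \<noteq> y' \<Longrightarrow> \<bar>\<psi> y - \<psi> y'\<bar> > pi/3"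
    by blast
  let ?Y = "{u. (xs ! i, u) \<in> E} - {f}" let ?T = "\<psi> ` ?Y"
  have fin: "finite ?Y" using finite_nbrs[OF sp] by simp
  have "inj_on \<psi> ?Y"
  proof (rule inj_onI, rule ccontr)
    fix x y assume "x \<in> ?Y" "y \<in> ?Y" "\<psi> x = \<psi> y" "x \<noteq> y"
    then show False using \<psi>(4)[of x y] pi_gt_zero by simp
  qed
  then have "card ?T = card ?Y" by (rule card_image)
  also have "\<dots> = Suc m" using d f finite_nbrs[OF sp] by (simp add: degree_def)
  finally have c: "card ?T = Suc m" .
  have "Max ?T - Min ?T > m * (pi/3)"
    by (rule separated_spread_gt) (use fin c d(2) \<psi>(4) in auto)
  moreover have "?T \<noteq> {}" using c by (metis card.empty nat.distinct(1))
  then have "Max ?T \<in> ?T" "Min ?T \<in> ?T" 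
    using Max_in[of ?T] Min_in[of ?T] finite_imageI[OF fin] by blast+
  then obtain b where "b \<in> ?Y" "Max ?T = \<psi> b" by blast
  moreover obtain a where "a \<in> ?Y" "Min ?T = \<psi> a" using \<open>Min ?T \<in> ?T\<close> by blast
  ultimately show thesis using that[of a b "\<psi> a" "\<psi> b"] \<psi>(1-3) by simp
qed

text \<open>With six or more neighbours, at least five besides \<open>f\<close> would spread over
  more than 4 pi/3, which is the length of the interval available to them.\<close>

lemma degree_le_5: assumes i: "i < length xs" shows "degree E (xs ! i) \<le> 5"
proof (rule ccontr)
  assume *: "\<not> ?thesis"
  then obtain m where m: "degree E (xs ! i) = Suc (Suc m)" "m \<ge> 4"
    by (intro that[of "degree E (xs ! i) - 2"]) auto
  then have "{u. (xs ! i, u) \<in> E} \<noteq> {}" unfolding degree_def by (metis card.empty nat.distinct(1))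
  then obtain f where f: "(xs ! i, f) \<in> E" by blast
  obtain t where "z f = z (xs ! i) + cis t" using nbr_angle[OF f] .
  from star_spread[OF i f this m(1)] m(2) obtain \<alpha> \<beta> where
    "pi/3 < \<alpha>" "\<beta> < 5*pi/3" "\<beta> - \<alpha> > m * (pi/3)" by (metis zero_less_numeral order_less_le_trans)
  moreover have "real m * (pi/3) \<ge> 4 * (pi/3)" using m by (intro mult_right_mono) auto
  ultimately show False by argo
qed

text \<open>The sector at \<open>xs ! Suc i\<close> is recorded by two positions at unit distance
  from the centre of \<open>xs ! i\<close>, in directions on either side of the next spine disk.
  They may be centres of leaves or empty; what counts is that later neighbours stay away from them.
  The clause ranges over all later spine vertices because the covering argument uses the same
  positions again for vertices further along.\<close>

definition confined :: "nat \<Rightarrow> bool" where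
  "confined i \<longleftrightarrow> (\<exists>\<phi>1 \<phi>2 t. z (xs ! Suc i) = z (xs ! i) + cis t \<and> \<phi>1 + pi/3 \<le> t \<and> t \<le> \<phi>2 - pi/3 \<and> \<phi>2 - \<phi>1 < pi \<and>
     (\<forall>j y. Suc i \<le> j \<longrightarrow> j < length xs \<longrightarrow> (xs ! j, y) \<in> E \<longrightarrow> y \<noteq> xs ! i \<longrightarrow> y \<noteq> xs ! Suc i \<longrightarrow>
        norm (z y - (z (xs ! i) + cis \<phi>1)) \<ge> 1 \<and> norm (z y - (z (xs ! i) + cis \<phi>2)) \<ge> 1))"

text \<open>A common neighbour of two spine vertices lies between them on the spine, so for a later
  second vertex it could only be \<open>xs ! Suc i\<close>.\<close>

lemma far_nbr_distinct:
  assumes i: "i < length xs" and a: "(xs ! i, a) \<in> E" and j: "j < length xs" "i < j" and y: "(xs ! j, y) \<in> E"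
    and ne: "a \<noteq> xs ! Suc i"
  shows "y \<noteq> a"
proof
  assume "y = a"
  then have e: "(a, xs ! j) \<in> E" using spine_edge_lt[OF sp y] by blast
  from sp i a show False
  proof (cases rule: spine_nbr_cases)
    case 1
    then have "xs ! j = xs ! i" using e by blast
    then show ?thesis using i j sp by (simp add: spine_def nth_eq_iff_index_eq)
  next
    case (3 k)
    then show ?thesis using e i j sp by (auto simp: spine_def)
  qed (use ne in simp)
qed

lemma confined_start:
  assumes i: "Suc i < length xs" and d: "degree E (xs ! i) \<ge> 5"
  shows "confined i"
proof -
  have i': "i < length xs" using i by simp
  have f: "(xs ! i, xs ! Suc i) \<in> E" using sp i unfolding spine_def by auto
  obtain t where t: "z (xs ! Suc i) = z (xs ! i) + cis t" using nbr_angle[OF f] .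
  have d': "degree E (xs ! i) = Suc (Suc 3)" using d degree_le_5[OF i'] by simp
  obtain a b \<alpha> \<beta> where ab:
    "(xs ! i, a) \<in> E" "a \<noteq> xs ! Suc i" "(xs ! i, b) \<in> E" "b \<noteq> xs ! Suc i"
    "z a = z (xs ! i) + cis (t + \<alpha>)" "z b = z (xs ! i) + cis (t + \<beta>)"
    "pi/3 < \<alpha>" "\<alpha> < 5*pi/3" "pi/3 < \<beta>" "\<beta> < 5*pi/3" "\<beta> - \<alpha> > real 3 * (pi/3)" by (rule star_spread[OF i' f t d']) (simp, rule that)
  have ba: "\<beta> - \<alpha> > pi" using ab(11) by simp
  have cb: "cis (t + \<beta> - 2*pi) = cis (t + \<beta>)"
    using cos_periodic[of "t + \<beta> - 2*pi"] sin_periodic[of "t + \<beta> - 2*pi"] by (simp add: complex_eq_iff)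
  show ?thesis unfolding confined_def
  \<comment> \<open>The four neighbours other than the next spine vertex spread over more than pi,
    so the gap around direction \<open>t\<close> is smaller than pi. It is bounded by the first of
    them and by the last, whose angle is lowered by a full turn.\<close>
  proof (rule exI[of _ "t + \<beta> - 2*pi"], rule exI[of _ "t + \<alpha>"], rule exI[of _ t], intro conjI t allI impI)
    fix j y assume j: "Suc i \<le> j" "j < length xs" and y: "(xs ! j, y) \<in> E" "y \<noteq> xs ! i" "y \<noteq> xs ! Suc i"
    have lt: "y < n" "a < n" "b < n" using spine_edge_lt[OF sp] y ab by blast+
    show "norm (z y - (z (xs ! i) + cis (t + \<alpha>))) \<ge> 1"
      unfolding ab(5)[symmetric] using far_nbr_distinct[OF i' ab(1) j(2) _ y(1) ab(2)] j by (intro sep lt) simp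
    show "norm (z y - (z (xs ! i) + cis (t + \<beta> - 2*pi))) \<ge> 1"
      unfolding cb ab(6)[symmetric] using far_nbr_distinct[OF i' ab(3) j(2) _ y(1) ab(4)] j by (intro sep lt) simp
  qed (use ab(1-10) ba in argo)+
qed

text \<open>A neighbour of \<open>xs ! Suc i\<close> touching a blocked position completes a
  rhombus, hence has direction \<open>\<phi>1\<close> or \<open>\<phi>2\<close>; the window lemmas
  exclude everything beyond. They need \<open>t\<close> to be at most 2 pi/3 away from both ends,
  which follows from \<open>\<phi>2 - \<phi>1 < pi\<close> and the gaps of pi/3.\<close>

lemma confined_angles:
  assumes i: "Suc i < length xs"
    and st: "z (xs ! Suc i) = z (xs ! i) + cis t" "\<phi>1 + pi/3 \<le> t" "t \<le> \<phi>2 - pi/3" "\<phi>2 - \<phi>1 < pi"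
      "\<forall>j y. Suc i \<le> j \<longrightarrow> j < length xs \<longrightarrow> (xs ! j, y) \<in> E \<longrightarrow> y \<noteq> xs ! i \<longrightarrow> y \<noteq> xs ! Suc i \<longrightarrow>
        norm (z y - (z (xs ! i) + cis \<phi>1)) \<ge> 1 \<and> norm (z y - (z (xs ! i) + cis \<phi>2)) \<ge> 1"
    and y: "(xs ! Suc i, y) \<in> E" "y \<noteq> xs ! i"
  shows "\<exists>u. z y = z (xs ! Suc i) + cis u \<and> \<phi>1 \<le> u \<and> u \<le> \<phi>2"
proof -
  define a where "a = Arg ((z y - z (xs ! Suc i)) * cis (-t))"
  have n: "norm ((z y - z (xs ! Suc i)) * cis (-t)) = 1" using adj[OF y(1)] by (simp add: norm_mult norm_minus_commute)
  then have "(z y - z (xs ! Suc i)) * cis (-t) = cis a"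
    using rcis_cmod_Arg[of "(z y - z (xs ! Suc i)) * cis (-t)"] by (simp add: rcis_def a_def)
  then have "(z y - z (xs ! Suc i)) * (cis (-t) * cis t) = cis a * cis t" by (metis mult.assoc)
  then have zy: "z y = z (xs ! Suc i) + cis (t + a)" by (simp add: cis_mult algebra_simps)
  have lt: "y < n" "xs ! i < n" "y \<noteq> xs ! Suc i" using spine_edge_lt[OF sp y(1)] spine_nth_lt[OF sp] i by auto
  have "-pi < a" "a \<le> pi" using mpi_less_Arg Arg_le_pi by (auto simp: a_def)
  moreover have "a \<noteq> pi"
  proof
    assume "a = pi"
    then have "cis (t + a) = - cis t" by (simp add: complex_eq_iff)
    then have "z y = z (xs ! i)" using zy st(1) by simp
    then show False using sep[OF lt(1,2) y(2)] by simp
  qed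
  ultimately have a: "\<bar>t + a - t\<bar> < pi" by simp
  have *: "z y - (z (xs ! i) + w) = cis t + cis (t + a) - w" for w using zy st(1) by simp
  have "norm (cis t + cis (t + a) - cis \<phi>1) \<ge> 1" "norm (cis t + cis (t + a) - cis \<phi>2) \<ge> 1"
    using st(5)[rule_format, OF _ i y(1,2) lt(3)] unfolding * by auto
  then have "\<phi>1 \<le> t + a" "t + a \<le> \<phi>2"
    using st(2-4) by (intro window_lower[OF _ _ a] window_upper[OF _ _ a]; argo)+
  then show ?thesis using zy by blast
qed

text \<open>Four neighbours with gaps of at least pi/3 have spread at least pi and do not fit into
  the sector. At degree 4 there are two leaves \<open>a\<close>, \<open>b\<close> and the next spine
  vertex, and the new sector depends on their order by angle.\<close>

lemma confined_step:
  assumes i: "Suc i < length xs" and c: "confined i"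
  shows "degree E (xs ! Suc i) < 5" and
    "degree E (xs ! Suc i) \<ge> 4 \<Longrightarrow> Suc (Suc i) < length xs \<Longrightarrow> confined (Suc i)"
proof -
  let ?v = "xs ! i" and ?f = "xs ! Suc i"
  from c obtain \<phi>1 \<phi>2 t where st: "z ?f = z ?v + cis t" "\<phi>1 + pi/3 \<le> t" "t \<le> \<phi>2 - pi/3" "\<phi>2 - \<phi>1 < pi"
      "\<forall>j y. Suc i \<le> j \<longrightarrow> j < length xs \<longrightarrow> (xs ! j, y) \<in> E \<longrightarrow> y \<noteq> ?v \<longrightarrow> y \<noteq> ?f \<longrightarrow>
        norm (z y - (z ?v + cis \<phi>1)) \<ge> 1 \<and> norm (z y - (z ?v + cis \<phi>2)) \<ge> 1"
    unfolding confined_def by blast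
  have "\<forall>y. \<exists>u. (?f, y) \<in> E \<longrightarrow> y \<noteq> ?v \<longrightarrow> z y = z ?f + cis u \<and> \<phi>1 \<le> u \<and> u \<le> \<phi>2"
    using confined_angles[OF i st] by blast
  then obtain u where u: "\<And>y. (?f, y) \<in> E \<Longrightarrow> y \<noteq> ?v \<Longrightarrow> z y = z ?f + cis (u y) \<and> \<phi>1 \<le> u y \<and> u y \<le> \<phi>2"
    by metis
  have us: "\<bar>u y - u y'\<bar> \<ge> pi/3" if "(?f, y) \<in> E" "(?f, y') \<in> E" "y \<noteq> ?v" "y' \<noteq> ?v" "y \<noteq> y'" for y y'
    using nbrs_sep[OF i that(1,2,5)] u that by (intro cis_sep_ge) simp
  let ?Y = "{y. (?f, y) \<in> E} - {?v}"
  have fin: "finite ?Y" using finite_nbrs[OF sp] by simp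
  have fv: "(?f, ?v) \<in> E" using sp i unfolding spine_def by auto
  have card: "card ?Y = degree E ?f - 1" using fv finite_nbrs[OF sp] by (simp add: degree_def)
  show "degree E ?f < 5"
  proof (rule ccontr)
    assume d: "\<not> degree E ?f < 5"
    let ?T = "u ` ?Y"
    have "inj_on u ?Y"
    proof (rule inj_onI, rule ccontr)
      fix x y assume "x \<in> ?Y" "y \<in> ?Y" "u x = u y" "x \<noteq> y"
      then show False using us[of x y] pi_gt_zero by simp
    qed
    then have cT: "card ?T = Suc (degree E ?f - 2)" using card d by (simp add: card_image)
    have sprd: "Max ?T - Min ?T \<ge> real (degree E ?f - 2) * (pi/3)"
      by (rule separated_spread) (use fin us cT in auto)
    have "real (degree E ?f - 2) * (pi/3) \<ge> 3 * (pi/3)" using d by (intro mult_right_mono) auto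
    then have w: "Max ?T - Min ?T \<ge> pi" using sprd by argo
    have "?T \<noteq> {}" using cT by (metis card.empty nat.distinct(1))
    then have "Max ?T \<in> ?T" "Min ?T \<in> ?T" 
    using Max_in[of ?T] Min_in[of ?T] finite_imageI[OF fin] by blast+
    moreover have "\<forall>x\<in>?T. \<phi>1 \<le> x \<and> x \<le> \<phi>2" using u by blast
    ultimately have "Max ?T \<le> \<phi>2" "Min ?T \<ge> \<phi>1" by blast+
    then show False using st(4) w by argo
  qed
  assume d: "degree E ?f \<ge> 4" and i2: "Suc (Suc i) < length xs"
  let ?g = "xs ! Suc (Suc i)"
  have fg: "(?f, ?g) \<in> E" using sp i2 unfolding spine_def by auto
  have gv: "?g \<noteq> ?v" using sp i i2 by (simp add: spine_def nth_eq_iff_index_eq)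
  have "card (?Y - {?g}) \<ge> 2" using card d fin fg gv by simp
  then obtain a b where ab: "a \<in> ?Y - {?g}" "b \<in> ?Y - {?g}" "a \<noteq> b"
    by (metis (no_types, lifting) card_le_Suc0_iff_eq fin finite_Diff not_less_eq_eq numeral_2_eq_2)
  have lt: "a < n" "b < n" "?f < n" "?v < n" using ab spine_edge_lt[OF sp] fv by blast+
  have later: "norm (z y - z ?v) \<ge> 1 \<and> norm (z y - z ?f) \<ge> 1 \<and> norm (z y - z a) \<ge> 1 \<and> norm (z y - z b) \<ge> 1
      \<and> norm (z y - (z ?v + cis \<phi>1)) \<ge> 1 \<and> norm (z y - (z ?v + cis \<phi>2)) \<ge> 1"
    if j: "Suc (Suc i) \<le> j" "j < length xs" "(xs ! j, y) \<in> E" and y: "y \<noteq> ?f" "y \<noteq> ?g" for j y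
  proof -
    have yn: "y < n" using j spine_edge_lt[OF sp] by blast
    have "y \<noteq> a" "y \<noteq> b" "y \<noteq> ?v"
      using far_nbr_distinct[OF i _ j(2) _ j(3)] ab j fv gv by auto
    then show ?thesis using sep yn lt y st(5)[rule_format, OF _ j(2,3)] j(1) by simp
  qed
  have ang: "z x = z ?f + cis (u x)" "\<phi>1 \<le> u x" "u x \<le> \<phi>2" if "x \<in> {a, b, ?g}" for x
    using u[of x] that ab fg gv by auto
  have s: "\<bar>u a - u ?g\<bar> \<ge> pi/3" "\<bar>u b - u ?g\<bar> \<ge> pi/3" "\<bar>u a - u b\<bar> \<ge> pi/3"
    using us ab fg gv by auto
  have intro: "confined (Suc i)" if "\<psi>1 + pi/3 \<le> u ?g" "u ?g \<le> \<psi>2 - pi/3" "\<psi>2 - \<psi>1 < pi"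
    "\<And>j y. Suc (Suc i) \<le> j \<Longrightarrow> j < length xs \<Longrightarrow> (xs ! j, y) \<in> E \<Longrightarrow> y \<noteq> ?f \<Longrightarrow> y \<noteq> ?g \<Longrightarrow>
        norm (z y - (z ?f + cis \<psi>1)) \<ge> 1 \<and> norm (z y - (z ?f + cis \<psi>2)) \<ge> 1" for \<psi>1 \<psi>2
    unfolding confined_def using that ang(1)[of ?g] by blast
  have t1: "t \<le> \<phi>1 + 2*pi/3" "\<phi>2 - 2*pi/3 \<le> t" using st(2-4) by argo+
  \<comment> \<open>The position lies outside the old sector. The disks of \<open>xs ! i\<close> and
    \<open>xs ! Suc i\<close> together with the old blocked position cover it, so it is blocked
    although nothing was placed there.\<close>
  have low: "norm (z y - (z ?f + cis (\<phi>1 - pi/3))) \<ge> 1"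
    if "Suc (Suc i) \<le> j" "j < length xs" "(xs ! j, y) \<in> E" "y \<noteq> ?f" "y \<noteq> ?g" for j y
    using later[OF that] unfolding st(1) by (intro cover_lower[OF st(2) t1(1)]) auto
  have up: "norm (z y - (z ?f + cis (\<phi>2 + pi/3))) \<ge> 1"
    if "Suc (Suc i) \<le> j" "j < length xs" "(xs ! j, y) \<in> E" "y \<noteq> ?f" "y \<noteq> ?g" for j y
    using later[OF that] unfolding st(1) by (intro cover_upper[OF t1(2) st(3)]) auto
  have leaf: "norm (z y - (z ?f + cis (u m))) \<ge> 1"
    if "m \<in> {a, b}" "Suc (Suc i) \<le> j" "j < length xs" "(xs ! j, y) \<in> E" "y \<noteq> ?f" "y \<noteq> ?g" for m j y
    using later[OF that(2-6)] that(1) ang(1)[of m] by auto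
  have "u a \<noteq> u ?g" "u b \<noteq> u ?g" using s pi_gt_zero by fastforce+
  then consider "u a < u ?g" "u ?g < u b" | "u b < u ?g" "u ?g < u a"
    | "u ?g < u a" "u ?g < u b" | "u a < u ?g" "u b < u ?g"
    by linarith
  then show "confined (Suc i)"
  proof cases
    case 1
    have "u a + pi/3 \<le> u ?g" "u ?g \<le> u b - pi/3" using 1 s by simp_all
    moreover have "u b - u a < pi" using ang(2)[of a] ang(3)[of b] st(4) by simp
    ultimately show ?thesis using leaf by (intro intro[of "u a" "u b"]) blast+
  next
    case 2
    have "u b + pi/3 \<le> u ?g" "u ?g \<le> u a - pi/3" using 2 s by simp_all
    moreover have "u a - u b < pi" using ang(2)[of b] ang(3)[of a] st(4) by simp
    ultimately show ?thesis using leaf by (intro intro[of "u b" "u a"]) blast+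
  next
    \<comment> \<open>Both leaves lie above the next spine vertex. The nearer one, \<open>m\<close>,
      becomes the new upper bound. The farther one still has to fit below \<open>\<phi>2\<close>, so
      \<open>u m\<close> is at most \<open>\<phi>2 - pi/3\<close>, which pays for lowering the other
      bound by pi/3.\<close>
    case 3
    obtain m where m: "m \<in> {a, b}" "u ?g + pi/3 \<le> u m" "u m \<le> \<phi>2 - pi/3"
    proof (cases "u a < u b")
      case True
      then show thesis using 3 s ang(3)[of b] by (intro that[of a]) simp_all
    next
      case False
      then show thesis using 3 s ang(3)[of a] by (intro that[of b]) simp_all
    qed
    have "\<phi>1 - pi/3 + pi/3 \<le> u ?g" "u ?g \<le> u m - pi/3" using m ang(2)[of ?g] by simp_all
    moreover have "u m - (\<phi>1 - pi/3) < pi" using m st(4) by simp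
    ultimately show ?thesis using leaf[OF m(1)] low by (intro intro[of "\<phi>1 - pi/3" "u m"]) blast+
  next
    case 4
    obtain m where m: "m \<in> {a, b}" "u m \<le> u ?g - pi/3" "\<phi>1 + pi/3 \<le> u m"
    proof (cases "u a < u b")
      case True
      then show thesis using 4 s ang(2)[of a] by (intro that[of b]) simp_all
    next
      case False
      then show thesis using 4 s ang(2)[of b] by (intro that[of a]) simp_all
    qed
    have "u m + pi/3 \<le> u ?g" "u ?g \<le> \<phi>2 + pi/3 - pi/3" using m ang(3)[of ?g] by simp_all
    moreover have "\<phi>2 + pi/3 - u m < pi" using m st(4) by simp
    ultimately show ?thesis using leaf[OF m(1)] up by (intro intro[of "u m" "\<phi>2 + pi/3"]) blast+
  qed
qed

lemma narrow_confined: "narrow E xs (Suc i) \<Longrightarrow> Suc i < length xs \<Longrightarrow> confined i"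
proof (induction i)
  case 0
  then show ?case by (intro confined_start) auto
next
  case (Suc i)
  then show ?case by (metis confined_start confined_step(2) narrow.simps(2) Suc_lessD)
qed

lemma feasible: "feasible E xs"
  unfolding feasible_def
proof (intro allI impI conjI)
  fix i assume i: "i < length xs"
  show "degree E (xs ! i) \<le> 5" by (rule degree_le_5[OF i])
  assume d: "5 \<le> degree E (xs ! i)"
  show "\<not> narrow E xs i"
  proof
    assume n: "narrow E xs i"
    then obtain j where "i = Suc j" by (cases i) auto
    then show False using confined_step(1)[of j] narrow_confined[of j] n d i by simp
  qed
qed

end

theorem UDC_imp_feasible:
  assumes "spine n E xs" "UDC_graph n E"
  shows "feasible E xs"
proof -
  obtain c r where "unit_disk_contact_rep n E c r" using assms(2) by (auto simp: UDC_graph_def)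
  then have r: "r > 0" and d: "\<And>u v. u < n \<Longrightarrow> v < n \<Longrightarrow> u \<noteq> v \<Longrightarrow>
      if (u, v) \<in> E then dist (c u) (c v) = 2 * r else dist (c u) (c v) > 2 * r"
    unfolding unit_disk_contact_rep_iff by blast+
  define z where "z v = Complex (fst (c v) / (2*r)) (snd (c v) / (2*r))" for v
  have z: "norm (z u - z v) = dist (c u) (c v) / (2 * r)" for u v
  proof -
    have "norm (z u - z v) = sqrt (((fst (c u) - fst (c v)) / (2*r))\<^sup>2 + ((snd (c u) - snd (c v)) / (2*r))\<^sup>2)"
      by (simp add: cmod_def z_def diff_divide_distrib)
    also have "\<dots> = sqrt (((fst (c u) - fst (c v))\<^sup>2 + (snd (c u) - snd (c v))\<^sup>2) / (2*r)\<^sup>2)"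
      by (simp add: power_divide add_divide_distrib)
    also have "\<dots> = sqrt ((fst (c u) - fst (c v))\<^sup>2 + (snd (c u) - snd (c v))\<^sup>2) / (2*r)"
      using r by (simp only: real_sqrt_divide real_sqrt_abs)
    also have "\<dots> = dist (c u) (c v) / (2 * r)"
      by (cases "c u"; cases "c v") (simp add: dist_Pair_Pair dist_real_def)
    finally show ?thesis .
  qed
  interpret unit_drawing n E xs z
  proof
    show "norm (z u - z v) = 1" if "(u, v) \<in> E" for u v
      using d[of u v] spine_edge_lt[OF assms(1) that] that r by (simp add: z)
    show "norm (z u - z v) > 1" if "u < n" "v < n" "u \<noteq> v" "(u, v) \<notin> E" for u v
      using d[OF that(1-3)] that(4) r by (simp add: z)
  qed fact
  show ?thesis by (rule feasible)
qed

section \<open>Positions on a bent arc\<close>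

text \<open>The spine is drawn on a slightly bent arc close to the triangular lattice. Every spine disk
  offers three places for leaves, close to the directions \<open>2\<pi>/3\<close>, \<open>\<pi>/3\<close> and \<open>-\<pi>/3\<close>.\<close>

datatype place = Spine | Back | Front | Lower

text \<open>\<open>\<eta>\<close> is the unit of drift and \<open>N\<close> bounds the positions
  that carry leaves. The bound 1/1000 keeps every direction within 1/100 of its lattice value, so
  coarse rational boxes settle all pairs that are not tight.\<close>

locale bent_arc =
  fixes \<eta> :: real and N :: nat
  assumes \<eta>: "\<eta> > 0" "\<eta> * (real N + 1) \<le> 1/1000"
begin

text \<open>Direction of the step from position \<open>j\<close> to the next. Consecutive steps
  differ by 3 \<eta>, so the upper side of a spine disk spans pi + 3 \<eta>, and \<open>Back\<close>
  and \<open>Front\<close> divide it into three equal gaps of pi/3 + \<eta>.\<close>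

definition dir :: "nat \<Rightarrow> real" where "dir j = - 3 * \<eta> * j - 2 * \<eta>"

definition spine_pos :: "nat \<Rightarrow> complex" where "spine_pos j = (\<Sum>t<j. cis (dir t))"

text \<open>Upper leaves turn clockwise with the spine. \<open>Lower\<close> turns counterclockwise
  by \<eta> per vertex, so that consecutive lower leaves diverge too. Its gap to the outgoing spine
  step thereby shrinks by 4 \<eta> per vertex; the offset \<open>4 * real N + 3\<close> keeps this
  gap above pi/3 up to index \<open>N\<close>.\<close>

fun angle :: "nat \<Rightarrow> place \<Rightarrow> real" where
  "angle j Spine = 0"
| "angle j Back = 2*pi/3 - 3 * \<eta> * j"
| "angle j Front = pi/3 - 3 * \<eta> * j - \<eta>"
| "angle j Lower = - pi/3 - \<eta> * (4 * real N + 3) + \<eta> * j"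

definition place_pos :: "nat \<Rightarrow> place \<Rightarrow> complex" where
  "place_pos j k = (if k = Spine then spine_pos j else spine_pos j + cis (angle j k))"

section \<open>Rational estimates for slightly tilted directions\<close>

lemma \<eta>_bound: "j \<le> N + 1 \<Longrightarrow> \<eta> * j \<le> 1/1000"
proof -
  assume "j \<le> N + 1"
  then have "\<eta> * j \<le> \<eta> * (real N + 1)" using \<eta>(1) by (intro mult_left_mono) auto
  then show ?thesis using \<eta>(2) by linarith
qed

lemma \<eta>_small: "\<eta> \<le> 1/1000" using \<eta>_bound[of 1] by simp

lemma cos_sin_small: fixes x :: real assumes "\<bar>x\<bar> \<le> 1/100" shows "cos x \<ge> 99/100" "cos x \<le> 1" "\<bar>sin x\<bar> \<le> 1/100"
proof -
  show s: "\<bar>sin x\<bar> \<le> 1/100" using abs_sin_x_le_abs_x[of x] assms by linarith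
  have "(sin x)\<^sup>2 \<le> (1/100)\<^sup>2" using s by (subst abs_le_square_iff[symmetric]) simp
  then have c2: "(cos x)\<^sup>2 \<ge> (99/100)\<^sup>2" unfolding cos_squared_eq by (simp add: power2_eq_square)
  have "cos x \<ge> 0" using assms pi_gt3 by (intro cos_ge_zero) (auto simp: abs_le_iff)
  with c2 show "cos x \<ge> 99/100" by (rule power2_le_imp_le)
qed simp

lemma sqrt3_bounds: "173/100 < sqrt 3" "sqrt 3 < 174/100"
  by (rule real_less_rsqrt, simp add: power2_eq_square) (rule real_less_lsqrt, simp_all add: power2_eq_square)

lemma cis_bounds:
  assumes "\<bar>x\<bar> \<le> 1/100"
  shows "Re (cis (2*pi/3 + x)) \<le> -48/100" "Re (cis (2*pi/3 + x)) \<ge> -52/100" "Im (cis (2*pi/3 + x)) \<ge> 84/100"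
    "Re (cis (pi/3 + x)) \<ge> 48/100" "Re (cis (pi/3 + x)) \<le> 52/100" "Im (cis (pi/3 + x)) \<ge> 84/100"
    "Re (cis (-pi/3 + x)) \<ge> 48/100" "Re (cis (-pi/3 + x)) \<le> 52/100" "Im (cis (-pi/3 + x)) \<le> -84/100"
proof -
  let ?r = "sqrt 3 / 2"
  have s: "\<bar>?r * sin x\<bar> \<le> 1/100"
  proof -
    have "?r * \<bar>sin x\<bar> \<le> 1 * (1/100)" using cos_sin_small[OF assms] sqrt3_bounds by (intro mult_mono) auto
    then show ?thesis by (simp add: abs_mult)
  qed
  have c: "?r * cos x \<ge> 85/100"
  proof -
    have "?r * cos x \<ge> (173/200) * (99/100)" using cos_sin_small[OF assms] sqrt3_bounds by (intro mult_mono) auto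
    then show ?thesis by simp
  qed
  note b = cos_sin_small[OF assms] s c
  have e: "cis (2*pi/3 + x) = Complex (- (cos x) / 2 - ?r * sin x) (?r * cos x - sin x / 2)"
    "cis (pi/3 + x) = Complex (cos x / 2 - ?r * sin x) (?r * cos x + sin x / 2)"
    "cis (-pi/3 + x) = Complex (cos x / 2 + ?r * sin x) (- (?r * cos x) + sin x / 2)"
    by (simp_all add: complex_eq_iff cos_add sin_add cos_120 sin_120 cos_60 sin_60 cos_diff sin_diff)
  show "Re (cis (2*pi/3 + x)) \<le> -48/100" "Re (cis (2*pi/3 + x)) \<ge> -52/100" "Im (cis (2*pi/3 + x)) \<ge> 84/100"
    "Re (cis (pi/3 + x)) \<ge> 48/100" "Re (cis (pi/3 + x)) \<le> 52/100" "Im (cis (pi/3 + x)) \<ge> 84/100"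
    "Re (cis (-pi/3 + x)) \<ge> 48/100" "Re (cis (-pi/3 + x)) \<le> 52/100" "Im (cis (-pi/3 + x)) \<le> -84/100"
    unfolding e complex.sel using b by linarith+
qed

fun re_lo :: "place \<Rightarrow> real" where "re_lo Spine = 0" | "re_lo Back = -52/100" | "re_lo Front = 48/100" | "re_lo Lower = 48/100"
fun re_hi :: "place \<Rightarrow> real" where "re_hi Spine = 0" | "re_hi Back = -48/100" | "re_hi Front = 52/100" | "re_hi Lower = 52/100"

lemma dir_bound: "j \<le> N \<Longrightarrow> \<bar>dir j\<bar> \<le> 1/100"
  using \<eta>_bound[of j] \<eta>_small \<eta>(1) mult_nonneg_nonneg[of \<eta> "real j"]
  unfolding dir_def abs_le_iff mult.assoc by linarith

lemma place_Re:
  assumes "j \<le> N + 1"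
  shows "re_lo k \<le> Re (place_pos j k) - Re (spine_pos j)" "Re (place_pos j k) - Re (spine_pos j) \<le> re_hi k"
proof -
  have j: "\<eta> * j \<le> 1/1000" "0 \<le> \<eta> * j" "\<eta> * N \<le> 1/1000" "0 \<le> \<eta> * N"
    using \<eta>_bound[of j] \<eta>_bound[of N] \<eta>(1) assms by auto
  have "\<bar>- (3 * \<eta> * j)\<bar> \<le> 1/100" "\<bar>- (3 * \<eta> * j) - \<eta>\<bar> \<le> 1/100" "\<bar>- \<eta> * (4 * real N + 3) + \<eta> * j\<bar> \<le> 1/100"
    using j \<eta>(1) \<eta>_small unfolding abs_le_iff mult.assoc distrib_left mult.left_commute[of \<eta> 4] mult_minus_left
    by argo+
  note this[THEN cis_bounds(1)] this[THEN cis_bounds(2)] this[THEN cis_bounds(4)] this[THEN cis_bounds(5)]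
    this[THEN cis_bounds(7)] this[THEN cis_bounds(8)]
  then show "re_lo k \<le> Re (place_pos j k) - Re (spine_pos j)" "Re (place_pos j k) - Re (spine_pos j) \<le> re_hi k"
    by (cases k; simp add: place_pos_def algebra_simps)+
qed

lemma place_Im:
  assumes "j \<le> N + 1"
  shows "Im (place_pos j Back) - Im (spine_pos j) \<ge> 84/100" "Im (place_pos j Front) - Im (spine_pos j) \<ge> 84/100"
    "Im (place_pos j Lower) - Im (spine_pos j) \<le> -84/100"
proof -
  have j: "\<eta> * j \<le> 1/1000" "0 \<le> \<eta> * j" "\<eta> * N \<le> 1/1000" "0 \<le> \<eta> * N"
    using \<eta>_bound[of j] \<eta>_bound[of N] \<eta>(1) assms by auto
  have "\<bar>- (3 * \<eta> * j)\<bar> \<le> 1/100" "\<bar>- (3 * \<eta> * j) - \<eta>\<bar> \<le> 1/100" "\<bar>- \<eta> * (4 * real N + 3) + \<eta> * j\<bar> \<le> 1/100"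
    using j \<eta>(1) \<eta>_small unfolding abs_le_iff mult.assoc distrib_left mult.left_commute[of \<eta> 4] mult_minus_left
    by argo+
  note this[THEN cis_bounds(3)] this[THEN cis_bounds(6)] this[THEN cis_bounds(9)]
  then show "Im (place_pos j Back) - Im (spine_pos j) \<ge> 84/100" "Im (place_pos j Front) - Im (spine_pos j) \<ge> 84/100"
    "Im (place_pos j Lower) - Im (spine_pos j) \<le> -84/100"
    by (simp_all add: place_pos_def algebra_simps)
qed

lemma spine_pos_Suc: "spine_pos (Suc j) = spine_pos j + cis (dir j)"
  by (simp add: spine_pos_def)

lemma spine_Re: "j + s \<le> N + 1 \<Longrightarrow> Re (spine_pos (j + s)) - Re (spine_pos j) \<ge> 99/100 * s"
proof (induction s)
  case (Suc s)
  have "Re (cis (dir (j + s))) \<ge> 99/100" using cos_sin_small(1)[OF dir_bound[of "j + s"]] Suc.prems by simp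
  moreover have "Re (spine_pos (j + s)) - Re (spine_pos j) \<ge> 99/100 * s" using Suc by simp
  ultimately show ?case unfolding add_Suc_right spine_pos_Suc plus_complex.sel of_nat_Suc by argo
qed simp

lemma spine_Im: "j + s \<le> N + 1 \<Longrightarrow> \<bar>Im (spine_pos (j + s)) - Im (spine_pos j)\<bar> \<le> 1/100 * s"
proof (induction s)
  case (Suc s)
  have "\<bar>Im (cis (dir (j + s)))\<bar> \<le> 1/100" using cos_sin_small(3)[OF dir_bound[of "j + s"]] Suc.prems by simp
  moreover have "\<bar>Im (spine_pos (j + s)) - Im (spine_pos j)\<bar> \<le> 1/100 * s" using Suc by simp
  ultimately show ?case unfolding add_Suc_right spine_pos_Suc plus_complex.sel of_nat_Suc abs_le_iff by argo
qed simp

lemma far_Re: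
  assumes "j + s \<le> N + 1" "99/100 * s + re_lo k' - re_hi k > 1"
  shows "norm (place_pos (j + s) k' - place_pos j k) > 1"
proof -
  have "Re (place_pos (j + s) k' - place_pos j k) > 1"
    using spine_Re[OF assms(1)] place_Re(1)[OF assms(1), of k'] place_Re(2)[of j k] assms by simp
  then show ?thesis using complex_Re_le_cmod[of "place_pos (j + s) k' - place_pos j k"] by linarith
qed

lemma far_Im:
  assumes "j + s \<le> N + 1" "s \<le> 2" "k \<in> {Back, Front} \<and> k' = Lower \<or> k' \<in> {Back, Front} \<and> k = Lower"
  shows "norm (place_pos (j + s) k' - place_pos j k) > 1"
proof -
  have "\<bar>Im (place_pos (j + s) k' - place_pos j k)\<bar> > 1"
    using spine_Im[OF assms(1)] place_Im[OF assms(1)] place_Im[of j] assms by (auto simp: abs_if split: if_splits)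
  then show ?thesis using abs_Im_le_cmod[of "place_pos (j + s) k' - place_pos j k"] by linarith
qed

section \<open>Pairs at distance exactly 1 in the straight lattice\<close>

lemma cos_lt_half: assumes "pi/3 < g" "g \<le> pi" shows "cos g < 1/2"
  using cos_monotone_0_pi[of "pi/3" g] assms by (simp add: cos_60)

lemma norm_cis_diff_gt_1: assumes "pi/3 < a - b" "a - b \<le> pi" shows "norm (cis a - cis b) > 1"
  unfolding norm_gt_1_iff norm_cis_diff_sq using cos_lt_half[OF assms] by simp

text \<open>Parallel leaves of consecutive spine disks would have distance exactly 1. If the later
  one is turned away, the two sine factors of the rhombus formula have equal sign and the distance
  grows. The second inequality is the mirror image, for the lower leaves.\<close>

lemma parallel_leaves:
  assumes "a' < a" "a - d < pi" "a - d > 0" "a' - d > 0"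
  shows "norm (cis d + cis a' - cis a) > 1" "norm (cis (-d) + cis (-a') - cis (-a)) > 1"
proof -
  have "cos ((d - a')/2) > 0" by (rule cos_gt_zero_pi) (use assms pi_gt_zero in \<open>simp_all add: field_simps\<close>)
  moreover have "sin ((a - d)/2) > 0" by (rule sin_gt_zero) (use assms pi_gt_zero in \<open>simp_all add: field_simps\<close>)
  moreover have "sin ((a - a')/2) > 0" by (rule sin_gt_zero) (use assms pi_gt_zero in \<open>simp_all add: field_simps\<close>)
  ultimately have pos: "cos ((d - a')/2) * sin ((a - d)/2) * sin ((a - a')/2) > 0" by simp
  have sw: "sin ((x - y)/2) = - sin ((y - x)/2)" for x y :: real
    by (metis minus_diff_eq minus_divide_left sin_minus)
  have cw: "cos ((x - y)/2) = cos ((y - x)/2)" for x y :: real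
    by (metis minus_diff_eq minus_divide_left cos_minus)
  show "norm (cis d + cis a' - cis a) > 1"
    unfolding norm_gt_1_iff norm_cis_rhombus_sq using pos sw[of d a] sw[of a' a] by (simp add: mult_ac)
  then show "norm (cis (-d) + cis (-a') - cis (-a)) > 1"
    by (metis cis_cnj complex_cnj_add complex_cnj_diff complex_mod_cnj)
qed

text \<open>The straight lattice again gives distance exactly 1. Seen from the direction
  \<open>c\<close> the figure is mirror symmetric, so the difference vector is a real multiple of
  \<open>cis c\<close>. The two leaves tilt apart by 5/2 \<eta> each, which outweighs the shortening
  of the spine by tilts of 3/2 \<eta>.\<close>

lemma front_back:
  "norm (cis (dir j) + cis (dir (Suc j)) + cis (angle (Suc (Suc j)) Back) - cis (angle j Front)) > 1"
proof -
  define c where "c = - 3 * \<eta> * j - 7/2 * \<eta>"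
  have e: "dir j = c + 3/2 * \<eta>" "dir (Suc j) = c - 3/2 * \<eta>"
    "angle (Suc (Suc j)) Back = c + (pi - (pi/3 + 5/2 * \<eta>))" "angle j Front = c + (pi/3 + 5/2 * \<eta>)"
    by (simp_all add: dir_def c_def algebra_simps)
  have e1: "cis x + cis (- x) + cis (pi - y) - cis y = of_real (2 * (cos x - cos y))" for x y
    by (simp add: complex_eq_iff)
  have "cis (dir j) + cis (dir (Suc j)) + cis (angle (Suc (Suc j)) Back) - cis (angle j Front)
      = cis c * (cis (3/2 * \<eta>) + cis (- (3/2 * \<eta>)) + cis (pi - (pi/3 + 5/2 * \<eta>)) - cis (pi/3 + 5/2 * \<eta>))"
    unfolding e by (simp add: algebra_simps cis_mult)
  also note e1
  finally have n: "norm (cis (dir j) + cis (dir (Suc j)) + cis (angle (Suc (Suc j)) Back) - cis (angle j Front))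
      = \<bar>2 * (cos (3/2 * \<eta>) - cos (pi/3 + 5/2 * \<eta>))\<bar>" by (simp only: norm_mult norm_cis mult_1_left norm_of_real)
  have "cos (3/2 * \<eta>) - cos (pi/3 + 5/2 * \<eta>) = 2 * sin (pi/6 + 2 * \<eta>) * sin (pi/6 + \<eta>/2)"
  proof -
    have "(3/2 * \<eta> + (pi/3 + 5/2 * \<eta>))/2 = pi/6 + 2 * \<eta>" "((pi/3 + 5/2 * \<eta>) - 3/2 * \<eta>)/2 = pi/6 + \<eta>/2"
      by (simp_all add: field_simps)
    then show ?thesis by (simp only: cos_diff_cos)
  qed
  moreover have "sin (pi/6 + x) > 1/2" if "0 < x" "x \<le> 1/100" for x
    using sin_monotone_2pi[of "pi/6" "pi/6 + x"] that pi_gt3 by (simp add: sin_30)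
  then have "sin (pi/6 + 2 * \<eta>) > 1/2" "sin (pi/6 + \<eta>/2) > 1/2" using \<eta>(1) \<eta>_small by auto
  then have "sin (pi/6 + 2 * \<eta>) * sin (pi/6 + \<eta>/2) > 1/2 * (1/2)" by (intro mult_strict_mono) auto
  ultimately show ?thesis unfolding n by simp
qed

definition related :: "nat \<times> place \<Rightarrow> nat \<times> place \<Rightarrow> bool" where
  "related x y \<longleftrightarrow> snd x = Spine \<and> snd y = Spine \<and> (fst y = Suc (fst x) \<or> fst x = Suc (fst y))
     \<or> fst x = fst y \<and> (snd x = Spine) \<noteq> (snd y = Spine)"

text \<open>In the straight lattice these two places are the same point.\<close>

definition clash :: "nat \<times> place \<Rightarrow> nat \<times> place \<Rightarrow> bool" where
  "clash x y \<longleftrightarrow> snd x = Front \<and> snd y = Back \<and> fst y = Suc (fst x)"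

lemma related_dist:
  assumes "related (i, k) (j, k')"
  shows "norm (place_pos i k - place_pos j k') = 1"
  using assms by (auto simp: related_def place_pos_def spine_pos_Suc norm_minus_commute)

text \<open>Case distinction on the index difference \<open>s\<close>. Horizontal boxes settle
  \<open>s \<ge> 3\<close> and most pairs for smaller \<open>s\<close>; vertical separation settles
  upper against lower leaves. The remaining pairs have lattice distance exactly 1 and are decided by
  the slack \<eta>.\<close>

lemma unrelated_dist_le:
  assumes le: "i \<le> j" "j \<le> N + 1" and k: "k \<noteq> Spine \<Longrightarrow> i \<le> N" "k' \<noteq> Spine \<Longrightarrow> j \<le> N"
    and ne: "(i, k) \<noteq> (j, k')" "\<not> related (i, k) (j, k')" "\<not> clash (i, k) (j, k')"
  shows "norm (place_pos j k' - place_pos i k) > 1"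
proof -
  define s where "s = j - i"
  have j: "j = i + s" using le by (simp add: s_def)
  have lt: "i + s \<le> N + 1" using le j by simp
  note defs = related_def clash_def
  define a b where "a = \<eta> * real i" and "b = \<eta> * real N"
  have small: "0 \<le> a" "a \<le> 1/1000" "b \<le> 1/1000" "0 < \<eta>" "\<eta> \<le> 1/1000" "pi > 3"
    using \<eta>_bound[of i] \<eta>_bound[of N] \<eta>(1) \<eta>_small le pi_gt3 by (auto simp: a_def b_def)
  have ab: "a \<le> b" if "s = 1" using lt that \<eta>(1) by (simp add: a_def b_def)
  have ang: "dir i = - 3 * a - 2 * \<eta>" "angle i Back = 2*pi/3 - 3 * a" "angle (Suc i) Back = 2*pi/3 - 3 * a - 3 * \<eta>"
    "angle i Front = pi/3 - 3 * a - \<eta>" "angle (Suc i) Front = pi/3 - 3 * a - 4 * \<eta>"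
    "angle i Lower = - pi/3 - 4 * b - 3 * \<eta> + a" "angle (Suc i) Lower = - pi/3 - 4 * b - 2 * \<eta> + a"
    by (simp_all add: dir_def a_def b_def algebra_simps)
  consider "s \<ge> 3" | "s = 2" | "s = 1" | "s = 0" by linarith
  then have "norm (place_pos (i + s) k' - place_pos i k) > 1"
  proof cases
    case 1
    then have "99/100 * real s \<ge> 297/100" by simp
    then show ?thesis by (intro far_Re[OF lt]) (cases k; cases k'; simp)
  next
    case 2
    show ?thesis
    proof (cases "k' = Back \<and> (k = Front \<or> k = Lower)")
      case True
      show ?thesis
      proof (cases "k = Lower")
        case True
        then show ?thesis using 2 \<open>k' = Back \<and> _\<close> by (intro far_Im[OF lt]) auto
      next
        case False
        then have "k = Front" "k' = Back" using True by auto
        then show ?thesis using front_back[of i] 2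
          by (simp add: place_pos_def spine_pos_Suc numeral_2_eq_2 algebra_simps)
      qed
    next
      case False
      then show ?thesis using 2 by (intro far_Re[OF lt]) (cases k; cases k'; simp)
    qed
  next
    case 3
    consider "k = Spine" "k' = Back" | "k = k'" "k \<noteq> Spine" | "k = Front \<or> k = Lower" "k' = Spine"
      | "k = Lower \<and> k' \<in> {Back, Front} \<or> k' = Lower \<and> k = Front"
      | "99/100 * real s + re_lo k' - re_hi k > 1"
      using ne 3 j by (cases k; cases k'; simp add: defs)
    then show ?thesis
    proof cases
      case 1
      have "norm (cis (dir i + pi) - cis (angle (Suc i) Back)) > 1"
        by (rule norm_cis_diff_gt_1; unfold ang) (use small in argo)+
      moreover have "place_pos (i + s) k' - place_pos i k = - (cis (dir i + pi) - cis (angle (Suc i) Back))"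
        using 1 3 by (simp add: place_pos_def spine_pos_Suc complex_eq_iff)
      ultimately show ?thesis by (simp only: norm_minus_cancel)
    next
      case 2
      have e: "place_pos (i + s) k' - place_pos i k = cis (dir i) + cis (angle (Suc i) k) - cis (angle i k)"
        using 2 3 by (simp add: place_pos_def spine_pos_Suc)
      have "norm (cis (dir i) + cis (angle (Suc i) Back) - cis (angle i Back)) > 1"
        by (rule parallel_leaves(1); unfold ang) (use small in argo)+
      moreover have "norm (cis (dir i) + cis (angle (Suc i) Front) - cis (angle i Front)) > 1"
        by (rule parallel_leaves(1); unfold ang) (use small in argo)+
      moreover have "norm (cis (- (- dir i)) + cis (- (- angle (Suc i) Lower)) - cis (- (- angle i Lower))) > 1"
        by (rule parallel_leaves(2); unfold ang) (use small ab 3 in argo)+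
      ultimately show ?thesis unfolding e minus_minus using 2(2) by (cases k) (simp_all del: angle.simps)
    next
      case c: 3
      have e: "place_pos (i + s) k' - place_pos i k = cis (dir i) - cis (angle i k)"
        using c 3 by (auto simp: place_pos_def spine_pos_Suc)
      have "norm (cis (dir i) - cis (angle i Lower)) > 1"
        by (rule norm_cis_diff_gt_1; unfold ang) (use small ab 3 in argo)+
      moreover have "norm (cis (angle i Front) - cis (dir i)) > 1"
        by (rule norm_cis_diff_gt_1; unfold ang) (use small in argo)+
      ultimately show ?thesis unfolding e using c by (auto simp: norm_minus_commute)
    next
      case 4
      then show ?thesis using 3 by (intro far_Im[OF lt]) auto
    next
      case 5
      then show ?thesis by (rule far_Re[OF lt])
    qed
  next
    case 4
    then have kk: "k \<noteq> k'" "k \<noteq> Spine" "k' \<noteq> Spine" using ne j by (auto simp: defs)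
    show ?thesis
    proof (cases "k = Lower \<or> k' = Lower")
      case True
      then show ?thesis using 4 kk by (intro far_Im[OF lt]) (cases k; cases k'; simp)+
    next
      case False
      have "norm (cis (angle i Back) - cis (angle i Front)) > 1"
        by (rule norm_cis_diff_gt_1; unfold ang) (use small in argo)+
      then show ?thesis using False kk 4
        by (cases k; cases k'; simp add: place_pos_def norm_minus_commute)
    qed
  qed
  then show ?thesis using j by simp
qed

lemma related_sym: "related x y = related y x"
  by (auto simp: related_def)

lemma unrelated_dist:
  assumes "i \<le> N + 1" "j \<le> N + 1" and "k \<noteq> Spine \<Longrightarrow> i \<le> N" "k' \<noteq> Spine \<Longrightarrow> j \<le> N"
    and "(i, k) \<noteq> (j, k')" "\<not> related (i, k) (j, k')" "\<not> clash (i, k) (j, k')" "\<not> clash (j, k') (i, k)"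
  shows "norm (place_pos i k - place_pos j k') > 1"
proof (cases "i \<le> j")
  case True
  then show ?thesis using unrelated_dist_le[of i j k k'] assms by (simp add: norm_minus_commute)
next
  case False
  then show ?thesis using unrelated_dist_le[of j i k' k] assms related_sym[of "(i,k)"] by auto
qed

end

section \<open>Placing a caterpillar\<close>

text \<open>Characterised by degrees instead of membership in the spine, because degrees are what
  the machine can compute before it knows the spine.\<close>

definition spine_nbrs :: "(nat \<times> nat) set \<Rightarrow> nat \<Rightarrow> nat set" where
  "spine_nbrs E v = {w. (v, w) \<in> E \<and> degree E w \<noteq> 1}"

lemma spine_nbrs_nth:
  assumes sp: "spine n E xs" and i: "i < length xs"
  shows "spine_nbrs E (xs ! i) =
    (if i = 0 then {} else {xs ! (i - 1)}) \<union> (if Suc i < length xs then {xs ! Suc i} else {})"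
proof -
  have "w \<in> spine_nbrs E (xs ! i) \<longleftrightarrow> w \<in> set xs \<and> (xs ! i, w) \<in> E" for w
    using sp i unfolding spine_nbrs_def spine_def by auto
  also have "\<dots> w \<longleftrightarrow> (\<exists>j<length xs. w = xs ! j \<and> (j = Suc i \<or> i = Suc j))" for w
    using sp i unfolding spine_def in_set_conv_nth by auto
  also have "\<dots> w \<longleftrightarrow> (Suc i < length xs \<and> w = xs ! Suc i) \<or> (\<exists>m. i = Suc m \<and> w = xs ! m)" for w
    using i Suc_lessD by blast
  finally show ?thesis by (cases i) auto
qed

lemma card_spine_nbrs:
  assumes sp: "spine n E xs" and i: "i < length xs"
  shows "card (spine_nbrs E (xs ! i)) = (if i = 0 then 0 else 1) + (if Suc i < length xs then 1 else 0)"
proof -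
  have "xs ! Suc i \<noteq> xs ! (i - Suc 0)" if "Suc i < length xs"
    using sp i that by (simp add: spine_def nth_eq_iff_index_eq)
  then show ?thesis unfolding spine_nbrs_nth[OF assms] by (auto simp: card_insert_if)
qed

text \<open>The search for a starting vertex may find either end of the path.\<close>

lemma spine_rev: assumes "spine n E xs" shows "spine n E (rev xs)"
proof -
  have "(rev xs ! i, rev xs ! j) \<in> E \<longleftrightarrow> j = Suc i \<or> i = Suc j" if "i < length xs" "j < length xs" for i j
  proof -
    have "(xs ! (length xs - Suc i), xs ! (length xs - Suc j)) \<in> E \<longleftrightarrow>
        length xs - Suc j = Suc (length xs - Suc i) \<or> length xs - Suc i = Suc (length xs - Suc j)"
      using assms that by (simp add: spine_def)
    also have "\<dots> \<longleftrightarrow> j = Suc i \<or> i = Suc j" using that by linarith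
    finally show ?thesis using that by (simp only: rev_nth)
  qed
  then show ?thesis using assms unfolding spine_def by simp
qed

text \<open>An end of the spine. Among caterpillars the default 0 takes effect only for the tree
  with a single edge, which has no vertex other than leaves.\<close>

definition start :: "nat \<Rightarrow> (nat \<times> nat) set \<Rightarrow> nat" where
  "start n E = fold (\<lambda>v a. if degree E v \<noteq> 1 \<and> card (spine_nbrs E v) \<le> 1 then v else a) [0..<n] 0"

lemma fold_if_cases:
  "fold (\<lambda>v a. if P v then v else a) xs a = a \<and> (\<forall>x\<in>set xs. \<not> P x) \<or>
   (\<exists>x\<in>set xs. P x \<and> fold (\<lambda>v a. if P v then v else a) xs a = x)"
  by (induction xs arbitrary: a) auto

lemma caterpillar_spine:
  assumes cat: "caterpillar n E"
  obtains xs where "spine n E xs" "hd xs = start n E"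
proof -
  have g: "graph_on n E" and n: "n \<ge> 1" and conn: "\<And>u v. u < n \<Longrightarrow> v < n \<Longrightarrow> (u, v) \<in> E\<^sup>*"
    using cat unfolding caterpillar_def is_tree_def connected_graph_def by auto
  have lt: "u < n \<and> v < n \<and> u \<noteq> v \<and> (v, u) \<in> E" if "(u, v) \<in> E" for u v
    using g that unfolding graph_on_def sym_def by force
  have fin: "finite {u. (v, u) \<in> E}" for v
    by (rule finite_subset[of _ "{..<n}"]) (auto dest: lt)
  have deg1: "\<exists>u. \<forall>w. (v, w) \<in> E \<longleftrightarrow> w = u" if d: "degree E v = 1" for v
  proof -
    obtain u where "{u. (v, u) \<in> E} = {u}" using d unfolding degree_def by (rule card_1_singletonE)
    then show ?thesis by blast
  qed
  let ?P = "\<lambda>v. degree E v \<noteq> 1 \<and> card (spine_nbrs E v) \<le> 1"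
  show thesis
  \<comment> \<open>Two adjacent leaves form a whole component, so the tree is a single edge.
    Removing its leaves leaves nothing, and \<open>[0]\<close> is chosen as the spine.\<close>
  proof (cases "\<exists>u v. (u, v) \<in> E \<and> degree E u = 1 \<and> degree E v = 1")
    case True
    then obtain u v where uv: "(u, v) \<in> E" "degree E u = 1" "degree E v = 1" by blast
    have only: "w = v" if "(u, w) \<in> E" for w using deg1[OF uv(2)] uv(1) that by auto
    have only': "w = u" if "(v, w) \<in> E" for w using deg1[OF uv(3)] lt[OF uv(1)] that by auto
    have "w \<in> {u, v}" if "(u, w) \<in> E\<^sup>*" for w
      using that by (induction rule: rtrancl_induct) (use only only' in auto)
    then have "{..<n} \<subseteq> {u, v}" using conn[of u] lt[OF uv(1)] by auto
    then have all: "{..<n} = {u, v}" using lt[OF uv(1)] by auto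
    have "card {..<n} = 2" unfolding all using lt[OF uv(1)] by simp
    then have n2: "n = 2" by simp
    then have "{u, v} = {0, 1}" using all by (auto simp: lessThan_Suc numeral_2_eq_2)
    then have uv': "u = 0 \<and> v = 1 \<or> u = 1 \<and> v = 0" by (auto simp: doubleton_eq_iff)
    have E: "E = {(0, 1), (1, 0)}"
    proof (intro equalityI subrelI)
      fix x y assume xy: "(x, y) \<in> E"
      then have "x < 2" "y < 2" "x \<noteq> y" using lt[OF xy] n2 by auto
      then show "(x, y) \<in> {(0, 1), (1, 0)}" by (auto simp: less_2_cases_iff)
    qed (use uv' uv(1) lt[OF uv(1)] in auto)
    have d: "degree E 0 = 1" "degree E 1 = 1" using uv uv' by auto
    have "start n E = 0" using d n2 fold_if_cases[of ?P "[0..<n]" 0] unfolding start_def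
      by (auto simp: less_2_cases_iff)
    moreover have "spine n E [0]"
      unfolding spine_def
    proof (intro conjI ballI allI impI)
      fix v assume "v < n" "v \<notin> set [0::nat]"
      then have "v = 1" using n2 by auto
      then show "\<exists>u\<in>set [0]. \<forall>w. (v, w) \<in> E \<longleftrightarrow> w = u" by (auto simp: E)
    next
      fix u v assume "u \<in> set [0::nat]" "(u, v) \<in> E"
      then have "v = 1" by (auto simp: E)
      then show "v \<in> set [0] \<longleftrightarrow> degree E v \<noteq> 1" using d by simp
    qed (use g n2 in \<open>auto simp: E\<close>)
    ultimately show thesis using that by simp
  next
    case False
    have "is_path_graph {v. v < n \<and> degree E v \<noteq> 1} E" using cat by (simp add: caterpillar_def)
    then obtain xs where xs: "distinct xs" "set xs = {v. v < n \<and> degree E v \<noteq> 1}"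
      and adj0: "\<forall>u\<in>{v. v < n \<and> degree E v \<noteq> 1}. \<forall>v\<in>{v. v < n \<and> degree E v \<noteq> 1}. (u, v) \<in> E \<longleftrightarrow>
        (\<exists>i. Suc i < length xs \<and> ((xs ! i = u \<and> xs ! Suc i = v) \<or> (xs ! i = v \<and> xs ! Suc i = u)))"
      unfolding is_path_graph_def by (elim exE conjE)
    note adj = adj0[folded xs(2)]
    have adj': "(xs ! i, xs ! j) \<in> E \<longleftrightarrow> j = Suc i \<or> i = Suc j" if "i < length xs" "j < length xs" for i j
    proof -
      have "(xs ! i, xs ! j) \<in> E \<longleftrightarrow> (\<exists>l. Suc l < length xs \<and> (l = i \<and> Suc l = j \<or> l = j \<and> Suc l = i))"
      proof -
        have "(xs ! i, xs ! j) \<in> E \<longleftrightarrow> (\<exists>l. Suc l < length xs \<and>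
            (xs ! l = xs ! i \<and> xs ! Suc l = xs ! j \<or> xs ! l = xs ! j \<and> xs ! Suc l = xs ! i))"
          using adj nth_mem[OF that(1)] nth_mem[OF that(2)] by blast
        also have "\<dots> \<longleftrightarrow> (\<exists>l. Suc l < length xs \<and> (l = i \<and> Suc l = j \<or> l = j \<and> Suc l = i))"
          using that xs(1) by (intro ex_cong1) (simp add: nth_eq_iff_index_eq cong: conj_cong)
        finally show ?thesis .
      qed
      then show ?thesis using that by auto
    qed
    have leaf: "\<exists>u\<in>set xs. \<forall>w. (v, w) \<in> E \<longleftrightarrow> w = u" if v: "v < n" "v \<notin> set xs" for v
    proof -
      have dv: "degree E v = 1" using v xs by auto
      then obtain u where u: "\<forall>w. (v, w) \<in> E \<longleftrightarrow> w = u" using deg1 by blast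
      then have "degree E u \<noteq> 1" "u < n" using False dv lt by blast+
      then show ?thesis using u xs by auto
    qed
    have ne: "xs \<noteq> []"
    proof
      assume "xs = []"
      then show False using leaf[of 0] n by auto
    qed
    have sp: "spine n E xs"
      unfolding spine_def
    proof (intro conjI ballI allI impI)
      fix u v assume "(u, v) \<in> E"
      then show "v \<in> set xs \<longleftrightarrow> degree E v \<noteq> 1" using xs(2) lt by blast
    qed (use g ne xs adj' leaf in auto)
    have nt: "xs ! i < n" "degree E (xs ! i) \<noteq> 1" if "i < length xs" for i
      using xs(2) nth_mem[OF that] by auto
    have "?P (hd xs)" using nt(2)[of 0] card_spine_nbrs[OF sp, of 0] ne by (simp add: hd_conv_nth)
    moreover have "hd xs < n" using nt(1)[of 0] ne by (simp add: hd_conv_nth)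
    ultimately have s: "?P (start n E)" "start n E < n"
      using fold_if_cases[of ?P "[0..<n]" 0] unfolding start_def by auto
    then have "start n E \<in> set xs" using xs by auto
    then obtain i where i: "i < length xs" "start n E = xs ! i" by (metis in_set_conv_nth)
    have "card (spine_nbrs E (xs ! i)) \<le> 1" using s i by simp
    then have "i = 0 \<or> Suc i = length xs" using card_spine_nbrs[OF sp i(1)] i by (auto split: if_splits)
    then show thesis
    proof
      assume "i = 0"
      then show thesis using that[OF sp] i ne by (simp add: hd_conv_nth)
    next
      assume "Suc i = length xs"
      then have "i = length xs - 1" by simp
      then show thesis using that[OF spine_rev[OF sp]] i ne by (simp add: hd_rev last_conv_nth)
    qed
  qed
qed

text \<open>The greedy choice. In a feasible spine, \<open>narrow E xs i\<close> holds exactly if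
  the preceding vertex has a leaf at \<open>Front\<close>: degree 5 uses slot 4, and degree 4 puts
  slot 3 there only if \<open>Back\<close> was forbidden. So the obstruction from the necessity
  proof is also the state of the construction.\<close>

fun slot :: "(nat \<times> nat) set \<Rightarrow> nat list \<Rightarrow> nat \<Rightarrow> nat \<Rightarrow> nat \<times> place" where
  "slot E xs i s = (if s = 0 then (0, Spine)
     else if s = 1 then (if Suc i < length xs then (0, Spine) else (Suc (length xs), Spine))
     else if s = 2 then (Suc i, Lower)
     else if s = 3 then (Suc i, if narrow E xs i then Front else Back)
     else (Suc i, Front))"

text \<open>The ends of the spine offer an additional place for a leaf, namely the next position
  (\<open>0\<close> or \<open>length xs + 1\<close>) of the spine. A vertex with \<open>c\<close> neighbours on the spine uses the slots
  \<open>c, c + 1, \<dots>\<close>.\<close>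

locale leaf_order =
  fixes n :: nat and E :: "(nat \<times> nat) set" and xs :: "nat list" and r :: "nat \<Rightarrow> nat" and par :: "nat \<Rightarrow> nat"
  assumes sp: "spine n E xs" and feas: "feasible E xs"
    and par: "\<And>v. v < n \<Longrightarrow> v \<notin> set xs \<Longrightarrow> par v < length xs \<and> (xs ! par v, v) \<in> E"
    and r_lt: "\<And>v. v < n \<Longrightarrow> v \<notin> set xs \<Longrightarrow>
      card (spine_nbrs E (xs ! par v)) + r v < degree E (xs ! par v)"
    and r_inj: "\<And>v v'. v < n \<Longrightarrow> v \<notin> set xs \<Longrightarrow> v' < n \<Longrightarrow> v' \<notin> set xs \<Longrightarrow> par v = par v' \<Longrightarrow> r v = r v' \<Longrightarrow> v = v'"
begin

definition slot_no :: "nat \<Rightarrow> nat" where "slot_no v = card (spine_nbrs E (xs ! par v)) + r v"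

definition idx :: "nat \<Rightarrow> nat" where "idx v = (THE i. i < length xs \<and> xs ! i = v)"

definition spot :: "nat \<Rightarrow> nat \<times> place" where
  "spot v = (if v \<in> set xs then (Suc (idx v), Spine) else slot E xs (par v) (slot_no v))"

lemma idx_nth: "i < length xs \<Longrightarrow> idx (xs ! i) = i"
  unfolding idx_def using sp by (intro the_equality) (auto simp: spine_def nth_eq_iff_index_eq)

lemma spot_spine: "i < length xs \<Longrightarrow> spot (xs ! i) = (Suc i, Spine)"
  by (simp add: spot_def idx_nth)

lemma leaf_edge: "v < n \<Longrightarrow> v \<notin> set xs \<Longrightarrow> (v, w) \<in> E \<longleftrightarrow> w = xs ! par v"
  using par[of v] sp spine_edge_lt[OF sp] unfolding spine_def by metis

text \<open>Slot numbers run from the number of spine neighbours to the degree minus 1, which is at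
  most 4, so slots 0 and 1 occur only at ends of the spine. A leaf at \<open>Front\<close> makes the
  next vertex narrow, whereas \<open>Back\<close> is taken only where \<open>narrow\<close> fails;
  this excludes clashes.\<close>

lemma spot_leaf_cases:
  assumes v: "v < n" "v \<notin> set xs"
  shows "spot v = (0, Spine) \<and> par v = 0 \<and> (slot_no v = 0 \<and> length xs = 1 \<or> slot_no v = 1 \<and> length xs > 1)
    \<or> spot v = (Suc (length xs), Spine) \<and> Suc (par v) = length xs \<and> slot_no v = 1
    \<or> spot v = (Suc (par v), Lower) \<and> slot_no v = 2
    \<or> spot v = (Suc (par v), Back) \<and> slot_no v = 3 \<and> \<not> narrow E xs (par v)
    \<or> spot v = (Suc (par v), Front) \<and> narrow E xs (Suc (par v)) \<and>
       (slot_no v = 3 \<and> narrow E xs (par v) \<or> slot_no v = 4 \<and> \<not> narrow E xs (par v))"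
proof -
  let ?j = "par v" let ?s = "slot_no v"
  have j: "?j < length xs" using par[OF v] by simp
  have s: "?s < degree E (xs ! ?j)" using r_lt[OF v] by (simp add: slot_no_def)
  have d: "degree E (xs ! ?j) \<le> 5" "degree E (xs ! ?j) \<ge> 5 \<longrightarrow> \<not> narrow E xs ?j"
    using feas j by (auto simp: feasible_def)
  have c: "(if ?j = 0 then 0 else 1) + (if Suc ?j < length xs then 1 else 0) \<le> ?s"
    using card_spine_nbrs[OF sp j] by (simp add: slot_no_def)
  have sp: "spot v = slot E xs ?j ?s" using v by (simp add: spot_def)
  consider "?s = 0" | "?s = 1" | "?s = 2" | "?s = 3" | "?s = 4" using s d(1) by linarith
  then show ?thesis
  proof cases
    case 1
    then have "?j = 0" "\<not> Suc ?j < length xs" using c by (auto split: if_splits)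
    then have "?j = 0" "length xs = 1" using j by linarith+
    then show ?thesis using sp 1 by simp
  next
    case 2
    from j have "Suc ?j < length xs \<or> Suc ?j = length xs" by auto
    then show ?thesis using 2 sp c by (elim disjE) (auto split: if_splits)
  next
    case 3
    then show ?thesis using sp by simp
  next
    case 4
    then show ?thesis using sp s by simp
  next
    case 5
    then show ?thesis using sp s d by simp
  qed
qed

lemma spot_inj:
  assumes "u < n" "v < n" "spot u = spot v" shows "u = v"
proof (cases "u \<in> set xs"; cases "v \<in> set xs")
  assume "u \<in> set xs" "v \<in> set xs"
  then show ?thesis using assms by (auto simp: in_set_conv_nth spot_spine)
next
  assume u: "u \<in> set xs" and v: "v \<notin> set xs"
  then show ?thesis using assms(3) spot_leaf_cases[OF assms(2) v] by (auto simp: in_set_conv_nth spot_spine)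
next
  assume u: "u \<notin> set xs" and v: "v \<in> set xs"
  then show ?thesis using assms(3) spot_leaf_cases[OF assms(1) u] by (auto simp: in_set_conv_nth spot_spine)
next
  assume u: "u \<notin> set xs" and v: "v \<notin> set xs"
  have "par u < length xs" "par v < length xs" using par u v assms by auto
  then have "par u = par v \<and> slot_no u = slot_no v"
    using assms(3) spot_leaf_cases[OF assms(1) u] spot_leaf_cases[OF assms(2) v] by auto
  then show ?thesis using r_inj[OF assms(1) u assms(2) v] by (auto simp: slot_no_def)
qed

end

locale drawn = leaf_order + bent_arc +
  assumes N: "length xs \<le> N"
begin

lemma spot_range:
  assumes "v < n" shows "fst (spot v) \<le> N + 1" "snd (spot v) \<noteq> Spine \<Longrightarrow> fst (spot v) \<le> N"
proof -
  have "fst (spot v) \<le> N + 1 \<and> (snd (spot v) \<noteq> Spine \<longrightarrow> fst (spot v) \<le> N)"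
  proof (cases "v \<in> set xs")
    case True
    then show ?thesis using N by (auto simp: in_set_conv_nth spot_spine)
  next
    case False
    then show ?thesis using spot_leaf_cases[OF assms False] par[OF assms False] N by auto
  qed
  then show "fst (spot v) \<le> N + 1" "snd (spot v) \<noteq> Spine \<Longrightarrow> fst (spot v) \<le> N" by auto
qed

lemma spot_related_leaf:
  assumes u: "i < length xs" and v: "v < n" "v \<notin> set xs"
  shows "related (spot (xs ! i)) (spot v) \<longleftrightarrow> (xs ! i, v) \<in> E"
proof -
  have "(xs ! i, v) \<in> E \<longleftrightarrow> (v, xs ! i) \<in> E" using spine_edge_lt[OF sp] by blast
  also have "\<dots> \<longleftrightarrow> i = par v" using leaf_edge[OF v] par[OF v] u sp by (simp add: spine_def nth_eq_iff_index_eq)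
  finally show ?thesis using spot_leaf_cases[OF v] par[OF v] u by (auto simp: spot_spine related_def)
qed

lemma spot_related:
  assumes "u < n" "v < n" shows "related (spot u) (spot v) \<longleftrightarrow> (u, v) \<in> E"
proof (cases "u \<in> set xs"; cases "v \<in> set xs")
  assume "u \<in> set xs" "v \<in> set xs"
  then show ?thesis using sp by (auto simp: in_set_conv_nth spot_spine related_def spine_def)
next
  assume u: "u \<in> set xs" and v: "v \<notin> set xs"
  then show ?thesis using spot_related_leaf[OF _ assms(2) v] by (auto simp: in_set_conv_nth)
next
  assume u: "u \<notin> set xs" and v: "v \<in> set xs"
  then show ?thesis using spot_related_leaf[OF _ assms(1) u] related_sym spine_edge_lt[OF sp]
    by (metis in_set_conv_nth)
next
  assume u: "u \<notin> set xs" and v: "v \<notin> set xs"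
  have p: "par u < length xs" "par v < length xs" using par u v assms by auto
  have "(u, v) \<notin> E" using leaf_edge[OF assms(1) u] p v by auto
  moreover have "\<not> related (spot u) (spot v)"
    using spot_leaf_cases[OF assms(1) u] spot_leaf_cases[OF assms(2) v] p by (auto simp: related_def)
  ultimately show ?thesis by simp
qed

lemma spot_no_clash:
  assumes "u < n" "v < n" shows "\<not> clash (spot u) (spot v)"
proof (cases "u \<in> set xs \<or> v \<in> set xs")
  case True
  then show ?thesis by (auto simp: in_set_conv_nth spot_spine clash_def)
next
  case False
  then show ?thesis using spot_leaf_cases[of u] spot_leaf_cases[of v] assms by (auto simp: clash_def)
qed

definition center :: "nat \<Rightarrow> complex" where "center v = 2 * place_pos (fst (spot v)) (snd (spot v))"

theorem contact_rep: "unit_disk_contact_rep n E (\<lambda>v. (Re (center v), Im (center v))) 1"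
  unfolding unit_disk_contact_rep_iff
proof (intro conjI allI impI)
  fix u v assume uv: "u < n" "v < n" "u \<noteq> v"
  let ?d = "norm (place_pos (fst (spot u)) (snd (spot u)) - place_pos (fst (spot v)) (snd (spot v)))"
  have "dist (Re (center u), Im (center u)) (Re (center v), Im (center v)) = norm (center u - center v)"
    by (simp add: dist_Pair_Pair dist_real_def cmod_def)
  also have "\<dots> = 2 * ?d"
    unfolding center_def right_diff_distrib[symmetric] norm_mult by simp
  finally have e: "dist (Re (center u), Im (center u)) (Re (center v), Im (center v)) = 2 * ?d" .
  have "?d = 1" if "(u, v) \<in> E"
    using spot_related[OF uv(1,2)] that by (intro related_dist) simp
  moreover have "?d > 1" if "(u, v) \<notin> E"
    using spot_related[OF uv(1,2)] that spot_range[OF uv(1)] spot_range[OF uv(2)] spot_inj[OF uv(1,2)] uv(3)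
      spot_no_clash[OF uv(1,2)] spot_no_clash[OF uv(2,1)]
    by (intro unrelated_dist) auto
  ultimately show "if (u, v) \<in> E then dist (Re (center u), Im (center u)) (Re (center v), Im (center v)) = 2 * 1
    else dist (Re (center u), Im (center u)) (Re (center v), Im (center v)) > 2 * 1"
    unfolding e by simp
qed simp

end

section \<open>Structured programs for the Real RAM\<close>

fun effect :: "instr \<Rightarrow> mem \<Rightarrow> mem option" where
  "effect (LoadConst d k) m = Some (m(d := of_int k))"
| "effect (Add d a b) m = Some (m(d := m a + m b))"
| "effect (Sub d a b) m = Some (m(d := m a - m b))"
| "effect (Mul d a b) m = Some (m(d := m a * m b))"
| "effect (Div d a b) m = (if m b = 0 then None else Some (m(d := m a / m b)))"
| "effect (Sqrt d a) m = (if m a < 0 then None else Some (m(d := sqrt (m a))))"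
| "effect (Sin d a) m = Some (m(d := sin (m a)))"
| "effect (Cos d a) m = Some (m(d := cos (m a)))"
| "effect (Arctan d a) m = Some (m(d := arctan (m a)))"
| "effect (LoadInd d a) m = (if m a \<in> \<nat> then Some (m(d := m (nat \<lfloor>m a\<rfloor>))) else None)"
| "effect (StoreInd a s) m = (if m a \<in> \<nat> then Some (m(nat \<lfloor>m a\<rfloor> := m s)) else None)"
| "effect (JmpLe a b t) m = None"
| "effect Halt m = None"

lemma step_effect: "effect i m = Some m' \<Longrightarrow> step i pc m = Some (Suc pc, m')"
  by (cases i) (auto split: if_splits)

fun exec :: "instr list \<Rightarrow> mem \<Rightarrow> mem option" where
  "exec [] m = Some m"
| "exec (i # is) m = (case effect i m of None \<Rightarrow> None | Some m' \<Rightarrow> exec is m')"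

lemma exec_append: "exec (is @ js) m = (case exec is m of None \<Rightarrow> None | Some m' \<Rightarrow> exec js m')"
  by (induction "is" arbitrary: m) (auto split: option.splits)

lemma exec_append_Some: "exec is m = Some m1 \<Longrightarrow> exec js m1 = r \<Longrightarrow> exec (is @ js) m = r"
  by (simp add: exec_append)

datatype cmd = Block "instr list" | Seq cmd cmd (infixr ";;" 60)
  | IfLe nat nat cmd cmd | WhileLe nat nat cmd

fun csize :: "cmd \<Rightarrow> nat" where
  "csize (Block is) = length is"
| "csize (c ;; d) = csize c + csize d"
| "csize (IfLe a b c d) = csize c + csize d + 2"
| "csize (WhileLe a b c) = csize c + 3"

text \<open>Jump targets are absolute, so the start address \<open>p\<close> is a parameter.
  \<open>JmpLe 0 0\<close> compares a cell with itself and thus always jumps. The else branch comes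
  first because the conditional jump is taken when the test succeeds.\<close>

fun compile :: "nat \<Rightarrow> cmd \<Rightarrow> instr list" where
  "compile p (Block is) = is"
| "compile p (c ;; d) = compile p c @ compile (p + csize c) d"
| "compile p (IfLe a b c d) = JmpLe a b (p + csize d + 2) # compile (Suc p) d @
     JmpLe 0 0 (p + csize d + csize c + 2) # compile (p + csize d + 2) c"
| "compile p (WhileLe a b c) = JmpLe a b (p + 2) # JmpLe 0 0 (p + csize c + 3) #
     compile (p + 2) c @ [JmpLe 0 0 p]"

lemma length_compile [simp]: "length (compile p c) = csize c"
  by (induction c arbitrary: p) auto

text \<open>The number counts machine steps exactly, including the jumps inserted by
  \<open>compile\<close>.\<close>

inductive big_step :: "cmd \<Rightarrow> mem \<Rightarrow> nat \<Rightarrow> mem \<Rightarrow> bool" where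
  BlockI: "exec is m = Some m' \<Longrightarrow> big_step (Block is) m (length is) m'"
| SeqI: "big_step c m t m' \<Longrightarrow> big_step d m' t' m'' \<Longrightarrow> big_step (c ;; d) m (t + t') m''"
| IfTrue: "m a \<le> m b \<Longrightarrow> big_step c m t m' \<Longrightarrow> big_step (IfLe a b c d) m (Suc t) m'"
| IfFalse: "\<not> m a \<le> m b \<Longrightarrow> big_step d m t m' \<Longrightarrow> big_step (IfLe a b c d) m (Suc (t + 1)) m'"
| WhileTrue: "m a \<le> m b \<Longrightarrow> big_step c m t m' \<Longrightarrow> big_step (WhileLe a b c) m' t' m'' \<Longrightarrow>
    big_step (WhileLe a b c) m (Suc (t + Suc t')) m''"
| WhileFalse: "\<not> m a \<le> m b \<Longrightarrow> big_step (WhileLe a b c) m 2 m"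

lemma run_add: "run P (s + t) c = (case run P s c of None \<Rightarrow> None | Some c' \<Rightarrow> run P t c')"
proof (induction s arbitrary: c)
  case (Suc s)
  then show ?case by (cases c) (auto split: option.splits)
qed simp

lemma run_step:
  assumes "pc < length P" "step (P ! pc) pc m = Some c"
  shows "run P (Suc t) (pc, m) = run P t c"
  using assms by simp

lemma run_exec:
  "exec is m = Some m' \<Longrightarrow> run (pre @ is @ post) (length is) (length pre, m) = Some (length pre + length is, m')"
proof (induction "is" arbitrary: m pre)
  case (Cons i js)
  then obtain m1 where m1: "effect i m = Some m1" "exec js m1 = Some m'" by (auto split: option.splits)
  then show ?case using Cons.IH[of m1 "pre @ [i]"] step_effect[of i m m1 "length pre"] by (simp add: nth_append)
qed simp

lemma run_big_step:
  assumes "big_step c m t m'"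
  shows "run (pre @ compile (length pre) c @ post) t (length pre, m) = Some (length pre + csize c, m')"
  using assms
proof (induction arbitrary: pre post rule: big_step.induct)
  case (BlockI "is" m m')
  then show ?case by (simp add: run_exec)
next
  case (SeqI c m t m' d t' m'')
  let ?P = "pre @ compile (length pre) (c ;; d) @ post"
  have "run ?P t (length pre, m) = Some (length pre + csize c, m')"
    using SeqI.IH(1)[of pre "compile (length pre + csize c) d @ post"] by simp
  moreover have "run ?P t' (length pre + csize c, m') = Some (length pre + csize c + csize d, m'')"
    using SeqI.IH(2)[of "pre @ compile (length pre) c" post] by simp
  ultimately show ?case by (simp add: run_add)
next
  case (IfTrue m a b c t m' d)
  let ?p = "length pre"
  let ?l = "JmpLe a b (?p + csize d + 2) # compile (Suc ?p) d @ [JmpLe 0 0 (?p + csize d + csize c + 2)]"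
  let ?P = "pre @ compile ?p (IfLe a b c d) @ post"
  have "run ?P t (?p + csize d + 2, m) = Some (?p + csize d + 2 + csize c, m')"
    using IfTrue.IH[of "pre @ ?l" post] by simp
  moreover have "run ?P (Suc t) (?p, m) = run ?P t (?p + csize d + 2, m)"
    using IfTrue.hyps(1) by (intro run_step) (auto simp: nth_append)
  ultimately show ?case by (simp add: add_ac)
next
  case (IfFalse m a b d t m' c)
  let ?p = "length pre"
  let ?P = "pre @ compile ?p (IfLe a b c d) @ post"
  have 1: "run ?P (Suc (t + 1)) (?p, m) = run ?P (t + 1) (Suc ?p, m)"
    using IfFalse.hyps(1) by (intro run_step) (auto simp: nth_append)
  have 2: "run ?P t (Suc ?p, m) = Some (Suc ?p + csize d, m')"
    using IfFalse.IH[of "pre @ [JmpLe a b (?p + csize d + 2)]"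
      "JmpLe 0 0 (?p + csize d + csize c + 2) # compile (?p + csize d + 2) c @ post"] by simp
  have 3: "run ?P 1 (Suc ?p + csize d, m') = Some (?p + csize d + csize c + 2, m')"
    by (simp add: nth_append)
  show ?case unfolding 1 run_add 2 using 3 by (simp add: add_ac)
next
  case (WhileTrue m a b c t m' t' m'')
  let ?p = "length pre"
  let ?P = "pre @ compile ?p (WhileLe a b c) @ post"
  have 1: "run ?P (Suc (t + Suc t')) (?p, m) = run ?P (t + Suc t') (?p + 2, m)"
    using WhileTrue.hyps(1) by (intro run_step) (auto simp: nth_append)
  have 2: "run ?P t (?p + 2, m) = Some (?p + 2 + csize c, m')"
    using WhileTrue.IH(1)[of "pre @ [JmpLe a b (?p + 2), JmpLe 0 0 (?p + csize c + 3)]" "JmpLe 0 0 ?p # post"] by simp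
  have 3: "run ?P (Suc t') (?p + 2 + csize c, m') = run ?P t' (?p, m')"
    by (intro run_step) (auto simp: nth_append)
  show ?case unfolding 1 run_add 2 using 3 WhileTrue.IH(2)[of pre post] by simp
next
  case (WhileFalse m a b c)
  let ?p = "length pre"
  let ?P = "pre @ compile ?p (WhileLe a b c) @ post"
  have 1: "run ?P (Suc (Suc 0)) (?p, m) = run ?P (Suc 0) (Suc ?p, m)"
    using WhileFalse by (intro run_step) (auto simp: nth_append)
  have 2: "run ?P (Suc 0) (Suc ?p, m) = run ?P 0 (?p + csize c + 3, m)"
    by (intro run_step) (auto simp: nth_append)
  show ?case using 1 2 by (simp add: numeral_2_eq_2)
qed

text \<open>A total-correctness judgement with an upper bound on the running time. The postcondition
  may itself be an \<open>ends\<close> statement, which is how sequences are chained.\<close>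

definition ends :: "cmd \<Rightarrow> mem \<Rightarrow> nat \<Rightarrow> (mem \<Rightarrow> bool) \<Rightarrow> bool" where
  "ends c m T Q \<longleftrightarrow> (\<exists>t m'. big_step c m t m' \<and> t \<le> T \<and> Q m')"

lemma ends_halts:
  assumes "ends c m T Q"
  obtains m' where "halts_within (compile 0 c @ [Halt]) m T m'" "Q m'"
proof -
  obtain t m' where t: "big_step c m t m'" "t \<le> T" "Q m'" using assms by (auto simp: ends_def)
  have "run (compile 0 c @ [Halt]) t (0, m) = Some (csize c, m')"
    using run_big_step[OF t(1), of "[]" "[Halt]"] by simp
  then have "halts_within (compile 0 c @ [Halt]) m T m'"
    unfolding halts_within_def using t(2) by (intro exI[of _ t] exI[of _ "csize c"]) (simp add: nth_append)
  then show thesis using that t(3) by blast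
qed

lemma ends_mono: "ends c m T Q \<Longrightarrow> T \<le> T' \<Longrightarrow> (\<And>m. Q m \<Longrightarrow> Q' m) \<Longrightarrow> ends c m T' Q'"
  unfolding ends_def by (meson order_trans)

lemma ends_Block: "exec is m = Some m' \<Longrightarrow> length is \<le> T \<Longrightarrow> Q m' \<Longrightarrow> ends (Block is) m T Q"
  unfolding ends_def by (blast intro: BlockI)

lemma ends_Seq: "ends c m T (\<lambda>m. ends d m T' Q) \<Longrightarrow> T + T' \<le> T'' \<Longrightarrow> ends (c ;; d) m T'' Q"
  unfolding ends_def by (meson SeqI add_mono order_trans)

lemma ends_IfLe:
  "(m a \<le> m b \<Longrightarrow> ends c m T Q) \<Longrightarrow> (m b < m a \<Longrightarrow> ends d m T Q) \<Longrightarrow> T + 2 \<le> T' \<Longrightarrow> ends (IfLe a b c d) m T' Q"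
proof (cases "m a \<le> m b")
  case True
  assume "m a \<le> m b \<Longrightarrow> ends c m T Q" "T + 2 \<le> T'"
  then obtain t m' where "big_step c m t m'" "t \<le> T" "Q m'" using True by (auto simp: ends_def)
  then show ?thesis unfolding ends_def using True \<open>T + 2 \<le> T'\<close>
    by (intro exI[of _ "Suc t"] exI[of _ m']) (auto intro: IfTrue)
next
  case False
  assume "m b < m a \<Longrightarrow> ends d m T Q" "T + 2 \<le> T'"
  then obtain t m' where "big_step d m t m'" "t \<le> T" "Q m'" using False by (auto simp: ends_def)
  then show ?thesis unfolding ends_def using IfFalse[OF False] \<open>T + 2 \<le> T'\<close>
    by (intro exI[of _ "Suc (t + 1)"] exI[of _ m']) auto
qed

text \<open>The invariant is indexed by the number of finished rounds, which also yields termination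
  after \<open>N\<close> rounds. A round costs two jumps besides its body, and leaving the loop
  costs two.\<close>

lemma ends_WhileLe:
  assumes step: "\<And>i m. i < N \<Longrightarrow> I i m \<Longrightarrow> m a \<le> m b \<and> ends c m T (I (Suc i))"
    and exit: "\<And>m. I N m \<Longrightarrow> m b < m a \<and> Q m"
    and init: "I 0 m" and time: "N * (T + 2) + 2 \<le> T'"
  shows "ends (WhileLe a b c) m T' Q"
proof -
  have "\<exists>t m'. big_step (WhileLe a b c) m t m' \<and> t \<le> (N - i) * (T + 2) + 2 \<and> Q m'" if "i \<le> N" "I i m" for i m
    using that
  proof (induction "N - i" arbitrary: i m)
    case 0
    then show ?case using exit[of m] WhileFalse[of m a b c]
      by (intro exI[of _ 2] exI[of _ m]) (auto simp: not_le)
  next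
    case (Suc l)
    have "i < N" "l = N - Suc i" using Suc.hyps(2) by simp_all
    note l = \<open>l = N - Suc i\<close>
    from step[OF \<open>i < N\<close> Suc.prems(2)] obtain t m' where 1: "m a \<le> m b" "big_step c m t m'" "t \<le> T" "I (Suc i) m'"
      by (auto simp: ends_def)
    obtain t' m'' where 2: "big_step (WhileLe a b c) m' t' m''" "t' \<le> (N - Suc i) * (T + 2) + 2" "Q m''"
      using Suc.hyps(1)[OF l _ 1(4)] \<open>i < N\<close> by auto
    have e: "(N - i) * (T + 2) = (N - Suc i) * (T + 2) + (T + 2)"
      using Suc.hyps(2) by (metis Suc_diff_Suc add.commute mult_Suc zero_less_Suc zero_less_diff)
    have "Suc (t + Suc t') \<le> (N - i) * (T + 2) + 2" unfolding e using 1(3) 2(2) by linarith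
    then show ?case using WhileTrue[OF 1(1,2) 2(1)] 2(3) by blast
  qed
  from this[of 0 m] show ?thesis unfolding ends_def using init time by (metis diff_zero le0 order_trans)
qed

text \<open>The input occupies the lowest cells, so no register is free at the start. Cell 0, which holds
  \<open>n\<close>, is turned into \<open>128 n\<^sup>2\<close>, an address beyond the input, and cells 1 to 30 are moved there.\<close>

definition save :: "instr list" where
  "save = [Mul 0 0 0, Add 0 0 0, Add 0 0 0, Add 0 0 0, Add 0 0 0, Add 0 0 0, Add 0 0 0, Add 0 0 0,
     StoreInd 0 1, LoadConst 1 1] @ concat (map (\<lambda>j. [Add 0 0 1, StoreInd 0 j]) [2..<31])"

text \<open>Register 3 holds \<open>B = 128 n\<^sup>2\<close>, register 4 holds \<open>n\<close>, and registers 5 to 11 hold the base addresses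
  \<open>2 B, \<dots>, 8 B\<close> of the following arrays: the oriented edges; the degrees; the number and the
  sum of the spine neighbours; the address of the next free slot (0 for a leaf); the slot angles, 8
  cells per vertex; the coordinates, 2 cells per vertex. Two equal entries mark the end of the edges.\<close>

definition constants :: "instr list" where
  "constants = [LoadConst 2 29, Sub 3 0 2, LoadConst 2 128, Div 4 3 2, Sqrt 4 4, LoadConst 2 2,
     Add 5 3 3, Add 6 5 3, Add 7 6 3, Add 8 7 3, Add 9 8 3, Add 10 9 3, Add 11 10 3]"

text \<open>Register 13 receives the squared difference of the endpoints: at least 1 for an edge, 0
  for the end mark. Squaring replaces an absolute value, so one comparison with 1 controls the
  loops.\<close>

definition load_edge :: "instr list" where
  "load_edge = [LoadInd 14 12, Add 16 12 1, LoadInd 15 16, Sub 13 14 15, Mul 13 13 13]"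

definition store_pairs :: "instr list" where
  "store_pairs = [StoreInd 19 14, Add 19 19 1, StoreInd 19 15, Add 19 19 1, StoreInd 19 15, Add 19 19 1,
     StoreInd 19 14, Add 19 19 1, Add 12 12 2]"

text \<open>The input is now split: its first 30 cells lie from address \<open>B\<close> on, the
  others are still in place. Register 18 holds \<open>B + 30\<close>, at which the reading pointer
  has to continue with address 31.\<close>

definition duplicate_body :: cmd where
  "duplicate_body = Block store_pairs ;; IfLe 18 12 (Block [LoadConst 12 31]) (Block []) ;; Block load_edge"

definition duplicate_edges :: cmd where
  "duplicate_edges =
     Block ([LoadConst 18 30, Add 18 18 3, LoadConst 0 0, Add 19 5 0, Add 12 3 0] @ load_edge) ;;
     WhileLe 1 13 (
       duplicate_body)"

definition for_edges :: "cmd \<Rightarrow> cmd" where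
  "for_edges c = Block ([LoadConst 0 0, Add 12 5 0] @ load_edge) ;;
     WhileLe 1 13 (c ;; Block (Add 12 12 2 # load_edge))"

definition count_degree :: cmd where
  "count_degree = Block [Add 16 6 14, LoadInd 17 16, Add 17 17 1, StoreInd 16 17]"

definition count_spine :: cmd where
  "count_spine = Block [Add 16 6 15, LoadInd 17 16] ;;
     IfLe 2 17 (Block [Add 16 7 14, LoadInd 17 16, Add 17 17 1, StoreInd 16 17,
       Add 16 8 14, LoadInd 17 16, Add 17 17 15, StoreInd 16 17]) (Block [])"

definition find_start :: cmd where
  "find_start = Block [LoadConst 18 0, LoadConst 12 0, Sub 13 4 1] ;;
     WhileLe 12 13 (
       Block [Add 16 6 12, LoadInd 17 16, Sub 17 17 1, Mul 17 17 17] ;;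
       IfLe 1 17 (Block [Add 16 7 12, LoadInd 17 16] ;;
         IfLe 17 1 (Block [LoadConst 0 0, Add 18 12 0]) (Block [])) (Block []) ;;
       Block [Add 12 12 1])"

text \<open>Registers: 18 and 19 the current and previous vertex, 20 whether there is a previous one, 21
  whether there is a next one, 22 the value of \<open>narrow\<close>, 23 whether all vertices so far were
  feasible, 24 to 26 position and direction, 28 the drift \<open>\<eta>\<close>, 29 the angle of the lower leaf, 30 \<open>\<pi>\<close>.\<close>

definition spine_init :: "instr list" where
  "spine_init = [LoadConst 19 0, LoadConst 20 0, LoadConst 21 1, LoadConst 22 0, LoadConst 23 1,
     LoadConst 24 0, LoadConst 25 0, Arctan 30 1, Add 30 30 30, Add 30 30 30, Add 28 4 1,
     LoadConst 16 1000, Mul 28 28 16, Div 28 1 28, LoadConst 0 0, Sub 26 0 28, Sub 26 26 28,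
     LoadConst 16 3, Div 29 30 16, Sub 29 0 29, LoadConst 16 4, Mul 16 16 4, Add 16 16 2,
     Mul 16 16 28, Sub 29 29 16]"

definition walk_position :: "instr list" where
  "walk_position = [Cos 16 26, Mul 16 16 2, Add 24 24 16, Sin 16 26, Mul 16 16 2, Add 25 25 16, Sub 27 26 28,
     Add 16 18 18, Add 16 11 16, StoreInd 16 24, Add 16 16 1, StoreInd 16 25]"

text \<open>The slot pointer starts behind as many slots as there are spine neighbours; being
  positive, it also marks the vertex as belonging to the spine. Register 21 is the number of spine
  neighbours minus the indicator of a predecessor, hence the indicator of a successor.\<close>

definition walk_pointer :: "instr list" where
  "walk_pointer = [LoadConst 12 8, Mul 12 12 18, Add 12 10 12, Add 16 7 18, LoadInd 17 16, Add 13 12 17,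
     Add 16 9 18, StoreInd 16 13, Sub 21 17 20]"

definition walk_turn :: "instr list" where
  "walk_turn = [Add 14 30 26, StoreInd 12 14, Add 12 12 1, Sub 26 27 28, Sub 26 26 28]"

definition walk_lower :: "instr list" where
  "walk_lower = [Add 12 12 1, StoreInd 12 29, Add 29 29 28, Add 12 12 1]"

text \<open>Slot 3 is computed without a branch: subtracting pi/3 + \<eta> times the
  \<open>narrow\<close> flag turns the angle of \<open>Back\<close> into that of
  \<open>Front\<close>. Register 27 holds the direction of the incoming spine step minus
  \<eta>.\<close>

definition walk_upper :: "instr list" where
  "walk_upper = [LoadConst 16 3, Div 16 30 16, Add 17 16 16, Add 17 17 27, Add 14 16 28, Mul 14 14 22,
     Sub 14 17 14, StoreInd 12 14, Add 12 12 1, Add 14 16 27, Sub 14 14 28, StoreInd 12 14]"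

definition walk_degree :: "instr list" where
  "walk_degree = [Add 16 6 18, LoadInd 17 16, LoadConst 16 5]"

definition walk_next :: "instr list" where
  "walk_next = [Add 16 8 18, LoadInd 17 16, Sub 17 17 19, LoadConst 0 0, Add 19 18 0, Add 18 17 0,
     LoadConst 20 1]"

definition walk_narrow :: cmd where
  "walk_narrow = IfLe 16 17
       (IfLe 1 22 (Block [LoadConst 23 0]) (Block []) ;;
        Block [LoadConst 22 1, LoadConst 16 6] ;;
        IfLe 16 17 (Block [LoadConst 23 0]) (Block []))
       (Block [LoadConst 16 4] ;; IfLe 16 17 (Block []) (Block [LoadConst 22 0]))"

definition walk_body :: cmd where
  "walk_body = Block (walk_position @ walk_pointer @ walk_turn) ;;
       IfLe 1 21 (Block [StoreInd 12 14]) (Block [StoreInd 12 26]) ;;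
       Block (walk_lower @ walk_upper @ walk_degree) ;;
       walk_narrow ;;
       Block walk_next"

definition place_spine :: cmd where
  "place_spine =
     Block spine_init ;;
     WhileLe 1 21 (
       walk_body)"

definition leaf_slot :: "instr list" where
  "leaf_slot = [Add 16 9 14, LoadInd 17 16, LoadInd 27 17, Add 17 17 1, StoreInd 16 17]"

definition leaf_parent :: "instr list" where
  "leaf_parent = [Add 16 14 14, Add 16 11 16, LoadInd 24 16, Add 16 16 1, LoadInd 25 16]"

definition leaf_shift :: "instr list" where
  "leaf_shift = [Cos 17 27, Mul 17 17 2, Add 24 24 17, Sin 17 27, Mul 17 17 2, Add 25 25 17]"

definition leaf_store :: "instr list" where
  "leaf_store = [Add 16 15 15, Add 16 11 16, StoreInd 16 24, Add 16 16 1, StoreInd 16 25]"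

text \<open>Only oriented edges whose second end has pointer 0, that is, ends in a leaf, have an
  effect. The first end is then the parent, whose pointer supplies the direction and is
  advanced.\<close>

definition place_leaf :: cmd where
  "place_leaf = Block [Add 16 9 15, LoadInd 17 16, LoadConst 0 0] ;;
     IfLe 17 0 (Block (leaf_slot @ leaf_parent @ leaf_shift @ leaf_store)) (Block [])"

text \<open>The output overlaps the registers. A loop writes the cells from 31 on. Straight-line
  code then fills the cells 30 down to 2 with only cell 0 as pointer and the constant 1 in cell 1,
  and these two are overwritten last.\<close>

definition write_output :: cmd where
  "write_output = Block [LoadConst 12 31, Add 13 4 4] ;;
     WhileLe 12 13 (Block [Add 16 11 12, Sub 16 16 1, LoadInd 17 16, StoreInd 12 17, Add 12 12 1]) ;;
     Block ([LoadConst 16 29, Add 0 11 16] @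
       concat (map (\<lambda>j. [LoadInd j 0, Sub 0 0 1]) (rev [2..<31])) @ [LoadInd 1 0, LoadConst 0 1])"

definition program :: cmd where
  "program = Block (save @ constants) ;; duplicate_edges ;; for_edges count_degree ;;
     for_edges count_spine ;; find_start ;; place_spine ;;
     IfLe 1 23 (for_edges place_leaf ;; write_output) (Block [LoadConst 0 0])"

section \<open>Memory layout\<close>

lemma edge_list_bounds:
  assumes "graph_on n E" "edge_list_of E es"
  shows "length es \<le> n * n" "\<And>u v. (u, v) \<in> set es \<Longrightarrow> u < n \<and> v < n \<and> u \<noteq> v"
proof -
  show 1: "u < n \<and> v < n \<and> u \<noteq> v" if "(u, v) \<in> set es" for u v
  proof -
    have "(u, v) \<in> E" using assms(2) that unfolding edge_list_of_def by blast
    then show ?thesis using assms(1) unfolding graph_on_def by auto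
  qed
  have "distinct es" using assms(2) by (simp add: edge_list_of_def distinct_map)
  then have "length es = card (set es)" by (simp add: distinct_card)
  also have "\<dots> \<le> card ({..<n} \<times> {..<n})" by (rule card_mono) (use 1 in auto)
  finally show "length es \<le> n * n" by simp
qed

text \<open>Memory is viewed as consecutive arrays of length \<open>B\<close>; the registers and the input lie in array 0.\<close>

locale machine =
  fixes n :: nat and es :: "(nat \<times> nat) list" and B :: nat
  assumes n: "n \<ge> 1" and B: "B = 128 * n * n"
    and len: "length es \<le> n * n" and edges: "\<And>u v. (u, v) \<in> set es \<Longrightarrow> u < n \<and> v < n \<and> u \<noteq> v"
begin

definition cell :: "nat \<Rightarrow> nat \<Rightarrow> nat" where "cell a i = a * B + i"

lemma nn: "n \<le> n * n" using n by simp

text \<open>The factor 128 arises from seven doublings of cell 0. It makes one array large enough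
  for the registers, for 8 cells per vertex, or for 4 cells per edge with an end mark.\<close>

lemma B_ge: "128 \<le> B" "128 * n \<le> B" "128 * length es \<le> B"
proof -
  show "128 * n \<le> B" using nn B by simp
  then show "128 \<le> B" using n by linarith
  show "128 * length es \<le> B" using len B by simp
qed

lemma cell_inj [simp]: "i < B \<Longrightarrow> j < B \<Longrightarrow> cell a i = cell b j \<longleftrightarrow> a = b \<and> i = j"
proof
  assume ij: "i < B" "j < B" and e: "cell a i = cell b j"
  then have "(a * B + i) div B = (b * B + j) div B" "(a * B + i) mod B = (b * B + j) mod B"
    by (simp_all add: cell_def)
  then show "a = b \<and> i = j" using ij by simp
qed simp

lemma cell_ge: assumes "0 < a" shows "128 \<le> cell a i"
proof -
  have "B \<le> a * B" using assms by (cases a) auto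
  then show ?thesis using B_ge(1) unfolding cell_def by linarith
qed

lemma cell_reg [simp]: "0 < a \<Longrightarrow> r < 128 \<Longrightarrow> cell a i \<noteq> r" "0 < a \<Longrightarrow> r < 128 \<Longrightarrow> r \<noteq> cell a i"
  using cell_ge[of a i] by auto

lemma cell_add [simp]: "real (cell a i) + real j = real (cell a (i + j))"
  "real (cell a i) + 1 = real (cell a (Suc i))" "real (cell a i) + 2 = real (cell a (i + 2))"
  "real (cell a i) + numeral k = real (cell a (i + numeral k))"
  by (simp_all add: cell_def)

definition const_regs :: "mem \<Rightarrow> bool" where
  "const_regs m \<longleftrightarrow> m 1 = 1 \<and> m 2 = 2 \<and> m 3 = real (cell 1 0) \<and> m 4 = real n \<and> m 5 = real (cell 2 0) \<and>
     m 6 = real (cell 3 0) \<and> m 7 = real (cell 4 0) \<and> m 8 = real (cell 5 0) \<and> m 9 = real (cell 6 0) \<and>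
     m 10 = real (cell 7 0) \<and> m 11 = real (cell 8 0)"

definition inp :: mem where "inp = input_mem n es"

lemma inp_edge: "i < length es \<Longrightarrow> inp (2 * i + 1) = real (fst (es ! i))" "i < length es \<Longrightarrow> inp (2 * i + 2) = real (snd (es ! i))"
  "j > 2 * length es \<Longrightarrow> inp j = 0" "inp 0 = real n"
  by (auto simp: inp_def input_mem_def)

definition saved :: "mem \<Rightarrow> bool" where
  "saved m \<longleftrightarrow> (\<forall>j. 1 \<le> j \<longrightarrow> j \<le> 30 \<longrightarrow> m (cell 1 (j - 1)) = inp j) \<and>
     (\<forall>j. 31 \<le> j \<longrightarrow> j < B \<longrightarrow> m j = inp j) \<and> (\<forall>a i. 2 \<le> a \<longrightarrow> i < B \<longrightarrow> m (cell a i) = 0)"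

text \<open>Cell \<open>j\<close> goes to address \<open>B + j - 1\<close>, so
  \<open>x - B + 1\<close> is the source of the value at \<open>x\<close>.\<close>

lemma exec_save_aux:
  assumes "2 \<le> k" "k \<le> 31" "m 0 = real (cell 1 0)" "m 1 = 1"
  shows "exec (concat (map (\<lambda>j. [Add 0 0 1, StoreInd 0 j]) [2..<k])) m =
    Some (\<lambda>x. if x = 0 then real (cell 1 (k - 2)) else if \<exists>j. 2 \<le> j \<and> j < k \<and> x = cell 1 (j - 1) then m (x - B + 1) else m x)"
  using assms(1,2)
proof (induction k)
  case (Suc k)
  show ?case
  proof (cases "k = 1")
    case True
    then show ?thesis using assms by (auto simp: numeral_2_eq_2 intro!: ext)
  next
    case False
    then have k: "2 \<le> k" "k \<le> 31" using Suc by auto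
    let ?m = "\<lambda>x. if x = 0 then real (cell 1 (k - 2)) else if \<exists>j. 2 \<le> j \<and> j < k \<and> x = cell 1 (j - 1) then m (x - B + 1) else m x"
    have c: "cell 1 (k - 1) - B + 1 = k" using k by (simp add: cell_def)
    have mk: "?m k = m k" "?m 1 = 1" using k assms by auto
    have s: "Suc (k - 2) = k - 1" using k by simp
    have "exec [Add 0 0 1, StoreInd 0 k] ?m = Some (?m(0 := real (cell 1 (k - 1)), cell 1 (k - 1) := ?m k))"
      using k mk s by (simp del: One_nat_def)
    also have "?m(0 := real (cell 1 (k - 1)), cell 1 (k - 1) := ?m k) =
       (\<lambda>x. if x = 0 then real (cell 1 (Suc k - 2)) else if \<exists>j. 2 \<le> j \<and> j < Suc k \<and> x = cell 1 (j - 1) then m (x - B + 1) else m x)"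
    proof (rule ext)
      fix x
      have "(\<exists>j. 2 \<le> j \<and> j < Suc k \<and> x = cell 1 (j - 1)) \<longleftrightarrow> (\<exists>j. 2 \<le> j \<and> j < k \<and> x = cell 1 (j - 1)) \<or> x = cell 1 (k - 1)"
        using k by (auto simp: less_Suc_eq)
      then show "(?m(0 := real (cell 1 (k - 1)), cell 1 (k - 1) := ?m k)) x =
        (if x = 0 then real (cell 1 (Suc k - 2)) else if \<exists>j. 2 \<le> j \<and> j < Suc k \<and> x = cell 1 (j - 1) then m (x - B + 1) else m x)"
        using mk c by (auto simp: Suc_diff_le)
    qed
    finally show ?thesis using Suc.IH[OF k] k by (simp add: exec_append)
  qed
qed simp

lemma exec_save_constants: "\<exists>m. exec (save @ constants) inp = Some m \<and> const_regs m \<and> saved m"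
proof -
  have b: "inp 0 = real n" by (rule inp_edge(4))
  have B': "real (cell 1 0) = 128 * (real n * real n)" unfolding cell_def by (simp add: B)
  have "exec [Mul 0 0 0, Add 0 0 0, Add 0 0 0, Add 0 0 0, Add 0 0 0, Add 0 0 0, Add 0 0 0, Add 0 0 0] inp
     = Some (inp(0 := real (cell 1 0)))"
    unfolding B' by (simp add: b)
  have "exec [StoreInd 0 1, LoadConst 1 1] (inp(0 := real (cell 1 0))) =
      Some (inp(0 := real (cell 1 0), cell 1 0 := inp 1, 1 := 1))" by simp
  define m1 where "m1 = inp(0 := real (cell 1 0), cell 1 0 := inp 1, 1 := 1)"
  define m2 where "m2 x = (if x = 0 then real (cell 1 (31 - 2)) else if \<exists>j. 2 \<le> j \<and> j < 31 \<and> x = cell 1 (j - 1)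
    then m1 (x - B + 1) else m1 x)" for x
  have "exec (concat (map (\<lambda>j. [Add 0 0 1, StoreInd 0 j]) [2..<31])) m1 = Some m2"
    unfolding m2_def by (rule exec_save_aux) (auto simp: m1_def)
  have e: "exec save inp = Some m2"
  proof -
    have sp: "save = [Mul 0 0 0, Add 0 0 0, Add 0 0 0, Add 0 0 0, Add 0 0 0, Add 0 0 0, Add 0 0 0, Add 0 0 0] @
      [StoreInd 0 1, LoadConst 1 1] @ concat (map (\<lambda>j. [Add 0 0 1, StoreInd 0 j]) [2..<31])"
      unfolding save_def by (simp only: append_Cons append_Nil)
    show ?thesis using \<open>exec [Mul 0 0 0, Add 0 0 0, Add 0 0 0, Add 0 0 0, Add 0 0 0, Add 0 0 0, Add 0 0 0, Add 0 0 0] inp = _\<close>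
        \<open>exec [StoreInd 0 1, LoadConst 1 1] _ = _\<close> \<open>exec (concat _) m1 = _\<close>
      unfolding sp exec_append m1_def[symmetric] by (simp only: option.case)
  qed
  have m2a: "m2 x = m1 x" if "x \<noteq> 0" "\<not> (\<exists>j. 2 \<le> j \<and> j < 31 \<and> x = cell 1 (j - 1))" for x
    unfolding m2_def using that by (simp only: if_False)
  have m2b: "m2 x = m1 (x - B + 1)" if "x \<noteq> 0" "\<exists>j. 2 \<le> j \<and> j < 31 \<and> x = cell 1 (j - 1)" for x
    unfolding m2_def using that by (simp only: if_False if_True)
  have s2: "saved m2"
  proof -
    have "m2 (cell 1 (j - 1)) = inp j" if j: "1 \<le> j" "j \<le> 30" for j
    proof (cases "j = 1")
      case True
      have "\<not> (\<exists>j. 2 \<le> j \<and> j < 31 \<and> cell 1 0 = cell 1 (j - 1))" using B_ge(1) by auto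
      then have "m2 (cell 1 0) = m1 (cell 1 0)"
        by (intro m2a) simp_all
      then show ?thesis using True by (simp add: m1_def)
    next
      case False
      then have "\<exists>j'. 2 \<le> j' \<and> j' < 31 \<and> cell 1 (j - 1) = cell 1 (j' - 1)" using j by (intro exI[of _ j]) simp
      then have "m2 (cell 1 (j - 1)) = m1 (cell 1 (j - 1) - B + 1)"
        by (intro m2b) simp_all
      moreover have "cell 1 (j - 1) - B + 1 = j" using j by (simp add: cell_def)
      moreover have "j \<noteq> cell 1 0" using j cell_ge[of 1 0] by simp
      then have "m1 j = inp j" using j False by (simp add: m1_def)
      ultimately show ?thesis by simp
    qed
    moreover have "m2 j = inp j" if j: "31 \<le> j" "j < B" for j
    proof -
      have "\<forall>i. j \<noteq> cell 1 i" using j by (simp add: cell_def)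
      then show ?thesis using j m2a[of j] by (simp add: m1_def)
    qed
    moreover have "m2 (cell a i) = 0" if a: "2 \<le> a" "i < B" for a i
    proof -
      have "\<not> (\<exists>j. 2 \<le> j \<and> j < 31 \<and> cell a i = cell 1 (j - 1))" using a B_ge(1) by auto
      moreover have "cell a i > 2 * length es"
      proof -
        have "2 * B \<le> a * B" using a by simp
        then show ?thesis using B_ge(1,3) unfolding cell_def by linarith
      qed
      ultimately have "m2 (cell a i) = m1 (cell a i)" "inp (cell a i) = 0"
        using inp_edge(3) a m2a[of "cell a i"] by simp_all
      moreover have "cell a i \<noteq> cell 1 0" using a B_ge(1) by (subst cell_inj) auto
      ultimately show ?thesis using a by (simp add: m1_def)
    qed
    ultimately show ?thesis unfolding saved_def by blast
  qed
  have "m2 1 = m1 1" by (rule m2a) (auto simp: cell_reg(2))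
  then have m20: "m2 0 = real (cell 1 29)" "m2 1 = 1" by (simp_all add: m2_def m1_def)
  define m3 where "m3 = m2(2 := 29, 3 := real (cell 1 0), 2 := 128, 4 := real n * real n, 4 := real n, 2 := 2,
    5 := real (cell 2 0), 6 := real (cell 3 0), 7 := real (cell 4 0), 8 := real (cell 5 0),
    9 := real (cell 6 0), 10 := real (cell 7 0), 11 := real (cell 8 0))"
  have r: "real (cell 1 29) - 29 = real (cell 1 0)" "real (cell 1 0) + real (cell 1 0) = real (cell 2 0)"
    "real (cell 2 0) + real (cell 1 0) = real (cell 3 0)" "real (cell 3 0) + real (cell 1 0) = real (cell 4 0)"
    "real (cell 4 0) + real (cell 1 0) = real (cell 5 0)" "real (cell 5 0) + real (cell 1 0) = real (cell 6 0)"
    "real (cell 6 0) + real (cell 1 0) = real (cell 7 0)" "real (cell 7 0) + real (cell 1 0) = real (cell 8 0)"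
    by (simp_all add: cell_def)
  \<comment> \<open>Cell 0 lost the value of \<open>n\<close> when it became an address;
    \<open>n\<close> is recovered as the square root of \<open>B / 128\<close>.\<close>
  have r2: "real (cell 1 0) / 128 = real n * real n" unfolding B' by simp
  have "exec constants m2 = Some m3"
    unfolding constants_def m3_def using m20 by (simp add: r[unfolded One_nat_def] r2[unfolded One_nat_def] del: cell_add)
  moreover have "const_regs m3" using m20 by (simp add: const_regs_def m3_def)
  moreover have "saved m3" using s2 by (simp add: saved_def m3_def)
  ultimately show ?thesis using e by (simp add: exec_append)
qed

definition directed :: "(nat \<times> nat) list" where
  "directed = concat (map (\<lambda>(u, v). [(u, v), (v, u)]) es)"

definition has_edges :: "mem \<Rightarrow> bool" where
  "has_edges m \<longleftrightarrow> (\<forall>i<length directed. m (cell 2 (2 * i)) = real (fst (directed ! i)) \<and>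
     m (cell 2 (Suc (2 * i))) = real (snd (directed ! i))) \<and>
     m (cell 2 (2 * length directed)) = 0 \<and> m (cell 2 (Suc (2 * length directed))) = 0"

lemma length_directed: "length directed = 2 * length es"
  unfolding directed_def by (induction es) auto

lemma set_directed: "set directed = set es \<union> prod.swap ` set es"
  by (auto simp: directed_def)

lemma directed_lt: "(u, v) \<in> set directed \<Longrightarrow> u < n \<and> v < n \<and> u \<noteq> v"
  using edges by (auto simp: set_directed)

lemma nth_directed_lt: "i < length directed \<Longrightarrow> fst (directed ! i) < n \<and> snd (directed ! i) < n \<and> fst (directed ! i) \<noteq> snd (directed ! i)"
  using directed_lt[of "fst (directed ! i)" "snd (directed ! i)"] by simp

lemma sq_diff_ge_1: "u \<noteq> v \<Longrightarrow> 1 \<le> (real u - real v) * (real u - real v)"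
proof -
  assume "u \<noteq> v"
  then have "\<bar>real u - real v\<bar> \<ge> 1" by linarith
  then show ?thesis by (metis abs_mult_self_eq mult_mono' zero_le_one mult_1)
qed

text \<open>The invariant has to be insensitive to the scratch registers of the loop control, and
  the body must preserve the edge pointer in register 12. Inside the proof, \<open>J\<close> adds
  that pair \<open>k\<close> is loaded; the two zero cells behind the list end the loop.\<close>

lemma for_edges_rule:
  assumes body: "\<And>k m. k < length directed \<Longrightarrow> I k m \<Longrightarrow> m 14 = real (fst (directed ! k)) \<Longrightarrow>
      m 15 = real (snd (directed ! k)) \<Longrightarrow> ends c m T (\<lambda>m'. I (Suc k) m' \<and> m' 12 = m 12)"
    and upd: "\<And>k m r v. I k m \<Longrightarrow> r \<in> {0, 12, 13, 14, 15, 16} \<Longrightarrow> I k (m(r := v))"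
    and I: "\<And>k m. I k m \<Longrightarrow> const_regs m \<and> has_edges m"
    and init: "I 0 m" and T': "2 * length es * (T + 10) + 10 \<le> T'"
  shows "ends (for_edges c) m T' (I (length directed))"
proof -
  define J where "J k m \<longleftrightarrow> I k m \<and> m 12 = real (cell 2 (2 * k)) \<and>
      m 14 = m (cell 2 (2 * k)) \<and> m 15 = m (cell 2 (Suc (2 * k))) \<and> m 13 = (m 14 - m 15) * (m 14 - m 15)" for k m
  have load: "\<exists>m'. exec load_edge m = Some m' \<and> J k m'" if "I k m" "m 12 = real (cell 2 (2 * k))" for k m
  proof -
    have 1: "m (Suc 0) = 1" using I[OF that(1)] by (simp add: const_regs_def)
    let ?x = "m (cell 2 (2 * k))" let ?y = "m (cell 2 (Suc (2 * k)))"
    have "exec load_edge m = Some (m(14 := ?x, 16 := real (cell 2 (Suc (2 * k))), 15 := ?y, 13 := ?x - ?y, 13 := (?x - ?y) * (?x - ?y)))"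
      using 1 that(2) by (simp add: load_edge_def)
    moreover have "J k (m(14 := ?x, 16 := real (cell 2 (Suc (2 * k))), 15 := ?y, 13 := ?x - ?y, 13 := (?x - ?y) * (?x - ?y)))"
      unfolding J_def using that by (auto intro!: upd)
    ultimately show ?thesis by blast
  qed
  show ?thesis unfolding for_edges_def
  proof (rule ends_Seq)
    have c: "const_regs m" using I[OF init] by simp
    obtain m' where m': "exec load_edge (m(0 := 0, 12 := real (cell 2 0))) = Some m'" "J 0 m'"
      using load[of 0 "m(0 := 0, 12 := real (cell 2 0))"] upd[OF upd[OF init]] by auto
    show "ends (Block ([LoadConst 0 0, Add 12 5 0] @ load_edge)) m 7
       (\<lambda>m. ends (WhileLe 1 13 (c ;; Block (Add 12 12 2 # load_edge))) m (length directed * (T + 6 + 2) + 2) (I (length directed)))"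
    proof (rule ends_Block)
      show "exec ([LoadConst 0 0, Add 12 5 0] @ load_edge) m = Some m'"
        using m'(1) c by (simp add: const_regs_def)
      show "ends (WhileLe 1 13 (c ;; Block (Add 12 12 2 # load_edge))) m' (length directed * (T + 6 + 2) + 2) (I (length directed))"
      proof (rule ends_WhileLe[where I = J])
        fix k m assume k: "k < length directed" and J: "J k m"
        then have Ik: "I k m" and c: "const_regs m" "has_edges m" using I by (auto simp: J_def)
        have xy: "m 14 = real (fst (directed ! k))" "m 15 = real (snd (directed ! k))"
          using J c(2) k by (auto simp: J_def has_edges_def)
        have "m 13 = (m 14 - m 15) * (m 14 - m 15)" using J by (simp add: J_def)
        then have "m 1 \<le> m 13" using c(1) sq_diff_ge_1 nth_directed_lt[OF k] unfolding xy by (simp add: const_regs_def)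
        moreover have "ends (c ;; Block (Add 12 12 2 # load_edge)) m (T + 6) (J (Suc k))"
        proof (rule ends_Seq)
          show "ends c m T (\<lambda>m. ends (Block (Add 12 12 2 # load_edge)) m 6 (J (Suc k)))"
          proof (rule ends_mono[OF body[OF k Ik xy] order_refl])
            fix m' assume m': "I (Suc k) m' \<and> m' 12 = m 12"
            then have c: "const_regs m'" using I by blast
            have m12: "m' 12 = real (cell 2 (2 * k))" using m' J by (simp add: J_def)
            obtain m'' where "exec load_edge (m'(12 := real (cell 2 (2 * Suc k)))) = Some m''" "J (Suc k) m''"
              using load[of "Suc k" "m'(12 := real (cell 2 (2 * Suc k)))"] upd[of "Suc k" m'] m' by auto
            then show "ends (Block (Add 12 12 2 # load_edge)) m' 6 (J (Suc k))"
              using c m12 by (intro ends_Block[of _ _ m'']) (auto simp: const_regs_def load_edge_def)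
          qed
        qed simp
        ultimately show "m 1 \<le> m 13 \<and> ends (c ;; Block (Add 12 12 2 # load_edge)) m (T + 6) (J (Suc k))" ..
      next
        fix m assume J: "J (length directed) m"
        then have "const_regs m" "has_edges m" using I by (auto simp: J_def)
        then show "m 13 < m 1 \<and> I (length directed) m" using J by (simp add: J_def const_regs_def has_edges_def)
      qed (use m' in auto)
    qed (simp add: load_edge_def)
    show "7 + (length directed * (T + 6 + 2) + 2) \<le> T'" using T' by (simp add: length_directed algebra_simps)
  qed
qed

end

section \<open>Preparing the edge list\<close>

lemma nth_concat_pairs:
  "i < length xs \<Longrightarrow> concat (map (\<lambda>(u, v). [(u, v), (v, u)]) xs) ! (2 * i) = xs ! i \<and>
    concat (map (\<lambda>(u, v). [(u, v), (v, u)]) xs) ! Suc (2 * i) = prod.swap (xs ! i)"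
proof (induction xs arbitrary: i)
  case (Cons x xs)
  show ?case
  proof (cases i)
    case 0
    then show ?thesis by (cases x) simp
  next
    case (Suc j)
    then show ?thesis using Cons by (cases x) simp
  qed
qed simp

lemma distinct_concat_pairs:
  "distinct (map (\<lambda>(u, v). {u, v}) xs) \<Longrightarrow> (\<And>u v. (u, v) \<in> set xs \<Longrightarrow> u \<noteq> v) \<Longrightarrow>
    distinct (concat (map (\<lambda>(u, v). [(u, v), (v, u)]) xs))"
proof (induction xs)
  case (Cons x xs)
  obtain u v where x: "x = (u, v)" by (cases x)
  have "{u, v} \<notin> (\<lambda>(u, v). {u, v}) ` set xs" using Cons.prems(1) x by simp
  then have "(u, v) \<notin> set xs" "(v, u) \<notin> set xs" by (auto simp: insert_commute intro: rev_image_eqI)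
  moreover have "u \<noteq> v" using Cons.prems(2)[of u v] x by simp
  ultimately show ?case using Cons x by auto
qed simp

lemma exec_load_edge:
  assumes "m 1 = 1" "m 12 = real a" "Suc a \<noteq> 14" "Suc a \<noteq> 16"
  shows "exec load_edge m = Some (m(14 := m a, 16 := real (Suc a), 15 := m (Suc a),
    13 := (m a - m (Suc a)) * (m a - m (Suc a))))"
proof -
  have r: "real a + 1 = real (Suc a)" by simp
  have n: "real (Suc a) \<in> \<nat>" "nat \<lfloor>real (Suc a)\<rfloor> = Suc a" by (rule of_nat_in_Nats, simp only: floor_of_nat nat_int)
  show ?thesis
    using assms by (simp add: load_edge_def r n del: of_nat_Suc)
qed

locale graph_machine = machine +
  fixes E assumes graph: "graph_on n E" and edge_list: "edge_list_of E es"
begin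

lemma set_directed_E: "set directed = E"
  using edge_list unfolding set_directed edge_list_of_def by force

lemma distinct_directed: "distinct directed"
  unfolding directed_def using edge_list edges by (intro distinct_concat_pairs) (auto simp: edge_list_of_def)

text \<open>Address at which input cell \<open>j\<close> is found once cells 1 to 30 have been
  moved.\<close>

definition loc :: "nat \<Rightarrow> nat" where "loc j = (if j \<le> 30 then cell 1 (j - 1) else j)"

lemma loc_not_reg: "1 \<le> j \<Longrightarrow> r < 31 \<Longrightarrow> loc j \<noteq> r" "1 \<le> j \<Longrightarrow> r < 31 \<Longrightarrow> r \<noteq> loc j"
  by (auto simp: loc_def)

lemma loc_not_cell: assumes "j < B" "2 \<le> a" "i < B" shows "loc j \<noteq> cell a i"
proof (cases "j \<le> 30")
  case True
  then show ?thesis using assms B_ge(1) by (simp add: loc_def)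
next
  case False
  have "cell 0 j \<noteq> cell a i" using assms by (subst cell_inj) auto
  then show ?thesis using False by (simp add: loc_def cell_def)
qed

text \<open>An edge occupies an odd cell and the even one after it. As 30 is even, the move tears no
  edge apart.\<close>

lemma loc_Suc: "loc (Suc (Suc (2 * i))) = Suc (loc (Suc (2 * i)))"
proof -
  have "Suc (Suc (2 * i)) \<le> 30 \<longleftrightarrow> Suc (2 * i) \<le> 30" by presburger
  then show ?thesis by (simp add: loc_def cell_def)
qed

text \<open>Each input edge yields two oriented edges, hence four cells. The range up to
  \<open>2 * length es + 2\<close> includes the two zero cells behind the input, which stop the
  loop.\<close>

definition dup_inv :: "nat \<Rightarrow> mem \<Rightarrow> bool" where
  "dup_inv i m \<longleftrightarrow> const_regs m \<and> m 18 = real (cell 1 30) \<and> m 19 = real (cell 2 (4 * i)) \<and>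
     (\<forall>j. 1 \<le> j \<longrightarrow> j \<le> 2 * length es + 2 \<longrightarrow> m (loc j) = inp j) \<and>
     (\<forall>j<2 * i. m (cell 2 (2 * j)) = real (fst (directed ! j)) \<and> m (cell 2 (Suc (2 * j))) = real (snd (directed ! j))) \<and>
     (\<forall>j. 4 * i \<le> j \<longrightarrow> j < B \<longrightarrow> m (cell 2 j) = 0) \<and>
     (\<forall>a i. 3 \<le> a \<longrightarrow> i < B \<longrightarrow> m (cell a i) = 0)"

definition loaded :: "nat \<Rightarrow> mem \<Rightarrow> bool" where
  "loaded i m \<longleftrightarrow> m 12 = real (loc (Suc (2 * i))) \<and> m 14 = inp (Suc (2 * i)) \<and> m 15 = inp (Suc (Suc (2 * i))) \<and>
     m 13 = (m 14 - m 15) * (m 14 - m 15)"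

lemma const_regs_upd [simp]:
  "r \<notin> {1, 2, 3, 4, 5, 6, 7, 8, 9, 10, 11} \<Longrightarrow> const_regs (m(r := v)) = const_regs m"
proof -
  assume "r \<notin> {1, 2, 3, 4, 5, 6, 7, 8, 9, 10, 11}"
  then have "\<forall>s\<in>{1, 2, 3, 4, 5, 6, 7, 8, 9, 10, 11}. (m(r := v)) s = m s" by (metis fun_upd_other)
  then show ?thesis unfolding const_regs_def by simp
qed

lemma dup_inv_upd: assumes "dup_inv i m" "r \<in> {0, 12, 13, 14, 15, 16}" shows "dup_inv i (m(r := v))"
proof -
  have r: "r < 31" "r \<noteq> 18" "r \<noteq> 19" "r \<notin> {1, 2, 3, 4, 5, 6, 7, 8, 9, 10, 11}" using assms(2) by auto
  have "(m(r := v)) (loc j) = m (loc j)" if "1 \<le> j" for j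
    using loc_not_reg(1)[OF that r(1)] by simp
  moreover have "(m(r := v)) (cell a j) = m (cell a j)" if "0 < a" for a j
    using cell_reg(1)[OF that, of r j] r(1) by simp
  moreover have "const_regs (m(r := v)) = const_regs m" by (rule const_regs_upd[OF r(4)])
  moreover have "(m(r := v)) 18 = m 18" "(m(r := v)) 19 = m 19" using r by auto
  ultimately show ?thesis using assms(1) unfolding dup_inv_def by simp
qed

lemma exec_load_dup:
  assumes "dup_inv i m" "m 12 = real (loc (Suc (2 * i)))" "i \<le> length es"
  shows "\<exists>m'. exec load_edge m = Some m' \<and> dup_inv i m' \<and> loaded i m'"
proof -
  have s: "m (loc (Suc (2 * i))) = inp (Suc (2 * i))" "m (Suc (loc (Suc (2 * i)))) = inp (Suc (Suc (2 * i)))"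
    using assms(1,3) unfolding loc_Suc[symmetric] dup_inv_def by auto
  have "Suc (loc (Suc (2 * i))) \<noteq> 14" "Suc (loc (Suc (2 * i))) \<noteq> 16"
    unfolding loc_Suc[symmetric] by (rule loc_not_reg; simp)+
  then have "exec load_edge m = Some (m(14 := inp (Suc (2 * i)), 16 := real (Suc (loc (Suc (2 * i)))),
      15 := inp (Suc (Suc (2 * i))),
      13 := (inp (Suc (2 * i)) - inp (Suc (Suc (2 * i)))) * (inp (Suc (2 * i)) - inp (Suc (Suc (2 * i))))))"
    using exec_load_edge[of m "loc (Suc (2 * i))"] assms(1,2) unfolding s by (simp add: dup_inv_def const_regs_def)
  moreover have "dup_inv i (m(14 := inp (Suc (2 * i)), 16 := real (Suc (loc (Suc (2 * i)))),
      15 := inp (Suc (Suc (2 * i))),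
      13 := (inp (Suc (2 * i)) - inp (Suc (Suc (2 * i)))) * (inp (Suc (2 * i)) - inp (Suc (Suc (2 * i))))))"
    by (intro dup_inv_upd assms(1)) auto
  ultimately show ?thesis using assms(2) by (simp add: loaded_def)
qed

definition zero_from :: "nat \<Rightarrow> mem \<Rightarrow> bool" where
  "zero_from b m \<longleftrightarrow> (\<forall>a i. b \<le> a \<longrightarrow> i < B \<longrightarrow> m (cell a i) = 0)"

lemma zero_from_mono: "zero_from b m \<Longrightarrow> b \<le> b' \<Longrightarrow> zero_from b' m"
  by (simp add: zero_from_def)

lemma zero_from_upd [simp]: "r < 128 \<Longrightarrow> 0 < b \<Longrightarrow> zero_from b (m(r := v)) = zero_from b m"
  "a < b \<Longrightarrow> i < B \<Longrightarrow> zero_from b (m(cell a i := v)) = zero_from b m"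
  unfolding zero_from_def by (auto simp del: cell_inj) (metis cell_inj not_le)+

lemma exec_store_pairs:
  assumes "m 1 = 1" "m 2 = 2" "m 19 = real (cell 2 (4 * i))" "m 12 = p" "m 14 = u" "m 15 = v"
  shows "exec store_pairs m =
    Some (m(cell 2 (4 * i) := u, 19 := real (cell 2 (Suc (4 * i))),
         cell 2 (Suc (4 * i)) := v, 19 := real (cell 2 (Suc (Suc (4 * i)))),
         cell 2 (Suc (Suc (4 * i))) := v, 19 := real (cell 2 (Suc (Suc (Suc (4 * i))))),
         cell 2 (Suc (Suc (Suc (4 * i)))) := u, 19 := real (cell 2 (Suc (Suc (Suc (Suc (4 * i)))))),
         12 := p + 2))"
  using assms by (simp add: store_pairs_def)

lemma duplicate_edges:
  assumes "const_regs m" "saved m"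
  shows "ends duplicate_edges m (40 * length es + 40) (\<lambda>m. const_regs m \<and> has_edges m \<and> zero_from 3 m)"
  unfolding duplicate_edges_def
proof (rule ends_Seq)
  let ?m0 = "m(18 := real (cell 1 30), 0 := 0, 19 := real (cell 2 0), 12 := real (cell 1 0))"
  have src: "m (loc j) = inp j" if "1 \<le> j" "j \<le> 2 * length es + 2" for j
    using assms(2) that B_ge unfolding saved_def loc_def by (auto simp: nn)
  have "dup_inv 0 ?m0"
    unfolding dup_inv_def
  proof (intro conjI allI impI)
    show "const_regs ?m0" using assms(1) by (simp add: const_regs_def)
    show "?m0 (loc j) = inp j" if "1 \<le> j" "j \<le> 2 * length es + 2" for j
      using src[OF that] loc_not_reg[OF that(1)] by simp
    show "?m0 (cell 2 j) = 0" if "j < B" for j using assms(2) that by (simp add: saved_def)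
    show "?m0 (cell a i) = 0" if "3 \<le> a" "i < B" for a i using assms(2) that by (simp add: saved_def)
  qed auto
  from exec_load_dup[OF this] obtain m' where m': "exec load_edge ?m0 = Some m'" "dup_inv 0 m'" "loaded 0 m'"
    by (auto simp: loc_def)
  let ?W = "WhileLe 1 13
          duplicate_body"
  let ?Q = "\<lambda>m. const_regs m \<and> has_edges m \<and> zero_from 3 m"
  show "ends (Block ([LoadConst 18 30, Add 18 18 3, LoadConst 0 0, Add 19 5 0, Add 12 3 0] @ load_edge)) m 10
      (\<lambda>m. ends ?W m (40 * length es + 30) ?Q)"
  proof (rule ends_Block)
    have "30 + real (cell 1 0) = real (cell 1 30)" by (simp add: cell_def)
    then show "exec ([LoadConst 18 30, Add 18 18 3, LoadConst 0 0, Add 19 5 0, Add 12 3 0] @ load_edge) m = Some m'"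
      using m'(1) assms(1) by (simp add: const_regs_def fun_upd_twist)
    show "ends ?W m' (40 * length es + 30) ?Q"
    proof (rule ends_WhileLe[where I = "\<lambda>i m. dup_inv i m \<and> loaded i m" and N = "length es" and T = 18])
      fix i m assume i: "i < length es" and I: "dup_inv i m \<and> loaded i m"
      let ?u = "real (fst (es ! i))" and ?v = "real (snd (es ! i))"
      have c: "const_regs m" using I by (simp add: dup_inv_def)
      have xy: "m 14 = ?u" "m 15 = ?v" using I inp_edge(1,2)[OF i] by (auto simp: loaded_def)
      have d: "m 13 = (?u - ?v) * (?u - ?v)" using I unfolding loaded_def xy by simp
      have ne: "fst (es ! i) \<noteq> snd (es ! i)" using edges[of "fst (es ! i)" "snd (es ! i)"] i by simp
      have "m 1 \<le> m 13" unfolding d using c sq_diff_ge_1[OF ne] by (simp add: const_regs_def)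
      have i4: "4 * i + 4 < B" using i B_ge(1,3) by linarith
      have s4: "4 * Suc i = Suc (Suc (Suc (Suc (4 * i))))" by simp
      let ?m1 = "m(cell 2 (4 * i) := ?u, 19 := real (cell 2 (Suc (4 * i))),
         cell 2 (Suc (4 * i)) := ?v, 19 := real (cell 2 (Suc (Suc (4 * i)))),
         cell 2 (Suc (Suc (4 * i))) := ?v, 19 := real (cell 2 (Suc (Suc (Suc (4 * i))))),
         cell 2 (Suc (Suc (Suc (4 * i)))) := ?u, 19 := real (cell 2 (Suc (Suc (Suc (Suc (4 * i)))))),
         12 := real (loc (Suc (2 * i))) + 2)"
      have dup1: "dup_inv (Suc i) (?m1(12 := x))" for x
        unfolding dup_inv_def
      proof (intro conjI allI impI)
        show "const_regs (?m1(12 := x))" using c by (simp add: const_regs_def)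
        show "(?m1(12 := x)) 18 = real (cell 1 30)" using I by (simp add: dup_inv_def)
        show "(?m1(12 := x)) 19 = real (cell 2 (4 * Suc i))" unfolding s4 by simp
        show "(?m1(12 := x)) (loc j) = inp j" if "1 \<le> j" "j \<le> 2 * length es + 2" for j
        proof -
          have "j < B" using that B_ge(1,3) by linarith
          then show ?thesis using I that i4 loc_not_reg[OF that(1)] loc_not_cell[of j 2]
            by (simp add: dup_inv_def)
        qed
        show "(?m1(12 := x)) (cell 2 j) = 0" if "4 * Suc i \<le> j" "j < B" for j
          using I that i4 by (simp add: dup_inv_def)
        show "(?m1(12 := x)) (cell a j) = 0" if "3 \<le> a" "j < B" for a j
          using I that i4 by (simp add: dup_inv_def)
      next
        fix j assume j: "j < 2 * Suc i"
        have old: "j < 2 * i \<Longrightarrow> m (cell 2 (2 * j)) = real (fst (directed ! j)) \<and> m (cell 2 (Suc (2 * j))) = real (snd (directed ! j))"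
          using I by (simp add: dup_inv_def)
        have dn: "directed ! (2 * i) = es ! i" "directed ! Suc (2 * i) = prod.swap (es ! i)"
          using nth_concat_pairs[OF i] by (simp_all add: directed_def)
        have "j < 2 * i \<or> j = 2 * i \<or> j = Suc (2 * i)" using j by auto
        then consider "j < 2 * i" | "j = 2 * i" | "j = Suc (2 * i)" by blast
        then show "(?m1(12 := x)) (cell 2 (2 * j)) = real (fst (directed ! j))"
          "(?m1(12 := x)) (cell 2 (Suc (2 * j))) = real (snd (directed ! j))"
          using i4 old dn by (cases; simp; arith?)+
      qed
      have "ends duplicate_body m 18
         (\<lambda>m. dup_inv (Suc i) m \<and> loaded (Suc i) m)"
        unfolding duplicate_body_def
      proof (rule ends_Seq[where T = 9 and T' = 9])
        have dl: "dup_inv (Suc i) ?m1" using dup1[of "real (loc (Suc (2 * i))) + 2"] by simp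
        have fin: "ends (Block load_edge) m' 5 (\<lambda>m. dup_inv (Suc i) m \<and> loaded (Suc i) m)"
          if "dup_inv (Suc i) m'" "m' 12 = real (loc (Suc (2 * Suc i)))" for m'
          using exec_load_dup[OF that] i by (auto intro!: ends_Block simp: load_edge_def)
        have tl: "ends (IfLe 18 12 (Block [LoadConst 12 31]) (Block []) ;; Block load_edge) ?m1 9
          (\<lambda>m. dup_inv (Suc i) m \<and> loaded (Suc i) m)"
        proof (rule ends_Seq[where T = 3 and T' = 5], rule ends_IfLe[where T = 1])
          assume "?m1 18 \<le> ?m1 12"
          then have "real (cell 1 30) \<le> real (loc (Suc (2 * i)) + 2)" using dl by (simp add: dup_inv_def)
          then have "cell 1 30 \<le> loc (Suc (2 * i)) + 2" by (simp only: of_nat_le_iff)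
          moreover have "Suc (2 * i) < B" using i B_ge(1,3) by linarith
          ultimately have "Suc (2 * i) = 29" by (auto simp: loc_def cell_def split: if_splits) 
          then have l31: "loc (Suc (2 * Suc i)) = 31" by (simp add: loc_def)
          show "ends (Block [LoadConst 12 31]) ?m1 1 (\<lambda>m. ends (Block load_edge) m 5 (\<lambda>m. dup_inv (Suc i) m \<and> loaded (Suc i) m))"
          proof (rule ends_Block[where m' = "?m1(12 := 31)"])
            show "exec [LoadConst 12 31] ?m1 = Some (?m1(12 := 31))" by simp
            show "ends (Block load_edge) (?m1(12 := 31)) 5 (\<lambda>m. dup_inv (Suc i) m \<and> loaded (Suc i) m)"
              by (rule fin[OF dup1]) (simp add: l31[simplified])
          qed simp
        next
          assume "?m1 12 < ?m1 18"
          then have "real (loc (Suc (2 * i)) + 2) < real (cell 1 30)" using dl by (simp add: dup_inv_def)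
          then have "loc (Suc (2 * i)) + 2 < cell 1 30" by (simp only: of_nat_less_iff)
          then have "loc (Suc (2 * i)) + 2 = loc (Suc (2 * Suc i))" by (auto simp: loc_def cell_def split: if_splits) 
          then have l2: "real (loc (Suc (2 * i))) + 2 = real (loc (Suc (2 * Suc i)))" by (simp flip: of_nat_add)
          show "ends (Block []) ?m1 1 (\<lambda>m. ends (Block load_edge) m 5 (\<lambda>m. dup_inv (Suc i) m \<and> loaded (Suc i) m))"
          proof (rule ends_Block[where m' = ?m1])
            show "exec [] ?m1 = Some ?m1" by simp
            show "ends (Block load_edge) ?m1 5 (\<lambda>m. dup_inv (Suc i) m \<and> loaded (Suc i) m)"
              by (rule fin[OF dl]) (simp add: l2[simplified])
          qed simp
        qed simp_all
        have "m 19 = real (cell 2 (4 * i))" "m 12 = real (loc (Suc (2 * i)))" using I unfolding dup_inv_def loaded_def by blast+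
        then have ex: "exec store_pairs m = Some ?m1"
          using c by (intro exec_store_pairs xy) (simp_all only: const_regs_def)
        show "ends (Block store_pairs) m 9 (\<lambda>m. ends (IfLe 18 12 (Block [LoadConst 12 31]) (Block []) ;; Block load_edge) m 9
          (\<lambda>m. dup_inv (Suc i) m \<and> loaded (Suc i) m))"
          by (rule ends_Block, rule ex, simp add: store_pairs_def, rule tl)
      qed simp
      then show "m 1 \<le> m 13 \<and> ends duplicate_body m 18
         (\<lambda>m. dup_inv (Suc i) m \<and> loaded (Suc i) m)"
        using \<open>m 1 \<le> m 13\<close> by blast
    next
      fix m assume I: "dup_inv (length es) m \<and> loaded (length es) m"
      have "m 13 < m 1" using I inp_edge(3) by (simp add: loaded_def dup_inv_def const_regs_def)
      moreover have "has_edges m"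
        using I B_ge(1,3) unfolding has_edges_def length_directed dup_inv_def by auto
      ultimately show "m 13 < m 1 \<and> ?Q m" using I by (auto simp: dup_inv_def zero_from_def)
    qed (use m' in auto)
  qed (simp add: load_edge_def)
qed simp

end

section \<open>Degrees and spine neighbours\<close>

context graph_machine
begin

lemma lt_B: "v < n \<Longrightarrow> v < B" "v < n \<Longrightarrow> 2 * v < B" "v < n \<Longrightarrow> Suc (2 * v) < B" "v < n \<Longrightarrow> 8 * v + 7 < B"
  "i \<le> length directed \<Longrightarrow> 2 * i < B" "i \<le> length directed \<Longrightarrow> Suc (2 * i) < B"
  using B_ge unfolding length_directed by linarith+

lemma has_edges_upd [simp]: "r < 128 \<Longrightarrow> has_edges (m(r := v)) = has_edges m"
  "a \<noteq> 2 \<Longrightarrow> i < B \<Longrightarrow> has_edges (m(cell a i := v)) = has_edges m"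
  unfolding has_edges_def using lt_B by simp_all

definition arr :: "nat \<Rightarrow> (nat \<Rightarrow> real) \<Rightarrow> mem \<Rightarrow> bool" where
  "arr a f m \<longleftrightarrow> (\<forall>v<n. m (cell a v) = f v)"

lemma arrD: "arr a f m \<Longrightarrow> v < n \<Longrightarrow> m (cell a v) = f v"
  by (simp add: arr_def)

lemma arr_upd [simp]: "r < 128 \<Longrightarrow> 0 < a \<Longrightarrow> arr a f (m(r := x)) = arr a f m"
  "a \<noteq> b \<Longrightarrow> i < B \<Longrightarrow> arr a f (m(cell b i := x)) = arr a f m"
  unfolding arr_def using lt_B by simp_all

lemma arr_upd_same: "arr a f m \<Longrightarrow> v < n \<Longrightarrow> (\<And>w. w < n \<Longrightarrow> g w = (if w = v then x else f w)) \<Longrightarrow> arr a g (m(cell a v := x))"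
  unfolding arr_def using lt_B by simp

lemma zero_from_arr: "zero_from b m \<Longrightarrow> b \<le> a \<Longrightarrow> arr a (\<lambda>_. 0) m"
  using lt_B by (simp add: zero_from_def arr_def)

text \<open>\<open>directed\<close> lists \<open>E\<close> without repetition, so counting and
  summing along the list amount to counting and summing over sets of neighbours.\<close>

lemma filter_directed_nbrs:
  "length (filter (\<lambda>e. fst e = v \<and> P (snd e)) directed) = card {w. (v, w) \<in> E \<and> P w}"
  "sum_list (map (real \<circ> snd) (filter (\<lambda>e. fst e = v \<and> P (snd e)) directed)) = (\<Sum>w\<in>{w. (v, w) \<in> E \<and> P w}. real w)"
proof -
  let ?F = "filter (\<lambda>e. fst e = v \<and> P (snd e)) directed"
  have d: "distinct ?F" using distinct_directed by simp
  have s: "set ?F = Pair v ` {w. (v, w) \<in> E \<and> P w}" using set_directed_E by auto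
  have "length ?F = card (set ?F)" by (rule distinct_card[OF d, symmetric])
  then show "length ?F = card {w. (v, w) \<in> E \<and> P w}" unfolding s by (simp add: card_image inj_on_def)
  have "sum_list (map (real \<circ> snd) ?F) = sum (real \<circ> snd) (set ?F)" by (rule sum_list_distinct_conv_sum_set[OF d])
  then show "sum_list (map (real \<circ> snd) ?F) = (\<Sum>w\<in>{w. (v, w) \<in> E \<and> P w}. real w)"
    unfolding s by (simp add: sum.reindex inj_on_def)
qed

abbreviation deg_ok :: "mem \<Rightarrow> bool" where "deg_ok \<equiv> arr 3 (\<lambda>v. real (degree E v))"
abbreviation cnt_ok :: "mem \<Rightarrow> bool" where "cnt_ok \<equiv> arr 4 (\<lambda>v. real (card (spine_nbrs E v)))"
abbreviation sum_ok :: "mem \<Rightarrow> bool" where "sum_ok \<equiv> arr 5 (\<lambda>v. \<Sum>w\<in>spine_nbrs E v. real w)"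

lemma count_degree:
  assumes "const_regs m" "has_edges m" "zero_from 3 m"
  shows "ends (for_edges count_degree) m (28 * length es + 10) (\<lambda>m. const_regs m \<and> has_edges m \<and> deg_ok m \<and> zero_from 4 m)"
proof -
  define f where "f k v = real (length (filter (\<lambda>e. fst e = v) (take k directed)))" for k v
  define I where "I k m \<longleftrightarrow> const_regs m \<and> has_edges m \<and> arr 3 (f k) m \<and> zero_from 4 m" for k m
  have "ends (for_edges count_degree) m (28 * length es + 10) (I (length directed))"
  proof (rule for_edges_rule[where T = 4])
    fix k m assume k: "k < length directed" and I: "I k m" and x: "m 14 = real (fst (directed ! k))"
    let ?u = "fst (directed ! k)"
    have u: "?u < n" using nth_directed_lt[OF k] by simp
    have c: "const_regs m" using I by (simp add: I_def)
    have a: "m (cell 3 ?u) = f k ?u" using I u by (simp add: I_def arr_def)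
    let ?m = "m(16 := real (cell 3 ?u), 17 := f k ?u + 1, cell 3 ?u := f k ?u + 1)"
    have ex: "exec [Add 16 6 14, LoadInd 17 16, Add 17 17 1, StoreInd 16 17] m = Some ?m"
      using c x a by (simp add: const_regs_def)
    have "arr 3 (f (Suc k)) ?m"
      using I u k by (intro arr_upd_same[where f = "f k"]) (auto simp: I_def f_def take_Suc_conv_app_nth)
    then have "I (Suc k) ?m \<and> ?m 12 = m 12" using I u by (simp add: I_def lt_B)
    then show "ends count_degree m 4 (\<lambda>m'. I (Suc k) m' \<and> m' 12 = m 12)"
      unfolding count_degree_def by (intro ends_Block[OF ex]) simp_all
  next
    show "I k (m(r := v))" if "I k m" "r \<in> {0, 12, 13, 14, 15, 16}" for k m r v
      using that by (auto simp: I_def)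
    have "f 0 = (\<lambda>_. 0)" by (auto simp: f_def)
    then show "I 0 m" using assms zero_from_arr[of 3 m 3] zero_from_mono[of 3 m 4] by (simp add: I_def)
  qed (auto simp: I_def)
  then show ?thesis
  proof (rule ends_mono[OF _ order_refl])
    fix m assume "I (length directed) m"
    moreover have "f (length directed) v = real (degree E v)" for v
      using filter_directed_nbrs(1)[of v "\<lambda>_. True"] by (simp add: f_def degree_def)
    then have "f (length directed) = (\<lambda>v. real (degree E v))" by (rule ext)
    ultimately show "const_regs m \<and> has_edges m \<and> deg_ok m \<and> zero_from 4 m" by (simp add: I_def)
  qed
qed

lemma count_spine:
  assumes "const_regs m" "has_edges m" "deg_ok m" "zero_from 4 m"
  shows "ends (for_edges count_spine) m (48 * length es + 10)
    (\<lambda>m. const_regs m \<and> has_edges m \<and> deg_ok m \<and> cnt_ok m \<and> sum_ok m \<and> zero_from 6 m)"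
proof -
  define F where "F k v = filter (\<lambda>e. fst e = v \<and> 2 \<le> degree E (snd e)) (take k directed)" for k v
  define f where "f k v = real (length (F k v))" for k v
  define g where "g k v = sum_list (map (real \<circ> snd) (F k v))" for k v
  define I where "I k m \<longleftrightarrow> const_regs m \<and> has_edges m \<and> deg_ok m \<and> arr 4 (f k) m \<and> arr 5 (g k) m \<and> zero_from 6 m" for k m
  have "ends (for_edges count_spine) m (48 * length es + 10) (I (length directed))"
  proof (rule for_edges_rule[where T = 12])
    fix k m assume k: "k < length directed" and I: "I k m"
      and x: "m 14 = real (fst (directed ! k))" and y: "m 15 = real (snd (directed ! k))"
    let ?u = "fst (directed ! k)" and ?v = "snd (directed ! k)"
    have u: "?u < n" "?v < n" using nth_directed_lt[OF k] by auto
    have c: "const_regs m" using I by (simp add: I_def)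
    have a: "m (cell 3 ?v) = real (degree E ?v)" "m (cell 4 ?u) = f k ?u" "m (cell 5 ?u) = g k ?u"
      using I u by (auto simp: I_def arr_def)
    let ?m0 = "m(16 := real (cell 3 ?v), 17 := real (degree E ?v))"
    have ex0: "exec [Add 16 6 15, LoadInd 17 16] m = Some ?m0" using c y a by (simp add: const_regs_def)
    have m2: "?m0 2 = 2" "?m0 17 = real (degree E ?v)" using c by (simp_all add: const_regs_def)
    let ?m1 = "?m0(16 := real (cell 4 ?u), 17 := f k ?u + 1, cell 4 ?u := f k ?u + 1,
      16 := real (cell 5 ?u), 17 := g k ?u + real ?v, cell 5 ?u := g k ?u + real ?v)"
    have ex1: "exec [Add 16 7 14, LoadInd 17 16, Add 17 17 1, StoreInd 16 17,
       Add 16 8 14, LoadInd 17 16, Add 17 17 15, StoreInd 16 17] ?m0 = Some ?m1"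
      using c x y a u by (simp add: const_regs_def lt_B)
    show "ends count_spine m 12 (\<lambda>m'. I (Suc k) m' \<and> m' 12 = m 12)"
      unfolding count_spine_def
    proof (rule ends_Seq[where T = 2 and T' = 10], rule ends_Block, rule ex0, simp, rule ends_IfLe[where T = 8])
      assume "?m0 2 \<le> ?m0 17"
      then have d: "2 \<le> degree E ?v" unfolding m2 by simp
      have "arr 4 (f k) ?m0" "arr 5 (g k) ?m0" using I by (simp_all add: I_def)
      have F: "F (Suc k) v = (if v = ?u then F k v @ [directed ! k] else F k v)" for v
        using d k by (simp add: F_def take_Suc_conv_app_nth)
      have 4: "arr 4 (f (Suc k)) ?m1"
        using I u unfolding arr_def by (simp add: I_def arr_def f_def F lt_B)
      have 5: "arr 5 (g (Suc k)) ?m1"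
        using I u unfolding arr_def by (simp add: I_def arr_def g_def F lt_B)
      have "I (Suc k) ?m1 \<and> ?m1 12 = m 12" using I u 4 5 unfolding I_def by (simp add: lt_B)
      then show "ends (Block [Add 16 7 14, LoadInd 17 16, Add 17 17 1, StoreInd 16 17,
       Add 16 8 14, LoadInd 17 16, Add 17 17 15, StoreInd 16 17]) ?m0 8 (\<lambda>m'. I (Suc k) m' \<and> m' 12 = m 12)"
        by - (rule ends_Block, rule ex1, simp)
    next
      assume "?m0 17 < ?m0 2"
      then have d: "\<not> 2 \<le> degree E ?v" unfolding m2 by simp
      have F: "F (Suc k) = F k" using d k by (intro ext) (simp add: F_def take_Suc_conv_app_nth)
      have "f (Suc k) = f k" "g (Suc k) = g k" by (intro ext, simp add: f_def g_def F)+
      then have "I (Suc k) ?m0 \<and> ?m0 12 = m 12" using I by (simp add: I_def)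
      then show "ends (Block []) ?m0 8 (\<lambda>m'. I (Suc k) m' \<and> m' 12 = m 12)"
        by - (rule ends_Block, simp, simp)
    qed simp_all
  next
    show "I k (m(r := v))" if "I k m" "r \<in> {0, 12, 13, 14, 15, 16}" for k m r v
      using that by (auto simp: I_def)
    have "f 0 = (\<lambda>_. 0)" "g 0 = (\<lambda>_. 0)" by (auto simp: f_def g_def F_def)
    then show "I 0 m" using assms zero_from_arr[of 4 m] zero_from_mono[of 4 m 6] by (simp add: I_def)
  qed (auto simp: I_def)
  then show ?thesis
  proof (rule ends_mono[OF _ order_refl])
    fix m assume "I (length directed) m"
    \<comment> \<open>The machine tests for degree at least 2. A neighbour never has degree 0, so
      this agrees with degree different from 1.\<close>
    moreover have "{w. (v, w) \<in> E \<and> 2 \<le> degree E w} = spine_nbrs E v" for v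
    proof -
      have "degree E w \<noteq> 0" if "(v, w) \<in> E" for w
      proof -
        have "v \<in> {u. (w, u) \<in> E}" using that graph by (auto simp: graph_on_def sym_def)
        moreover have "finite {u. (w, u) \<in> E}"
          by (rule finite_subset[of _ "{..<n}"]) (use graph in \<open>auto simp: graph_on_def\<close>)
        ultimately show ?thesis unfolding degree_def by (metis card_0_eq empty_iff)
      qed
      then show ?thesis unfolding spine_nbrs_def by force
    qed
    then have "f (length directed) = (\<lambda>v. real (card (spine_nbrs E v)))" "g (length directed) = (\<lambda>v. \<Sum>w\<in>spine_nbrs E v. real w)"
      using filter_directed_nbrs[of _ "\<lambda>w. 2 \<le> degree E w"] by (auto simp: f_def g_def F_def)
    ultimately show "const_regs m \<and> has_edges m \<and> deg_ok m \<and> cnt_ok m \<and> sum_ok m \<and> zero_from 6 m" by (simp add: I_def)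
  qed
qed

definition graph_ok :: "mem \<Rightarrow> bool" where
  "graph_ok m \<longleftrightarrow> const_regs m \<and> has_edges m \<and> deg_ok m \<and> cnt_ok m \<and> sum_ok m"

lemma graph_ok_upd [simp]:
  "r < 128 \<Longrightarrow> r \<notin> {1, 2, 3, 4, 5, 6, 7, 8, 9, 10, 11} \<Longrightarrow> graph_ok (m(r := v)) = graph_ok m"
  "6 \<le> a \<Longrightarrow> i < B \<Longrightarrow> graph_ok (m(cell a i := v)) = graph_ok m"
  unfolding graph_ok_def by simp_all

lemma find_start:
  assumes "graph_ok m" "zero_from 6 m"
  shows "ends find_start m (20 * n + 20) (\<lambda>m. graph_ok m \<and> zero_from 6 m \<and> m 18 = real (start n E))"
proof -
  define h where "h i = fold (\<lambda>v a. if degree E v \<noteq> 1 \<and> card (spine_nbrs E v) \<le> 1 then v else a) [0..<i] 0" for i :: nat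
  define I where "I i m \<longleftrightarrow> graph_ok m \<and> zero_from 6 m \<and> m 12 = real i \<and> m 13 = real n - 1 \<and> m 18 = real (h i)" for i m
  let ?m0 = "m(18 := 0, 12 := 0, 13 := real n - 1)"
  let ?Q = "\<lambda>m. graph_ok m \<and> zero_from 6 m \<and> m 18 = real (start n E)"
  have c: "const_regs m" if "graph_ok m" for m using that by (simp add: graph_ok_def)
  have ex: "exec [LoadConst 18 0, LoadConst 12 0, Sub 13 4 1] m = Some ?m0"
    using c[OF assms(1)] by (simp add: const_regs_def)
  have I0: "I 0 ?m0" using assms by (simp add: I_def h_def)
  show ?thesis unfolding find_start_def
  proof (rule ends_Seq[where T = 3 and T' = "20 * n + 10"], rule ends_Block, rule ex, simp,
      rule ends_WhileLe[where I = I and N = n and T = 14])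
    fix i m assume i: "i < n" and I: "I i m"
    then have g: "graph_ok m" and m: "m 12 = real i" "m 13 = real n - 1" "m 18 = real (h i)" "zero_from 6 m" by (auto simp: I_def)
    have c: "const_regs m" "deg_ok m" "cnt_ok m" using g by (auto simp: graph_ok_def)
    let ?d = "real (degree E i) - 1"
    let ?m1 = "m(16 := real (cell 3 i), 17 := ?d * ?d)"
    have ex1: "exec [Add 16 6 12, LoadInd 17 16, Sub 17 17 1, Mul 17 17 17] m = Some ?m1"
      using c(1) m arrD[OF c(2) i] by (simp add: const_regs_def)
    let ?m2 = "?m1(16 := real (cell 4 i), 17 := real (card (spine_nbrs E i)))"
    have ex2: "exec [Add 16 7 12, LoadInd 17 16] ?m1 = Some ?m2"
      using c(1) m arrD[OF c(3) i] by (simp add: const_regs_def)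
    let ?m3 = "?m2(0 := 0, 18 := real i)"
    have ex3: "exec [LoadConst 0 0, Add 18 12 0] ?m2 = Some ?m3"
      using m by simp
    have fin: "ends (Block [Add 12 12 1]) m' 1 (I (Suc i))"
      if "graph_ok m'" "zero_from 6 m'" "m' 12 = real i" "m' 13 = real n - 1" "m' 18 = real (h (Suc i))" for m'
    proof -
      have "exec [Add 12 12 1] m' = Some (m'(12 := real (Suc i)))" using that(3) c[unfolded const_regs_def] that(1)
        by (simp add: graph_ok_def const_regs_def add.commute)
      moreover have "I (Suc i) (m'(12 := real (Suc i)))" using that by (simp add: I_def)
      ultimately show ?thesis by (intro ends_Block) auto
    qed
    have one: "x 1 = 1" if "graph_ok x" for x using that by (simp add: graph_ok_def const_regs_def)
    have d: "1 \<le> ?d * ?d \<longleftrightarrow> degree E i \<noteq> 1"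
    proof (cases "degree E i = 1")
      case False
      then show ?thesis using sq_diff_ge_1[of "degree E i" 1] by simp
    qed simp
    have "m 12 \<le> m 13" using m i by simp
    moreover have "ends (Block [Add 16 6 12, LoadInd 17 16, Sub 17 17 1, Mul 17 17 17] ;;
       IfLe 1 17 (Block [Add 16 7 12, LoadInd 17 16] ;;
         IfLe 17 1 (Block [LoadConst 0 0, Add 18 12 0]) (Block [])) (Block []) ;;
       Block [Add 12 12 1]) m 14 (I (Suc i))"
    proof (rule ends_Seq[where T = 4 and T' = 10], rule ends_Block, rule ex1, simp,
        rule ends_Seq[where T = 8 and T' = 1], rule ends_IfLe[where T = 6])
      have g1: "graph_ok ?m1" using g by simp
      assume "?m1 1 \<le> ?m1 17"
      then have d1: "degree E i \<noteq> 1" using d one[OF g1] by simp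
      show "ends (Block [Add 16 7 12, LoadInd 17 16] ;;
         IfLe 17 1 (Block [LoadConst 0 0, Add 18 12 0]) (Block [])) ?m1 6 (\<lambda>m. ends (Block [Add 12 12 1]) m 1 (I (Suc i)))"
      proof (rule ends_Seq[where T = 2 and T' = 4], rule ends_Block, rule ex2, simp, rule ends_IfLe[where T = 2])
        have g2: "graph_ok ?m2" using g by simp
        assume "?m2 17 \<le> ?m2 1"
        then have "card (spine_nbrs E i) \<le> 1" using one[OF g2] by simp
        then have "h (Suc i) = i" using d1 by (simp add: h_def)
        then show "ends (Block [LoadConst 0 0, Add 18 12 0]) ?m2 2 (\<lambda>m. ends (Block [Add 12 12 1]) m 1 (I (Suc i)))"
          by - (rule ends_Block, rule ex3, simp, rule fin, use g m in simp_all)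
      next
        have g2: "graph_ok ?m2" using g by simp
        assume "?m2 1 < ?m2 17"
        then have "\<not> card (spine_nbrs E i) \<le> 1" using one[OF g2] by simp
        then have "h (Suc i) = h i" by (simp add: h_def)
        then show "ends (Block []) ?m2 2 (\<lambda>m. ends (Block [Add 12 12 1]) m 1 (I (Suc i)))"
          by - (rule ends_Block, rule exec.simps(1), simp, rule fin, use g m in simp_all)
      qed simp_all
    next
      have g1: "graph_ok ?m1" using g by simp
      assume "?m1 17 < ?m1 1"
      then have "degree E i = 1" using d one[OF g1] by simp
      then have "h (Suc i) = h i" by (simp add: h_def)
      then show "ends (Block []) ?m1 6 (\<lambda>m. ends (Block [Add 12 12 1]) m 1 (I (Suc i)))"
        by - (rule ends_Block, rule exec.simps(1), simp, rule fin, use g m in simp_all)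
    qed simp_all
    ultimately show "m 12 \<le> m 13 \<and> ends (Block [Add 16 6 12, LoadInd 17 16, Sub 17 17 1, Mul 17 17 17] ;;
       IfLe 1 17 (Block [Add 16 7 12, LoadInd 17 16] ;;
         IfLe 17 1 (Block [LoadConst 0 0, Add 18 12 0]) (Block [])) (Block []) ;;
       Block [Add 12 12 1]) m 14 (I (Suc i))" by blast
  next
    fix m assume "I n m"
    then show "m 13 < m 12 \<and> ?Q m" by (simp add: I_def h_def start_def)
  qed (use I0 in simp_all)
qed

end

section \<open>Walking along the spine\<close>

locale spine_machine = graph_machine +
  fixes xs assumes sp: "spine n E xs" and hd_start: "hd xs = start n E"
begin

definition \<eta> :: real where "\<eta> = 1 / ((real n + 1) * 1000)"

sublocale bent_arc \<eta> n
  by unfold_locales (simp_all add: \<eta>_def field_simps)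

lemma xs_lt: "i < length xs \<Longrightarrow> xs ! i < n" by (rule spine_nth_lt[OF sp])

lemma xs_inj: "i < length xs \<Longrightarrow> j < length xs \<Longrightarrow> xs ! i = xs ! j \<longleftrightarrow> i = j"
  using sp by (simp add: spine_def nth_eq_iff_index_eq)

lemma length_xs: "length xs \<le> n"
proof -
  have "length xs = card (set xs)" using sp by (simp add: spine_def distinct_card)
  also have "\<dots> \<le> card {..<n}" using sp by (intro card_mono) (auto simp: spine_def)
  finally show ?thesis by simp
qed

text \<open>Every slot is stored as a direction seen from the parent at position
  \<open>Suc i\<close>: \<open>pi + dir i\<close> leads back to the preceding position of the arc,
  \<open>dir (Suc i)\<close> on to the following one. These are the extra places at the two
  ends.\<close>

definition slot_angle :: "nat \<Rightarrow> nat \<Rightarrow> real" where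
  "slot_angle i s = (if s = 0 then pi + dir i
     else if s = 1 then (if Suc i < length xs then pi + dir i else dir (Suc i))
     else if s = 2 then angle (Suc i) Lower
     else if s = 3 then angle (Suc i) (if narrow E xs i then Front else Back)
     else angle (Suc i) Front)"

definition vertex_ok :: "nat \<Rightarrow> bool" where
  "vertex_ok i \<longleftrightarrow> degree E (xs ! i) \<le> 5 \<and> (degree E (xs ! i) \<ge> 5 \<longrightarrow> \<not> narrow E xs i)"

definition ptr :: "nat \<Rightarrow> real" where
  "ptr i = real (cell 7 (8 * (xs ! i) + card (spine_nbrs E (xs ! i))))"

text \<open>The last clause keeps pointer 0 at vertices not yet visited; after the complete walk
  this identifies the leaves.\<close>

definition placed :: "nat \<Rightarrow> mem \<Rightarrow> bool" where
  "placed i m \<longleftrightarrow> (\<forall>j<i. m (cell 6 (xs ! j)) = ptr j) \<and>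
     (\<forall>j<i. \<forall>s<5. m (cell 7 (8 * (xs ! j) + s)) = slot_angle j s) \<and>
     (\<forall>j<i. m (cell 8 (2 * (xs ! j))) = 2 * Re (spine_pos (Suc j)) \<and>
        m (cell 8 (Suc (2 * (xs ! j)))) = 2 * Im (spine_pos (Suc j))) \<and>
     (\<forall>v<n. v \<notin> set (take i xs) \<longrightarrow> m (cell 6 v) = 0)"

definition walk_inv :: "nat \<Rightarrow> mem \<Rightarrow> bool" where
  "walk_inv i m \<longleftrightarrow> graph_ok m \<and> placed i m \<and>
     m 19 = (if i = 0 then 0 else real (xs ! (i - 1))) \<and> m 20 = (if i = 0 then 0 else 1) \<and>
     m 21 = of_bool (i < length xs) \<and> (i < length xs \<longrightarrow> m 18 = real (xs ! i)) \<and>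
     m 22 = of_bool (narrow E xs i) \<and> m 23 = of_bool (\<forall>j<i. vertex_ok j) \<and>
     m 24 = 2 * Re (spine_pos i) \<and> m 25 = 2 * Im (spine_pos i) \<and> m 26 = dir i \<and> m 28 = \<eta> \<and>
     m 29 = angle (Suc i) Lower \<and> m 30 = pi"

lemma walk_init:
  assumes "graph_ok m" "zero_from 6 m" "m 18 = real (start n E)"
  shows "\<exists>m'. exec spine_init m = Some m' \<and> walk_inv 0 m'"
proof -
  have c: "m 1 = 1" "m 2 = 2" "m 4 = real n" using assms(1) by (simp_all add: graph_ok_def const_regs_def)
  let ?m1 = "m(19 := 0, 20 := 0, 21 := 1, 22 := 0, 23 := 1, 24 := 0, 25 := 0, 30 := pi)"
  have "exec [LoadConst 19 0, LoadConst 20 0, LoadConst 21 1, LoadConst 22 0, LoadConst 23 1,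
       LoadConst 24 0, LoadConst 25 0, Arctan 30 1, Add 30 30 30, Add 30 30 30] m = Some ?m1"
    using c by (simp add: arctan_one)
  moreover let ?m2 = "?m1(28 := real n + 1, 16 := 1000, 28 := (real n + 1) * 1000, 28 := \<eta>, 0 := 0, 26 := - \<eta>, 26 := - \<eta> - \<eta>)"
  have "(real n + 1) * 1000 \<noteq> 0" using of_nat_0_le_iff[of n] by (simp add: add_nonneg_eq_0_iff)
  then have "exec [Add 28 4 1, LoadConst 16 1000, Mul 28 28 16, Div 28 1 28, LoadConst 0 0, Sub 26 0 28, Sub 26 26 28] ?m1 = Some ?m2"
    using c by (simp add: \<eta>_def)
  moreover let ?m3 = "?m2(16 := 3, 29 := pi / 3, 29 := - (pi / 3), 16 := 4, 16 := 4 * real n, 16 := 4 * real n + 2,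
      16 := (4 * real n + 2) * \<eta>, 29 := - (pi / 3) - (4 * real n + 2) * \<eta>)"
  have "exec [LoadConst 16 3, Div 29 30 16, Sub 29 0 29, LoadConst 16 4, Mul 16 16 4, Add 16 16 2,
       Mul 16 16 28, Sub 29 29 16] ?m2 = Some ?m3"
    using c by simp
  ultimately have "exec ([LoadConst 19 0, LoadConst 20 0, LoadConst 21 1, LoadConst 22 0, LoadConst 23 1,
       LoadConst 24 0, LoadConst 25 0, Arctan 30 1, Add 30 30 30, Add 30 30 30] @
      [Add 28 4 1, LoadConst 16 1000, Mul 28 28 16, Div 28 1 28, LoadConst 0 0, Sub 26 0 28, Sub 26 26 28] @
      [LoadConst 16 3, Div 29 30 16, Sub 29 0 29, LoadConst 16 4, Mul 16 16 4, Add 16 16 2,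
       Mul 16 16 28, Sub 29 29 16]) m = Some ?m3"
    unfolding exec_append by (simp only: option.case)
  moreover have "walk_inv 0 ?m3"
  proof -
    have "graph_ok ?m3" using assms(1) by simp
    moreover have "placed 0 ?m3" using assms(2) lt_B by (simp add: placed_def zero_from_def)
    moreover have "?m3 18 = real (xs ! 0)" "0 < length xs"
      using assms(3) hd_start sp by (auto simp: spine_def hd_conv_nth)
    ultimately show ?thesis unfolding walk_inv_def by (simp add: spine_pos_def dir_def algebra_simps)
  qed
  ultimately show ?thesis by (intro exI[of _ ?m3]) (simp only: spine_init_def append_Cons append_Nil simp_thms)
qed

section \<open>Effect of the code blocks of the walk\<close>

lemma cell_scaled [simp]: "real (cell a 0) + 8 * real x = real (cell a (8 * x))"
  "real (cell a 0) + 2 * real x = real (cell a (2 * x))" "real (cell a 0) + (real x + real x) = real (cell a (2 * x))"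
  by (simp_all add: cell_def)

lemma exec_walk_position:
  assumes "const_regs m" "m 18 = real x" "m 24 = X" "m 25 = Y" "m 26 = d" "m 28 = e"
  shows "exec walk_position m =
    Some (m(16 := cos d * 2, 24 := X + cos d * 2, 16 := sin d * 2, 25 := Y + sin d * 2,
      27 := d - e, 16 := real (cell 8 (2 * x)), cell 8 (2 * x) := X + cos d * 2,
      16 := real (cell 8 (Suc (2 * x))), cell 8 (Suc (2 * x)) := Y + sin d * 2))"
  using assms unfolding walk_position_def const_regs_def by simp

lemma exec_walk_pointer:
  assumes "const_regs m" "m 18 = real x" "m (cell 4 x) = real C" "m 20 = b"
  shows "exec walk_pointer m =
    Some (m(12 := real (cell 7 (8 * x)), 16 := real (cell 4 x), 17 := real C,
      13 := real (cell 7 (8 * x + C)), 16 := real (cell 6 x), cell 6 x := real (cell 7 (8 * x + C)), 21 := real C - b))"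
  using assms unfolding walk_pointer_def const_regs_def by simp

lemma exec_walk_turn:
  assumes "const_regs m" "m 12 = real (cell 7 y)" "m 30 = p" "m 26 = d" "m 27 = q" "m 28 = e"
  shows "exec walk_turn m =
    Some (m(14 := p + d, cell 7 y := p + d, 12 := real (cell 7 (Suc y)), 26 := q - e - e))"
  using assms unfolding walk_turn_def const_regs_def by simp

lemma exec_walk_lower:
  assumes "const_regs m" "m 12 = real (cell 7 y)" "m 29 = l" "m 28 = e"
  shows "exec walk_lower m =
    Some (m(12 := real (cell 7 (Suc y)), cell 7 (Suc y) := l, 29 := l + e, 12 := real (cell 7 (Suc (Suc y)))))"
  using assms unfolding walk_lower_def const_regs_def by simp

lemma exec_walk_upper:
  assumes "const_regs m" "m 12 = real (cell 7 y)" "m 30 = p" "m 27 = q" "m 28 = e" "m 22 = b"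
  shows "exec walk_upper m =
    Some (m(16 := p / 3, 17 := p / 3 + p / 3 + q, 14 := p / 3 + p / 3 + q - (p / 3 + e) * b,
      cell 7 y := p / 3 + p / 3 + q - (p / 3 + e) * b, 12 := real (cell 7 (Suc y)),
      14 := p / 3 + q - e, cell 7 (Suc y) := p / 3 + q - e))"
  using assms unfolding walk_upper_def const_regs_def by simp

lemma exec_walk_degree:
  assumes "const_regs m" "m 18 = real x" "m (cell 3 x) = D"
  shows "exec walk_degree m = Some (m(16 := real (cell 3 x), 17 := D, 16 := 5))"
  using assms unfolding walk_degree_def const_regs_def by simp

lemma exec_walk_next:
  assumes "const_regs m" "m 18 = real x" "m (cell 5 x) = S" "m 19 = p"
  shows "exec walk_next m =
    Some (m(16 := real (cell 5 x), 17 := S - p, 0 := 0, 19 := real x, 18 := S - p, 20 := 1))"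
  using assms unfolding walk_next_def const_regs_def by simp

lemma exec_walk_narrow:
  assumes "m 1 = 1" "m 16 = 5" "m 17 = real D" "m 22 = of_bool b" "m 23 = o1"
  shows "ends walk_narrow m 20
     (\<lambda>m'. (\<forall>x. x \<notin> {16, 22, 23} \<longrightarrow> m' x = m x) \<and> m' 22 = of_bool (D \<ge> 5 \<or> D \<ge> 4 \<and> b) \<and>
        m' 23 = (if D \<le> 5 \<and> (D \<ge> 5 \<longrightarrow> \<not> b) then o1 else 0))"
    (is "ends _ m 20 ?Q")
unfolding walk_narrow_def
proof (rule ends_IfLe[where T = 18])
  assume "m 16 \<le> m 17"
  then have D: "5 \<le> D" using assms by simp
  let ?R = "\<lambda>m'. (\<forall>x. x \<notin> {16, 22, 23} \<longrightarrow> m' x = m x) \<and> m' 23 = (if b then 0 else o1)"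
  show "ends (IfLe 1 22 (Block [LoadConst 23 0]) (Block []) ;;
          Block [LoadConst 22 1, LoadConst 16 6] ;;
          IfLe 16 17 (Block [LoadConst 23 0]) (Block [])) m 18 ?Q"
  proof (rule ends_Seq[where T = 3 and T' = 10])
    have rest: "ends (Block [LoadConst 22 1, LoadConst 16 6] ;; IfLe 16 17 (Block [LoadConst 23 0]) (Block [])) m' 10 ?Q"
      if R: "?R m'" for m'
    proof (rule ends_Seq[where T = 2 and T' = 4], rule ends_Block)
      let ?m = "m'(22 := 1, 16 := 6)"
      show "exec [LoadConst 22 1, LoadConst 16 6] m' = Some ?m" by simp
      have R': "\<And>x. x \<notin> {16, 22, 23} \<Longrightarrow> m' x = m x" "m' 23 = (if b then 0 else o1)" using R by auto
      have 17: "m' 17 = real D" using R'(1)[of 17] assms(3) by simp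
      show "ends (IfLe 16 17 (Block [LoadConst 23 0]) (Block [])) ?m 4 ?Q"
      proof (rule ends_IfLe[where T = 1])
        assume "?m 16 \<le> ?m 17"
        then have "6 \<le> D" using 17 by simp
        then have "?Q (?m(23 := 0))" using R' by simp
        then show "ends (Block [LoadConst 23 0]) ?m 1 ?Q" by - (rule ends_Block, simp, simp, simp)
      next
        assume "?m 17 < ?m 16"
        then have "D = 5" using 17 D by simp
        then have "?Q ?m" using R' by simp
        then show "ends (Block []) ?m 1 ?Q" by - (rule ends_Block, simp, simp, simp)
      qed simp
    qed simp_all
    show "ends (IfLe 1 22 (Block [LoadConst 23 0]) (Block [])) m 3
      (\<lambda>m. ends (Block [LoadConst 22 1, LoadConst 16 6] ;; IfLe 16 17 (Block [LoadConst 23 0]) (Block [])) m 10 ?Q)"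
    proof (rule ends_IfLe[where T = 1])
      assume "m 1 \<le> m 22"
      then have b using assms by (cases b) auto
      then show "ends (Block [LoadConst 23 0]) m 1
        (\<lambda>m. ends (Block [LoadConst 22 1, LoadConst 16 6] ;; IfLe 16 17 (Block [LoadConst 23 0]) (Block [])) m 10 ?Q)"
        by - (rule ends_Block, simp, simp, rule rest, simp)
    next
      assume "m 22 < m 1"
      then have "\<not> b" using assms by (cases b) auto
      then show "ends (Block []) m 1
        (\<lambda>m. ends (Block [LoadConst 22 1, LoadConst 16 6] ;; IfLe 16 17 (Block [LoadConst 23 0]) (Block [])) m 10 ?Q)"
        using assms(5) by - (rule ends_Block, simp, simp, rule rest, simp)
    qed simp
  qed simp
next
  assume "m 17 < m 16"
  then have D: "D < 5" using assms by simp
  show "ends (Block [LoadConst 16 4] ;; IfLe 16 17 (Block []) (Block [LoadConst 22 0])) m 18 ?Q"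
  proof (rule ends_Seq[where T = 1 and T' = 4], rule ends_Block)
    let ?m = "m(16 := 4)"
    show "exec [LoadConst 16 4] m = Some ?m" by simp
    show "ends (IfLe 16 17 (Block []) (Block [LoadConst 22 0])) ?m 4 ?Q"
    proof (rule ends_IfLe[where T = 1])
      assume "?m 16 \<le> ?m 17"
      then have "4 \<le> D" using assms(3) by simp
      then have "?Q ?m" using assms D by simp
      then show "ends (Block []) ?m 1 ?Q" by - (rule ends_Block, simp, simp, simp)
    next
      assume "?m 17 < ?m 16"
      then have "D < 4" using assms(3) by simp
      then have "?Q (?m(22 := 0))" using assms D by simp
      then show "ends (Block [LoadConst 22 0]) ?m 1 ?Q" by - (rule ends_Block, simp, simp, simp)
    qed simp
  qed simp_all
qed simp

text \<open>At the first vertex the missing predecessor counts as 0, and the sum is already the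
  successor.\<close>

lemma walk_next_sum:
  assumes i: "Suc i < length xs"
  shows "(\<Sum>w\<in>spine_nbrs E (xs ! i). real w) - (if i = 0 then 0 else real (xs ! (i - 1))) = real (xs ! Suc i)"
proof (cases i)
  case 0
  then show ?thesis using spine_nbrs_nth[OF sp Suc_lessD[OF i]] i by simp
next
  case (Suc j)
  have "xs ! j \<noteq> xs ! Suc i" using xs_inj[of j "Suc i"] i Suc by simp
  then show ?thesis using spine_nbrs_nth[OF sp Suc_lessD[OF i]] i Suc by simp
qed

lemma walk_step:
  assumes i: "i < length xs" and inv: "walk_inv i m"
  shows "ends walk_body m 80 (walk_inv (Suc i))" (is "ends _ _ _ ?Q")
proof -
  let ?B1 = "walk_position @ walk_pointer @ walk_turn" and ?B2 = "walk_lower @ walk_upper @ walk_degree"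
  let ?I1 = "IfLe 1 21 (Block [StoreInd 12 14]) (Block [StoreInd 12 26])"
  define x where "x = xs ! i"
  define C where "C = card (spine_nbrs E x)"
  define d where "d = dir i"
  define b where "b = m 20"
  have x: "x < n" unfolding x_def by (rule xs_lt[OF i])
  note xB = lt_B(1-4)[OF x]
  have g: "graph_ok m" and pl: "placed i m" and r: "m 18 = real x" "m 22 = of_bool (narrow E xs i)"
    "m 23 = of_bool (\<forall>j<i. vertex_ok j)" "m 24 = 2 * Re (spine_pos i)" "m 25 = 2 * Im (spine_pos i)"
    "m 26 = d" "m 28 = \<eta>" "m 29 = angle (Suc i) Lower" "m 30 = pi"
    "m 19 = (if i = 0 then 0 else real (xs ! (i - 1)))" "b = (if i = 0 then 0 else 1)" "m 20 = b"
    using inv i unfolding walk_inv_def x_def d_def b_def by auto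
  have gD: "const_regs m' \<and> m' (cell 3 x) = real (degree E x) \<and> m' (cell 4 x) = real C \<and>
      m' (cell 5 x) = (\<Sum>w\<in>spine_nbrs E x. real w)" if "graph_ok m'" for m'
    using that x unfolding graph_ok_def C_def by (auto dest: arrD)
  have C8: "8 * x + C < B" "C \<le> 2"
  proof -
    show "C \<le> 2" using card_spine_nbrs[OF sp i] by (simp add: C_def x_def)
    then show "8 * x + C < B" using xB by linarith
  qed
  have rem: "real C - b = of_bool (Suc i < length xs)"
    using card_spine_nbrs[OF sp i] r(11) by (auto simp: C_def x_def)
  define X where "X = 2 * Re (spine_pos i) + cos d * 2"
  define Y where "Y = 2 * Im (spine_pos i) + sin d * 2"
  have XY: "X = 2 * Re (spine_pos (Suc i))" "Y = 2 * Im (spine_pos (Suc i))"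
    by (simp_all add: X_def Y_def spine_pos_Suc d_def)
  \<comment> \<open>Cells untouched throughout this round. The rows of distinct vertices are
    disjoint, so the results for earlier vertices lie in such cells.\<close>
  define keep where "keep z \<longleftrightarrow> z \<notin> {0, 12, 13, 14, 16, 17, 18, 19, 20, 21, 22, 23, 24, 25, 26, 27, 29,
    cell 8 (2 * x), cell 8 (Suc (2 * x)), cell 6 x, cell 7 (8 * x), cell 7 (Suc (8 * x)), cell 7 (Suc (Suc (8 * x))),
    cell 7 (Suc (Suc (Suc (8 * x)))), cell 7 (Suc (Suc (Suc (Suc (8 * x)))))}" for z
  define m1 where "m1 = m(16 := cos d * 2, 24 := X, 16 := sin d * 2, 25 := Y,
      27 := d - \<eta>, 16 := real (cell 8 (2 * x)), cell 8 (2 * x) := X,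
      16 := real (cell 8 (Suc (2 * x))), cell 8 (Suc (2 * x)) := Y)"
  have e1: "exec walk_position m = Some m1"
    unfolding m1_def X_def Y_def using gD[OF g] r by (intro exec_walk_position) auto
  have g1: "graph_ok m1" using g xB by (simp add: m1_def)
  have r1: "m1 18 = real x" "m1 20 = b" "m1 30 = pi" "m1 26 = d" "m1 27 = d - \<eta>" "m1 28 = \<eta>"
    "m1 29 = angle (Suc i) Lower" "m1 22 = m 22" "m1 23 = m 23" "m1 19 = m 19" "m1 24 = X" "m1 25 = Y"
    "m1 (cell 8 (2 * x)) = X" "m1 (cell 8 (Suc (2 * x))) = Y"
    unfolding m1_def using r xB by simp_all
  have k1: "m1 z = m z" if "keep z" for z using that unfolding m1_def keep_def by simp
  define m2 where "m2 = m1(12 := real (cell 7 (8 * x)), 16 := real (cell 4 x), 17 := real C,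
      13 := real (cell 7 (8 * x + C)), 16 := real (cell 6 x), cell 6 x := real (cell 7 (8 * x + C)), 21 := real C - b)"
  have e2: "exec walk_pointer m1 = Some m2"
    unfolding m2_def using gD[OF g1] r1 by (intro exec_walk_pointer) auto
  have g2: "graph_ok m2" using g1 xB by (simp add: m2_def)
  have r2: "m2 18 = real x" "m2 30 = pi" "m2 26 = d" "m2 27 = d - \<eta>" "m2 28 = \<eta>" "m2 12 = real (cell 7 (8 * x))"
    "m2 29 = angle (Suc i) Lower" "m2 22 = m 22" "m2 23 = m 23" "m2 19 = m 19" "m2 24 = X" "m2 25 = Y"
    "m2 (cell 8 (2 * x)) = X" "m2 (cell 8 (Suc (2 * x))) = Y" "m2 21 = of_bool (Suc i < length xs)"
    "m2 (cell 6 x) = real (cell 7 (8 * x + C))"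
    unfolding m2_def using r1 xB rem by simp_all
  have k2: "m2 z = m z" if "keep z" for z using k1[OF that] that unfolding m2_def keep_def by simp
  define m3 where "m3 = m2(14 := pi + d, cell 7 (8 * x) := pi + d, 12 := real (cell 7 (Suc (8 * x))), 26 := d - \<eta> - \<eta> - \<eta>)"
  have e3: "exec walk_turn m2 = Some m3"
    unfolding m3_def using gD[OF g2] r2 by (intro exec_walk_turn) auto
  have g3: "graph_ok m3" using g2 xB by (simp add: m3_def)
  have r3: "m3 18 = real x" "m3 30 = pi" "m3 26 = dir (Suc i)" "m3 27 = d - \<eta>" "m3 28 = \<eta>" "m3 12 = real (cell 7 (Suc (8 * x)))"
    "m3 29 = angle (Suc i) Lower" "m3 22 = m 22" "m3 23 = m 23" "m3 19 = m 19" "m3 24 = X" "m3 25 = Y"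
    "m3 (cell 8 (2 * x)) = X" "m3 (cell 8 (Suc (2 * x))) = Y" "m3 21 = of_bool (Suc i < length xs)"
    "m3 (cell 6 x) = real (cell 7 (8 * x + C))" "m3 (cell 7 (8 * x)) = pi + d" "m3 14 = pi + d"
    unfolding m3_def using r2 xB by (simp_all add: d_def dir_def algebra_simps)
  have k3: "m3 z = m z" if "keep z" for z using k2[OF that] that unfolding m3_def keep_def by simp
  have B1: "exec ?B1 m = Some m3"
    by (rule exec_append_Some[OF e1 exec_append_Some[OF e2 e3]])
  define m4 where "m4 = m3(cell 7 (Suc (8 * x)) := slot_angle i 1)"
  have g4: "graph_ok m4" using g3 xB by (simp add: m4_def)
  have r4: "m4 18 = real x" "m4 30 = pi" "m4 26 = dir (Suc i)" "m4 27 = d - \<eta>" "m4 28 = \<eta>" "m4 12 = real (cell 7 (Suc (8 * x)))"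
    "m4 29 = angle (Suc i) Lower" "m4 22 = m 22" "m4 23 = m 23" "m4 19 = m 19" "m4 24 = X" "m4 25 = Y"
    "m4 (cell 8 (2 * x)) = X" "m4 (cell 8 (Suc (2 * x))) = Y" "m4 21 = of_bool (Suc i < length xs)"
    "m4 (cell 6 x) = real (cell 7 (8 * x + C))" "m4 (cell 7 (8 * x)) = pi + d" "m4 (cell 7 (Suc (8 * x))) = slot_angle i 1"
    unfolding m4_def using r3 xB by simp_all
  have k4: "m4 z = m z" if "keep z" for z using k3[OF that] that unfolding m4_def keep_def by simp
  have I1: "ends ?I1 m3 3 R" if R: "R m4" for R
  proof (rule ends_IfLe[where T = 1])
    have one: "m3 1 = 1" using gD[OF g3] by (simp add: const_regs_def)
    show "ends (Block [StoreInd 12 14]) m3 1 R" if "m3 1 \<le> m3 21"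
    proof -
      have "Suc i < length xs" using that one r3(15) by (cases "Suc i < length xs") simp_all
      then have "slot_angle i 1 = pi + d" by (simp add: slot_angle_def d_def)
      then have "exec [StoreInd 12 14] m3 = Some m4" using r3(6,18) by (simp add: m4_def)
      then show ?thesis by - (rule ends_Block, assumption, simp, rule R)
    qed
    show "ends (Block [StoreInd 12 26]) m3 1 R" if "m3 21 < m3 1"
    proof -
      have "\<not> Suc i < length xs" using that one r3(15) by (cases "Suc i < length xs") simp_all
      then have "slot_angle i 1 = dir (Suc i)" by (simp add: slot_angle_def)
      then have "exec [StoreInd 12 26] m3 = Some m4" using r3(3,6) by (simp add: m4_def)
      then show ?thesis by - (rule ends_Block, assumption, simp, rule R)
    qed
  qed simp
  define y where "y = Suc (Suc (Suc (8 * x)))"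
  define L where "L = angle (Suc i) Lower"
  define m5 where "m5 = m4(12 := real (cell 7 (Suc (Suc (8 * x)))), cell 7 (Suc (Suc (8 * x))) := L, 29 := L + \<eta>,
      12 := real (cell 7 (Suc (Suc (Suc (8 * x))))))"
  have e5: "exec walk_lower m4 = Some m5"
    unfolding m5_def using gD[OF g4] r4 by (intro exec_walk_lower) (auto simp: L_def)
  have g5: "graph_ok m5" using g4 xB by (simp add: m5_def)
  have r5: "m5 18 = real x" "m5 30 = pi" "m5 26 = dir (Suc i)" "m5 27 = d - \<eta>" "m5 28 = \<eta>"
    "m5 12 = real (cell 7 (Suc (Suc (Suc (8 * x)))))"
    "m5 29 = L + \<eta>" "m5 22 = of_bool (narrow E xs i)" "m5 23 = m 23" "m5 19 = m 19" "m5 24 = X" "m5 25 = Y"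
    "m5 (cell 8 (2 * x)) = X" "m5 (cell 8 (Suc (2 * x))) = Y" "m5 21 = of_bool (Suc i < length xs)"
    "m5 (cell 6 x) = real (cell 7 (8 * x + C))" "m5 (cell 7 (8 * x)) = pi + d" "m5 (cell 7 (Suc (8 * x))) = slot_angle i 1"
    "m5 (cell 7 (Suc (Suc (8 * x)))) = L"
    unfolding m5_def using r4 r(2) xB by simp_all
  have k5: "m5 z = m z" if "keep z" for z using k4[OF that] that unfolding m5_def keep_def by simp
  define u where "u = pi / 3 + pi / 3 + (d - \<eta>) - (pi / 3 + \<eta>) * of_bool (narrow E xs i)"
  define v where "v = pi / 3 + (d - \<eta>) - \<eta>"
  have u: "u = slot_angle i 3" and v: "v = slot_angle i 4"
    by (simp_all add: u_def v_def slot_angle_def d_def dir_def algebra_simps)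
  define m6 where "m6 = m5(16 := pi / 3, 17 := pi / 3 + pi / 3 + (d - \<eta>), 14 := u,
      cell 7 (Suc (Suc (Suc (8 * x)))) := u, 12 := real (cell 7 (Suc (Suc (Suc (Suc (8 * x)))))),
      14 := v, cell 7 (Suc (Suc (Suc (Suc (8 * x))))) := v)"
  have e6: "exec walk_upper m5 = Some m6"
    unfolding m6_def u_def v_def using gD[OF g5] r5 by (intro exec_walk_upper) auto
  have g6: "graph_ok m6" using g5 xB by (simp add: m6_def)
  have r6: "m6 18 = real x" "m6 30 = pi" "m6 26 = dir (Suc i)" "m6 28 = \<eta>"
    "m6 29 = L + \<eta>" "m6 22 = of_bool (narrow E xs i)" "m6 23 = m 23" "m6 19 = m 19" "m6 24 = X" "m6 25 = Y"
    "m6 (cell 8 (2 * x)) = X" "m6 (cell 8 (Suc (2 * x))) = Y" "m6 21 = of_bool (Suc i < length xs)"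
    "m6 (cell 6 x) = real (cell 7 (8 * x + C))" "m6 (cell 7 (8 * x)) = pi + d" "m6 (cell 7 (Suc (8 * x))) = slot_angle i 1"
    "m6 (cell 7 (Suc (Suc (8 * x)))) = L" "m6 (cell 7 (Suc (Suc (Suc (8 * x))))) = u"
    "m6 (cell 7 (Suc (Suc (Suc (Suc (8 * x)))))) = v"
    unfolding m6_def using r5 xB by simp_all
  have k6: "m6 z = m z" if "keep z" for z using k5[OF that] that unfolding m6_def keep_def by simp
  define m7 where "m7 = m6(16 := real (cell 3 x), 17 := real (degree E x), 16 := 5)"
  have e7: "exec walk_degree m6 = Some m7"
    unfolding m7_def using gD[OF g6] r6 by (intro exec_walk_degree) auto
  have B2: "exec ?B2 m4 = Some m7"
    by (rule exec_append_Some[OF e5 exec_append_Some[OF e6 e7]])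
  have last: "ends (Block walk_next) m8 7 ?Q"
    if R: "(\<forall>z. z \<notin> {16, 22, 23} \<longrightarrow> m8 z = m7 z) \<and> m8 22 = of_bool (degree E x \<ge> 5 \<or> degree E x \<ge> 4 \<and> narrow E xs i) \<and>
        m8 23 = (if degree E x \<le> 5 \<and> (degree E x \<ge> 5 \<longrightarrow> \<not> narrow E xs i) then m 23 else 0)" for m8
  proof -
    have R1: "m8 z = m7 z" if "z \<noteq> 16" "z \<noteq> 22" "z \<noteq> 23" for z using R that by blast
    have m8: "m8 = m7(16 := m8 16, 22 := m8 22, 23 := m8 23)" by (rule ext) (simp add: R1)
    have g8: "graph_ok m8" by (subst m8) (use g6 in \<open>simp add: m7_def\<close>)
    have t: "m8 z = m6 z" if "z \<notin> {16, 17, 22, 23}" for z using R1[of z] that by (simp add: m7_def)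
    have c8: "m8 (cell a j) = m6 (cell a j)" if "0 < a" for a j using that by (intro t) simp
    have k8: "m8 z = m z" if "keep z" for z
      using t[of z] k6[OF that] that by (simp add: keep_def)
    define S where "S = (\<Sum>w\<in>spine_nbrs E x. real w)"
    define m9 where "m9 = m8(16 := real (cell 5 x), 17 := S - m 19, 0 := 0, 19 := real x, 18 := S - m 19, 20 := 1)"
    have B3: "exec walk_next m8 = Some m9"
      unfolding m9_def using gD[OF g8] t[of 18] t[of 19] r6 by (intro exec_walk_next) (auto simp: S_def)
    have g9: "graph_ok m9" using g8 by (simp add: m9_def)
    have c9: "m9 (cell a j) = m6 (cell a j)" if "0 < a" for a j using that c8[OF that] by (simp add: m9_def)
    have k9: "m9 (cell a j) = m (cell a j)" if "0 < a" "keep (cell a j)" for a j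
      using k8[OF that(2)] that(1) by (simp add: m9_def)
    have "placed (Suc i) m9"
      unfolding placed_def
    proof (intro conjI allI impI)
      fix j assume j: "j < Suc i"
      have old: "j < i \<Longrightarrow> xs ! j < n \<and> xs ! j \<noteq> x" using i xs_lt[of j] xs_inj[of j i] by (simp add: x_def)
      have "j < i \<or> j = i" using j by auto
      then show "m9 (cell 6 (xs ! j)) = ptr j"
      proof
        assume j: "j < i"
        then have "keep (cell 6 (xs ! j))" using old[OF j] xB lt_B unfolding keep_def by simp
        then show ?thesis using pl j k9 by (simp add: placed_def)
      next
        assume "j = i"
        then show ?thesis using c9 r6 by (simp add: ptr_def x_def C_def)
      qed
      show "m9 (cell 8 (2 * (xs ! j))) = 2 * Re (spine_pos (Suc j))"
        "m9 (cell 8 (Suc (2 * (xs ! j)))) = 2 * Im (spine_pos (Suc j))"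
      proof -
        have "m9 (cell 8 (2 * (xs ! j))) = 2 * Re (spine_pos (Suc j)) \<and>
          m9 (cell 8 (Suc (2 * (xs ! j)))) = 2 * Im (spine_pos (Suc j))"
          using \<open>j < i \<or> j = i\<close>
        proof
          assume j: "j < i"
          then have "keep (cell 8 (2 * (xs ! j)))" "keep (cell 8 (Suc (2 * (xs ! j))))"
            using old[OF j] xB lt_B unfolding keep_def by simp_all
          then show ?thesis using pl j k9 by (simp add: placed_def)
        next
          assume "j = i"
          then show ?thesis using c9 r6 XY by (simp add: x_def)
        qed
        then show "m9 (cell 8 (2 * (xs ! j))) = 2 * Re (spine_pos (Suc j))"
          "m9 (cell 8 (Suc (2 * (xs ! j)))) = 2 * Im (spine_pos (Suc j))" by auto
      qed
      fix s :: nat assume s: "s < 5"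
      show "m9 (cell 7 (8 * (xs ! j) + s)) = slot_angle j s"
        using \<open>j < i \<or> j = i\<close>
      proof
        assume j: "j < i"
        have w: "xs ! j < n" "xs ! j \<noteq> x" using old[OF j] by auto
        then have "8 * (xs ! j) + s < B" using lt_B(4)[OF w(1)] s by linarith
        moreover have "8 * (xs ! j) + s \<noteq> 8 * x" "8 * (xs ! j) + s \<noteq> Suc (8 * x)" "8 * (xs ! j) + s \<noteq> Suc (Suc (8 * x))"
          "8 * (xs ! j) + s \<noteq> Suc (Suc (Suc (8 * x)))" "8 * (xs ! j) + s \<noteq> Suc (Suc (Suc (Suc (8 * x))))"
          using w(2) s by presburger+
        ultimately have "keep (cell 7 (8 * (xs ! j) + s))" using xB unfolding keep_def by simp
        then show ?thesis using pl j s k9 by (simp add: placed_def)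
      next
        assume ji: "j = i"
        have "s = 0 \<or> s = 1 \<or> s = 2 \<or> s = 3 \<or> s = 4" using s by auto
        moreover have "slot_angle i 0 = pi + d" "slot_angle i 2 = L" by (simp_all add: slot_angle_def d_def L_def)
        ultimately show ?thesis unfolding ji x_def[symmetric] using c9 r6 u v
          by (elim disjE) (simp_all add: eval_nat_numeral)
      qed
    next
      fix w assume w: "w < n" "w \<notin> set (take (Suc i) xs)"
      then have "w \<noteq> x" "w \<notin> set (take i xs)" using i by (auto simp: take_Suc_conv_app_nth x_def)
      then have "keep (cell 6 w)" using w(1) xB lt_B unfolding keep_def by simp
      then show "m9 (cell 6 w) = 0" using pl k9 w(1) \<open>w \<notin> set (take i xs)\<close> by (simp add: placed_def)
    qed
    moreover have "m9 19 = real x" "m9 20 = 1" "m9 18 = S - m 19" "m9 21 = of_bool (Suc i < length xs)" "m9 24 = X" "m9 25 = Y"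
      "m9 26 = dir (Suc i)" "m9 28 = \<eta>" "m9 29 = L + \<eta>" "m9 30 = pi" "m9 22 = m8 22" "m9 23 = m8 23"
      unfolding m9_def using t r6 by simp_all
    moreover have "Suc i < length xs \<longrightarrow> S - m 19 = real (xs ! Suc i)"
      using walk_next_sum[of i] r(10) by (simp add: S_def x_def)
    moreover have "m8 22 = of_bool (narrow E xs (Suc i))" using R by (simp add: x_def)
    moreover have "m8 23 = of_bool (\<forall>j<Suc i. vertex_ok j)"
      using R r(3) by (auto simp: less_Suc_eq vertex_ok_def x_def)
    moreover have "L + \<eta> = angle (Suc (Suc i)) Lower" by (simp add: L_def algebra_simps)
    ultimately have "walk_inv (Suc i) m9" using g9 XY unfolding walk_inv_def by (simp add: x_def)
    then show ?thesis by - (rule ends_Block, rule B3, simp_all add: walk_next_def)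
  qed
  have I2: "ends (walk_narrow ;; Block walk_next) m7 28 ?Q"
  proof (rule ends_Seq[where T = 20 and T' = 7])
    have "m7 1 = 1" using gD[OF g6] by (simp add: m7_def const_regs_def)
    then have "ends walk_narrow m7 20 (\<lambda>m'. (\<forall>z. z \<notin> {16, 22, 23} \<longrightarrow> m' z = m7 z) \<and>
        m' 22 = of_bool (degree E x \<ge> 5 \<or> degree E x \<ge> 4 \<and> narrow E xs i) \<and>
        m' 23 = (if degree E x \<le> 5 \<and> (degree E x \<ge> 5 \<longrightarrow> \<not> narrow E xs i) then m 23 else 0))"
      using r6 by (intro exec_walk_narrow) (simp_all add: m7_def)
    then show "ends walk_narrow m7 20 (\<lambda>m. ends (Block walk_next) m 7 ?Q)"
      by (rule ends_mono[OF _ order_refl]) (rule last)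
  qed simp
  have tail: "ends (Block ?B2 ;; walk_narrow ;; Block walk_next) m4 48 ?Q"
    by (rule ends_Seq[where T = 19 and T' = 28], rule ends_Block, rule B2,
        simp add: walk_lower_def walk_upper_def walk_degree_def, rule I2, simp)
  have tail1: "ends (?I1 ;; Block ?B2 ;; walk_narrow ;; Block walk_next) m3 52 ?Q"
    by (rule ends_Seq[where T = 3 and T' = 48], rule I1, rule tail, simp)
  show ?thesis unfolding walk_body_def
    by (rule ends_Seq[where T = 26 and T' = 52], rule ends_Block, rule B1,
        simp add: walk_position_def walk_pointer_def walk_turn_def, rule tail1, simp)
qed

lemma place_spine:
  assumes "graph_ok m" "zero_from 6 m" "m 18 = real (start n E)"
  shows "ends place_spine m (82 * n + 30) (\<lambda>m. graph_ok m \<and> placed (length xs) m \<and> m 23 = of_bool (feasible E xs))"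
proof -
  obtain m' where m': "exec spine_init m = Some m'" "walk_inv 0 m'"
    using walk_init[OF assms] by blast
  show ?thesis unfolding place_spine_def
  proof (rule ends_Seq[where T = 25 and T' = "82 * n + 2"], rule ends_Block, rule m'(1), simp add: spine_init_def,
      rule ends_WhileLe[where I = walk_inv and N = "length xs" and T = 80, OF _ _ m'(2)], rule conjI)
    fix i m assume "i < length xs" "walk_inv i m"
    then show "m 1 \<le> m 21" by (simp add: walk_inv_def graph_ok_def const_regs_def)
  next
    fix i m assume "i < length xs" "walk_inv i m"
    then show "ends walk_body m 80 (walk_inv (Suc i))" by (rule walk_step)
  next
    fix m assume "walk_inv (length xs) m"
    then show "m 21 < m 1 \<and> graph_ok m \<and> placed (length xs) m \<and> m 23 = of_bool (feasible E xs)"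
      by (simp add: walk_inv_def graph_ok_def const_regs_def feasible_def vertex_ok_def)
  qed (use length_xs in simp_all)
qed

end

section \<open>Placing the leaves and writing the output\<close>

context graph_machine
begin

text \<open>Descending order leaves the pointer in cell 0 at \<open>cell 8 0\<close>, the value
  destined for cell 1.\<close>

lemma exec_restore:
  assumes "2 \<le> k" "k \<le> 31" "m 0 = real (cell 8 (k - 2))" "m 1 = 1"
  shows "\<exists>m'. exec (concat (map (\<lambda>j. [LoadInd j 0, Sub 0 0 1]) (rev [2..<k]))) m = Some m' \<and>
    m' 0 = real (cell 8 0) \<and> m' 1 = 1 \<and> (\<forall>j. 2 \<le> j \<longrightarrow> j < k \<longrightarrow> m' j = m (cell 8 (j - 1))) \<and> (\<forall>x\<ge>k. m' x = m x)"
  using assms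
proof (induction k arbitrary: m)
  case (Suc k)
  show ?case
  proof (cases "k = 1")
    case True
    then show ?thesis using Suc.prems by (auto simp: numeral_2_eq_2)
  next
    case False
    then have k: "2 \<le> k" "k \<le> 31" "k < 128" using Suc.prems by auto
    have s: "Suc k - 2 = Suc (k - 2)" using k by simp
    let ?m = "m(k := m (cell 8 (Suc (k - 2))), 0 := real (cell 8 (k - 2)))"
    have "real (cell 8 (Suc (k - 2))) - 1 = real (cell 8 (k - 2))" by (simp add: cell_def)
    then have e: "exec [LoadInd k 0, Sub 0 0 1] m = Some ?m"
      using Suc.prems(3,4) k unfolding s by simp
    have "?m 0 = real (cell 8 (k - 2))" "?m 1 = 1" using Suc.prems(4) k by simp_all
    from Suc.IH[OF k(1,2) this] obtain m' where m': "exec (concat (map (\<lambda>j. [LoadInd j 0, Sub 0 0 1]) (rev [2..<k]))) ?m = Some m'"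
      "m' 0 = real (cell 8 0)" "m' 1 = 1" "\<And>j. 2 \<le> j \<Longrightarrow> j < k \<Longrightarrow> m' j = ?m (cell 8 (j - 1))" "\<And>x. x \<ge> k \<Longrightarrow> m' x = ?m x"
      by blast
    have sp: "concat (map (\<lambda>j. [LoadInd j 0, Sub 0 0 1]) (rev [2..<Suc k])) =
      [LoadInd k 0, Sub 0 0 1] @ concat (map (\<lambda>j. [LoadInd j 0, Sub 0 0 1]) (rev [2..<k]))" using k by simp
    have ck: "?m (cell 8 j) = m (cell 8 j)" for j using k by simp
    have "m' j = m (cell 8 (j - 1))" if "2 \<le> j" "j < Suc k" for j
    proof (cases "j = k")
      case True
      have "Suc (k - 2) = k - 1" using k by simp
      then show ?thesis using m'(5)[of k] True k by simp
    next
      case False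
      then show ?thesis using m'(4)[of j] that ck by simp
    qed
    moreover have "m' x = m x" if "x \<ge> Suc k" for x using m'(5)[of x] that by simp
    moreover have "exec (concat (map (\<lambda>j. [LoadInd j 0, Sub 0 0 1]) (rev [2..<Suc k]))) m = Some m'"
      unfolding sp by (rule exec_append_Some[OF e m'(1)])
    ultimately show ?thesis using m'(2,3) by blast
  qed
qed simp

lemma cell_ge_B: assumes "0 < a" shows "B \<le> cell a i"
  using assms unfolding cell_def by (cases a) auto

lemma write_output:
  assumes c: "const_regs m"
  shows "ends write_output m (20 * n + 100)
    (\<lambda>m'. m' 0 = 1 \<and> (\<forall>j. 1 \<le> j \<longrightarrow> j \<le> 2 * n \<longrightarrow> m' j = m (cell 8 (j - 1))))"
proof -
  define I where "I i m' \<longleftrightarrow> const_regs m' \<and> m' 12 = real (31 + i) \<and> m' 13 = real (2 * n) \<and>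
    (\<forall>t. m' (cell 8 t) = m (cell 8 t)) \<and> (\<forall>j. 31 \<le> j \<longrightarrow> j < 31 + i \<longrightarrow> m' j = m (cell 8 (j - 1)))" for i m'
  let ?m0 = "m(12 := 31, 13 := real n + real n)"
  have ex: "exec [LoadConst 12 31, Add 13 4 4] m = Some ?m0" using c by (simp add: const_regs_def)
  have I0: "I 0 ?m0" using c by (simp add: I_def const_regs_def)
  let ?E = "Block ([LoadConst 16 29, Add 0 11 16] @
       concat (map (\<lambda>j. [LoadInd j 0, Sub 0 0 1]) (rev [2..<31])) @ [LoadInd 1 0, LoadConst 0 1])"
  let ?Q = "\<lambda>m'. m' 0 = 1 \<and> (\<forall>j. 1 \<le> j \<longrightarrow> j \<le> 2 * n \<longrightarrow> m' j = m (cell 8 (j - 1)))"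
  \<comment> \<open>\<open>2 * n - 30\<close> is truncated subtraction: for
    \<open>n \<le> 15\<close> the whole output lies within cells 0 to 30 and the loop makes no
    round.\<close>
  have fin: "ends ?E m1 62 ?Q" if I: "I (2 * n - 30) m1" for m1
  proof -
    have c1: "m1 11 = real (cell 8 0)" "m1 1 = 1" using I by (simp_all add: I_def const_regs_def)
    let ?m2 = "m1(16 := 29, 0 := real (cell 8 29))"
    have e1: "exec [LoadConst 16 29, Add 0 11 16] m1 = Some ?m2" using c1 by simp
    have "?m2 0 = real (cell 8 (31 - 2))" "?m2 1 = 1" using c1 by simp_all
    moreover have "(2::nat) \<le> 31" by simp
    ultimately obtain m3 where m3: "exec (concat (map (\<lambda>j. [LoadInd j 0, Sub 0 0 1]) (rev [2..<31]))) ?m2 = Some m3"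
      "m3 0 = real (cell 8 0)" "m3 1 = 1" "\<And>j. 2 \<le> j \<Longrightarrow> j < 31 \<Longrightarrow> m3 j = ?m2 (cell 8 (j - 1))" "\<And>x. x \<ge> 31 \<Longrightarrow> m3 x = ?m2 x"
      using exec_restore[of 31 ?m2] by blast
    let ?m4 = "m3(1 := m3 (cell 8 0), 0 := 1)"
    have e4: "exec [LoadInd 1 0, LoadConst 0 1] m3 = Some ?m4" using m3(2) by simp
    have ex': "exec ([LoadConst 16 29, Add 0 11 16] @ concat (map (\<lambda>j. [LoadInd j 0, Sub 0 0 1]) (rev [2..<31])) @
        [LoadInd 1 0, LoadConst 0 1]) m1 = Some ?m4"
      by (rule exec_append_Some[OF e1 exec_append_Some[OF m3(1) e4]])
    have res: "?m4 j = m (cell 8 (j - 1))" if j: "1 \<le> j" "j \<le> 2 * n" for j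
    proof -
      have cells: "m3 (cell 8 t) = m (cell 8 t)" for t
      proof -
        have "31 \<le> cell 8 t" using cell_ge[of 8 t] by simp
        then show ?thesis using m3(5)[of "cell 8 t"] I by (simp add: I_def)
      qed
      consider "j = 1" | "2 \<le> j" "j < 31" | "31 \<le> j" using j by linarith
      then show ?thesis
      proof cases
        case 1
        then show ?thesis using cells by simp
      next
        case 2
        then show ?thesis using m3(4)[OF 2] I by (simp add: I_def)
      next
        case 3
        have "j < 31 + (2 * n - 30)" using j 3 by linarith
        then show ?thesis using m3(5)[OF 3] I 3 by (simp add: I_def)
      qed
    qed
    have len: "length ([LoadConst 16 29, Add 0 11 16] @ concat (map (\<lambda>j. [LoadInd j 0, Sub 0 0 1]) (rev [2..<31])) @
        [LoadInd 1 0, LoadConst 0 1]) \<le> 62" by (simp add: length_concat comp_def sum_list_triv)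
    show ?thesis
      by (rule ends_Block, rule ex', rule len, rule conjI, simp, intro allI impI, rule res)
  qed
  show ?thesis unfolding write_output_def
  proof (rule ends_Seq[where T = 2 and T' = "20 * n + 80"], rule ends_Block, rule ex, simp,
      rule ends_Seq[where T = "20 * n + 10" and T' = 62],
      rule ends_WhileLe[where I = I and N = "2 * n - 30" and T = 5, OF _ _ I0])
    fix i m1 assume i: "i < 2 * n - 30" and I: "I i m1"
    have c1: "const_regs m1" "m1 12 = real (31 + i)" "m1 13 = real (2 * n)" using I by (simp_all add: I_def)
    have "m1 12 \<le> m1 13" unfolding c1 of_nat_le_iff using i by linarith
    moreover have lt: "31 + i < B" using i B_ge(2) n by linarith
    let ?a = "m1(16 := real (cell 8 (31 + i)), 16 := real (cell 8 (30 + i)), 17 := m1 (cell 8 (30 + i)),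
      31 + i := m1 (cell 8 (30 + i)), 12 := real (31 + i) + 1)"
    have ne: "cell 8 t \<noteq> 31 + i" "31 + i \<noteq> cell 8 t" for t using cell_ge_B[of 8 t] lt by auto
    have r: "real (cell 8 0) + real (31 + i) = real (cell 8 (31 + i))" "real (cell 8 (31 + i)) - 1 = real (cell 8 (30 + i))"
      by (simp_all add: cell_def)
    have nn: "real (31 + i) \<in> \<nat>" "nat \<lfloor>real (31 + i)\<rfloor> = 31 + i" by (rule of_nat_in_Nats, simp only: floor_of_nat nat_int)
    have x: "exec [Add 16 11 12, Sub 16 16 1, LoadInd 17 16, StoreInd 12 17, Add 12 12 1] m1 = Some ?a"
      using c1 unfolding const_regs_def by (simp add: r nn del: of_nat_add cell_add)
    have "I (Suc i) ?a"
      unfolding I_def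
    proof (intro conjI allI impI)
      have "31 + i \<notin> {1, 2, 3, 4, 5, 6, 7, 8, 9, 10, 11}" by auto
      then show "const_regs ?a"
        by - (rule const_regs_upd[THEN iffD2], simp, rule const_regs_upd[THEN iffD2], assumption, simp add: c1(1))
      show "?a 12 = real (31 + Suc i)" by simp
      show "?a 13 = real (2 * n)" using c1(3) by simp
      show "?a (cell 8 t) = m (cell 8 t)" for t using I ne(1)[of t] by (simp add: I_def)
      fix j assume j: "31 \<le> j" "j < 31 + Suc i"
      show "?a j = m (cell 8 (j - 1))" using I j by (cases "j = 31 + i") (simp_all add: I_def)
    qed
    then have "ends (Block [Add 16 11 12, Sub 16 16 1, LoadInd 17 16, StoreInd 12 17, Add 12 12 1]) m1 5 (I (Suc i))"
      by - (rule ends_Block, rule x, simp)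
    ultimately show "m1 12 \<le> m1 13 \<and> ends (Block [Add 16 11 12, Sub 16 16 1, LoadInd 17 16, StoreInd 12 17, Add 12 12 1]) m1 5 (I (Suc i))"
      by blast
  next
    fix m1 assume I: "I (2 * n - 30) m1"
    have "2 * n < 31 + (2 * n - 30)" by linarith
    then have "m1 13 < m1 12" using I unfolding I_def by (simp only: of_nat_less_iff)
    then show "m1 13 < m1 12 \<and> ends ?E m1 62 ?Q" using fin[OF I] by blast
  qed auto
qed

end

locale feasible_machine = spine_machine +
  assumes feas: "feasible E xs"
begin

section \<open>Parents and ranks of the leaves\<close>

definition par :: "nat \<Rightarrow> nat" where "par v = (SOME j. j < length xs \<and> (xs ! j, v) \<in> E)"

text \<open>Leaves of a common parent are ranked in the order in which the edge list meets them,
  which is the order in which the machine hands out slots.\<close>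

definition leaves_before :: "nat \<Rightarrow> nat \<Rightarrow> nat" where
  "leaves_before k u = length (filter (\<lambda>e. fst e = u \<and> snd e \<notin> set xs) (take k directed))"

definition pos :: "nat \<Rightarrow> nat" where
  "pos v = (THE k. k < length directed \<and> directed ! k = (xs ! par v, v))"

definition rank :: "nat \<Rightarrow> nat" where "rank v = leaves_before (pos v) (xs ! par v)"

lemma par: assumes "v < n" "v \<notin> set xs" shows "par v < length xs \<and> (xs ! par v, v) \<in> E"
proof -
  obtain u where "u \<in> set xs" "(v, u) \<in> E" using sp assms unfolding spine_def by blast
  then have "\<exists>j. j < length xs \<and> (xs ! j, v) \<in> E"
    using spine_edge_lt[OF sp, of v u] by (auto simp: in_set_conv_nth)
  then show ?thesis unfolding par_def by (rule someI_ex)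
qed

lemma pos_eq: assumes "k < length directed" "directed ! k = (xs ! par v, v)" shows "pos v = k"
  unfolding pos_def
proof (rule the_equality)
  fix l assume "l < length directed \<and> directed ! l = (xs ! par v, v)"
  then show "l = k" using nth_eq_iff_index_eq[OF distinct_directed, of l k] assms by simp
qed (use assms in simp)

lemma pos: assumes "v < n" "v \<notin> set xs" shows "pos v < length directed" "directed ! pos v = (xs ! par v, v)"
proof -
  have "(xs ! par v, v) \<in> set directed" using par[OF assms] set_directed_E by simp
  then obtain k where "k < length directed" "directed ! k = (xs ! par v, v)" by (metis in_set_conv_nth)
  then show "pos v < length directed" "directed ! pos v = (xs ! par v, v)" using pos_eq by auto
qed

lemma leaves_before_Suc:
  "k < length directed \<Longrightarrow> leaves_before (Suc k) u =
    leaves_before k u + (if fst (directed ! k) = u \<and> snd (directed ! k) \<notin> set xs then 1 else 0)"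
  by (simp add: leaves_before_def take_Suc_conv_app_nth)

lemma leaves_before_mono: assumes "k \<le> l" shows "leaves_before k u \<le> leaves_before l u"
proof -
  obtain ys where "take l directed = take k directed @ ys" using assms by (metis le_Suc_ex take_add)
  then show ?thesis by (simp add: leaves_before_def)
qed

lemma leaves_before_pos:
  assumes "v < n" "v \<notin> set xs" "pos v < l" shows "leaves_before (pos v) (xs ! par v) < leaves_before l (xs ! par v)"
  using leaves_before_Suc[OF pos(1)[OF assms(1,2)], of "xs ! par v"] pos(2)[OF assms(1,2)] assms(2)
    leaves_before_mono[of "Suc (pos v)" l "xs ! par v"] assms(3) by simp

text \<open>Every neighbour of a spine vertex is a spine neighbour or a leaf. Hence the slot numbers
  handed out stay below the degree.\<close>

lemma leaves_total:
  assumes "u \<in> set xs" shows "card (spine_nbrs E u) + leaves_before (length directed) u = degree E u"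
proof -
  have fin: "finite {w. (u, w) \<in> E}" by (rule finite_nbrs[OF sp])
  have "leaves_before (length directed) u = card {w. (u, w) \<in> E \<and> w \<notin> set xs}"
    using filter_directed_nbrs(1)[of u "\<lambda>w. w \<notin> set xs"] by (simp add: leaves_before_def)
  moreover have "{w. (u, w) \<in> E} = spine_nbrs E u \<union> {w. (u, w) \<in> E \<and> w \<notin> set xs}"
    "spine_nbrs E u \<inter> {w. (u, w) \<in> E \<and> w \<notin> set xs} = {}"
    using sp assms unfolding spine_def spine_nbrs_def by blast+
  moreover have "finite (spine_nbrs E u)" "finite {w. (u, w) \<in> E \<and> w \<notin> set xs}"
    by (rule finite_subset[OF _ fin]; auto simp: spine_nbrs_def)+
  ultimately show ?thesis unfolding degree_def by (simp add: card_Un_disjoint)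
qed

lemma rank_lt:
  assumes "v < n" "v \<notin> set xs"
  shows "card (spine_nbrs E (xs ! par v)) + rank v < degree E (xs ! par v)"
proof -
  have "xs ! par v \<in> set xs" using par[OF assms] by simp
  then show ?thesis
    using leaves_total[of "xs ! par v"] leaves_before_pos[OF assms pos(1)[OF assms]] unfolding rank_def by linarith
qed

lemma rank_less:
  assumes "v < n" "v \<notin> set xs" "par v = par v'" "pos v < pos v'" shows "rank v < rank v'"
  using leaves_before_pos[OF assms(1,2,4)] unfolding rank_def assms(3) .

lemma rank_inj:
  assumes v: "v < n" "v \<notin> set xs" and v': "v' < n" "v' \<notin> set xs" and e: "par v = par v'" "rank v = rank v'"
  shows "v = v'"
proof -
  have "\<not> pos v < pos v'" "\<not> pos v' < pos v"
    using rank_less[OF v e(1)] rank_less[OF v' e(1)[symmetric]] e(2) by auto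
  then have "pos v = pos v'" by simp
  then have "(xs ! par v, v) = (xs ! par v', v')" using pos(2)[OF v] pos(2)[OF v'] by metis
  then show ?thesis by simp
qed

sublocale drawn n E xs rank par \<eta> n
  by unfold_locales (fact sp feas par rank_lt length_xs | (rule rank_inj; assumption))+

lemma center_spine: "i < length xs \<Longrightarrow> center (xs ! i) = 2 * spine_pos (Suc i)"
  by (simp add: center_def spot_spine place_pos_def)

text \<open>Connects the place of the abstract drawing with the polar form that the machine
  evaluates. For slots 0 and 1 this amounts to one step back or forth along the arc.\<close>

lemma center_leaf:
  assumes v: "v < n" "v \<notin> set xs"
  shows "center v = 2 * (spine_pos (Suc (par v)) + cis (slot_angle (par v) (slot_no v)))" and "slot_no v < 5"
proof -
  have at_back: "spine_pos (Suc 0) + cis (pi + dir 0) = spine_pos 0"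
    by (simp add: spine_pos_def complex_eq_iff)
  have at_front: "spine_pos (Suc j) + cis (dir (Suc j)) = spine_pos (Suc (Suc j))" for j
    by (simp add: spine_pos_Suc)
  have "place_pos (fst (spot v)) (snd (spot v)) = spine_pos (Suc (par v)) + cis (slot_angle (par v) (slot_no v)) \<and> slot_no v < 5"
    using spot_leaf_cases[OF v]
  proof (elim disjE conjE)
    assume "spot v = (0, Spine)" "par v = 0" "slot_no v = 0"
    then show ?thesis using at_back by (simp add: place_pos_def slot_angle_def)
  next
    assume "spot v = (0, Spine)" "par v = 0" "slot_no v = 1" "length xs > 1"
    then show ?thesis using at_back by (simp add: place_pos_def slot_angle_def)
  next
    assume "spot v = (Suc (length xs), Spine)" "Suc (par v) = length xs" "slot_no v = 1"
    then show ?thesis using at_front[of "par v"] by (simp add: place_pos_def slot_angle_def)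
  qed (simp_all add: place_pos_def slot_angle_def)
  then show "center v = 2 * (spine_pos (Suc (par v)) + cis (slot_angle (par v) (slot_no v)))" "slot_no v < 5"
    by (simp_all add: center_def)
qed

definition leaf_inv :: "nat \<Rightarrow> mem \<Rightarrow> bool" where
  "leaf_inv k m \<longleftrightarrow> const_regs m \<and> has_edges m \<and>
     arr 6 (\<lambda>v. if v \<in> set xs then real (cell 7 (8 * v + (card (spine_nbrs E v) + leaves_before k v))) else 0) m \<and>
     (\<forall>j<length xs. \<forall>s<5. m (cell 7 (8 * (xs ! j) + s)) = slot_angle j s) \<and>
     (\<forall>w<n. w \<in> set xs \<union> snd ` set (take k directed) \<longrightarrow>
        m (cell 8 (2 * w)) = Re (center w) \<and> m (cell 8 (Suc (2 * w))) = Im (center w))"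

lemma leaf_inv_upd: assumes "leaf_inv k m" "r < 31" "r \<notin> {1, 2, 3, 4, 5, 6, 7, 8, 9, 10, 11}" shows "leaf_inv k (m(r := v))"
proof -
  have "(m(r := v)) (cell a j) = m (cell a j)" if "0 < a" for a j
    using cell_reg(1)[OF that, of r j] assms(2) by simp
  then show ?thesis using assms const_regs_upd[OF assms(3)] unfolding leaf_inv_def by simp
qed

lemma exec_leaf_slot:
  assumes "const_regs m" "m 14 = real u" "m (cell 6 u) = real (cell 7 y)" "m (cell 7 y) = a"
  shows "exec leaf_slot m =
    Some (m(16 := real (cell 6 u), 17 := real (cell 7 y), 27 := a, 17 := real (cell 7 (Suc y)), cell 6 u := real (cell 7 (Suc y))))"
  using assms unfolding leaf_slot_def const_regs_def by simp

lemma exec_leaf_parent: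
  assumes "const_regs m" "m 14 = real u" "m (cell 8 (2 * u)) = X" "m (cell 8 (Suc (2 * u))) = Y"
  shows "exec leaf_parent m =
    Some (m(16 := real (cell 8 (2 * u)), 24 := X, 16 := real (cell 8 (Suc (2 * u))), 25 := Y))"
  using assms unfolding leaf_parent_def const_regs_def by simp

lemma exec_leaf_shift:
  assumes "const_regs m" "m 24 = X" "m 25 = Y" "m 27 = a"
  shows "exec leaf_shift m =
    Some (m(17 := cos a * 2, 24 := X + cos a * 2, 17 := sin a * 2, 25 := Y + sin a * 2))"
  using assms unfolding leaf_shift_def const_regs_def by simp

lemma exec_leaf_store:
  assumes "const_regs m" "m 15 = real v" "m 24 = X" "m 25 = Y"
  shows "exec leaf_store m =
    Some (m(16 := real (cell 8 (2 * v)), cell 8 (2 * v) := X, 16 := real (cell 8 (Suc (2 * v))), cell 8 (Suc (2 * v)) := Y))"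
  using assms unfolding leaf_store_def const_regs_def by simp

lemma place_leaf_step:
  assumes k: "k < length directed" and inv: "leaf_inv k m"
    and u14: "m 14 = real (fst (directed ! k))" and v15: "m 15 = real (snd (directed ! k))"
  shows "ends place_leaf m 30 (\<lambda>m'. leaf_inv (Suc k) m' \<and> m' 12 = m 12)"
proof -
  define u where "u = fst (directed ! k)"
  define v where "v = snd (directed ! k)"
  have lt: "u < n" "v < n" using nth_directed_lt[OF k] by (auto simp: u_def v_def)
  have uv: "(u, v) \<in> E" using k nth_mem[OF k] set_directed_E by (simp add: u_def v_def)
  note uB = lt_B(1-4)[OF lt(1)] and vB = lt_B(1-4)[OF lt(2)]
  have inv6: "m (cell 6 w) = (if w \<in> set xs then real (cell 7 (8 * w + (card (spine_nbrs E w) + leaves_before k w))) else 0)"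
    if "w < n" for w using inv that unfolding leaf_inv_def by (blast dest: arrD)
  have c: "const_regs m" using inv by (simp add: leaf_inv_def)
  have v15': "m 15 = real v" and u14': "m 14 = real u" using u14 v15 by (simp_all add: u_def v_def)
  let ?m0 = "m(16 := real (cell 6 v), 17 := m (cell 6 v), 0 := 0)"
  have e0: "exec [Add 16 9 15, LoadInd 17 16, LoadConst 0 0] m = Some ?m0"
    using c v15' unfolding const_regs_def by simp
  have inv0: "leaf_inv k ?m0" by (intro leaf_inv_upd inv) auto
  have leafS: "snd ` set (take (Suc k) directed) = insert v (snd ` set (take k directed))"
    using k by (simp add: take_Suc_conv_app_nth v_def)
  show ?thesis unfolding place_leaf_def
  proof (rule ends_Seq[where T = 3 and T' = 25], rule ends_Block, rule e0, simp, rule ends_IfLe[where T = 21])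
    assume "?m0 17 \<le> ?m0 0"
    \<comment> \<open>Pointers of spine vertices are addresses in array 7 and hence
      positive.\<close>
    then have "v \<notin> set xs"
    proof (rule contrapos_pn)
      assume "v \<in> set xs"
      then have "m (cell 6 v) > 0" using inv6[OF lt(2)] cell_ge[of 7] by (simp add: less_le_trans[of 0 128])
      then show "\<not> ?m0 17 \<le> ?m0 0" by simp
    qed
    note v = lt(2) this
    have "u = xs ! par v" using leaf_edge[OF v, of u] uv spine_edge_lt[OF sp] by blast
    then have u: "u = xs ! par v" "u \<in> set xs" "par v < length xs" using par[OF v] by auto
    have "directed ! k = (u, v)" by (simp add: u_def v_def)
    then have pk: "pos v = k" unfolding u(1) by (rule pos_eq[OF k])
    define s where "s = slot_no v"
    have s: "s = card (spine_nbrs E u) + leaves_before k u"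
      by (simp add: s_def slot_no_def rank_def pk u(1))
    have s5: "s < 5" using center_leaf(2)[OF v] by (simp add: s_def)
    have sB: "8 * u + s < B" using uB s5 by linarith
    define a where "a = slot_angle (par v) s"
    define X where "X = Re (center u)"
    define Y where "Y = Im (center u)"
    have 6: "?m0 (cell 6 u) = real (cell 7 (8 * u + s))" using inv6[OF lt(1)] u(2) by (simp add: s)
    have 7: "?m0 (cell 7 (8 * u + s)) = a" using inv0 s5 u unfolding leaf_inv_def a_def by blast
    define m1 where "m1 = ?m0(16 := real (cell 6 u), 17 := real (cell 7 (8 * u + s)), 27 := a,
      17 := real (cell 7 (Suc (8 * u + s))), cell 6 u := real (cell 7 (Suc (8 * u + s))))"
    have e1: "exec leaf_slot ?m0 = Some m1"
      unfolding m1_def using c u14' by (intro exec_leaf_slot 6 7) simp_all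
    have c1: "const_regs m1" using c by (simp add: m1_def)
    have r1: "m1 14 = real u" "m1 15 = real v" "m1 27 = a" "m1 12 = m 12" using u14' v15' by (simp_all add: m1_def)
    have xy: "m (cell 8 (2 * u)) = X" "m (cell 8 (Suc (2 * u))) = Y"
      using inv lt(1) u(2) unfolding leaf_inv_def X_def Y_def by blast+
    define m2 where "m2 = m1(16 := real (cell 8 (2 * u)), 24 := X, 16 := real (cell 8 (Suc (2 * u))), 25 := Y)"
    have e2: "exec leaf_parent m1 = Some m2"
      unfolding m2_def using c1 r1 xy uB by (intro exec_leaf_parent) (simp_all add: m1_def)
    have c2: "const_regs m2" using c1 by (simp add: m2_def)
    have r2: "m2 15 = real v" "m2 27 = a" "m2 24 = X" "m2 25 = Y" "m2 12 = m 12" using r1 by (simp_all add: m2_def)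
    define m3 where "m3 = m2(17 := cos a * 2, 24 := X + cos a * 2, 17 := sin a * 2, 25 := Y + sin a * 2)"
    have e3: "exec leaf_shift m2 = Some m3"
      unfolding m3_def using c2 r2 by (intro exec_leaf_shift)
    have c3: "const_regs m3" using c2 by (simp add: m3_def)
    have r3: "m3 15 = real v" "m3 24 = X + cos a * 2" "m3 25 = Y + sin a * 2" "m3 12 = m 12" using r2 by (simp_all add: m3_def)
    define m4 where "m4 = m3(16 := real (cell 8 (2 * v)), cell 8 (2 * v) := X + cos a * 2,
      16 := real (cell 8 (Suc (2 * v))), cell 8 (Suc (2 * v)) := Y + sin a * 2)"
    have e4: "exec leaf_store m3 = Some m4"
      unfolding m4_def using c3 r3 by (intro exec_leaf_store)
    have c4: "const_regs m4" using c3 by (simp add: m4_def)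
    have r4: "m4 12 = m 12" using r3 by (simp add: m4_def)
    have ex: "exec (leaf_slot @ leaf_parent @ leaf_shift @ leaf_store) ?m0 = Some m4"
      by (rule exec_append_Some[OF e1 exec_append_Some[OF e2 exec_append_Some[OF e3 e4]]])
    have cells: "m4 (cell b i) = (if b = 6 \<and> i = u then real (cell 7 (Suc (8 * u + s)))
        else if b = 8 \<and> i = 2 * v then X + cos a * 2 else if b = 8 \<and> i = Suc (2 * v) then Y + sin a * 2 else m (cell b i))"
      if "0 < b" "i < B" for b i
      using that uB vB by (simp add: m4_def m3_def m2_def m1_def)
    have "leaf_inv (Suc k) m4"
      unfolding leaf_inv_def
    proof (intro conjI allI impI c4)
      show "has_edges m4"
        using inv cells lt_B(5,6) unfolding leaf_inv_def has_edges_def by simp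
      show "arr 6 (\<lambda>v. if v \<in> set xs then real (cell 7 (8 * v + (card (spine_nbrs E v) + leaves_before (Suc k) v))) else 0) m4"
        unfolding arr_def
      proof (intro allI impI)
        fix w assume w: "w < n"
        show "m4 (cell 6 w) = (if w \<in> set xs then real (cell 7 (8 * w + (card (spine_nbrs E w) + leaves_before (Suc k) w))) else 0)"
        proof (cases "w = u")
          case True
          have "leaves_before (Suc k) u = leaves_before k u + 1"
            using leaves_before_Suc[OF k, of u] v(2) by (simp add: u_def v_def)
          then show ?thesis using True u(2) cells[of 6 u] uB by (simp add: s)
        next
          case False
          then have "leaves_before (Suc k) w = leaves_before k w"
            using leaves_before_Suc[OF k, of w] by (simp add: u_def)
          then show ?thesis using False cells[of 6 w] lt_B(1)[OF w] inv6[OF w] by simp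
        qed
      qed
    next
      fix j s' :: nat assume j: "j < length xs" "s' < 5"
      have "8 * (xs ! j) + s' < B" using lt_B(4)[OF xs_lt[OF j(1)]] j(2) by linarith
      then show "m4 (cell 7 (8 * (xs ! j) + s')) = slot_angle j s'"
        using cells[of 7 "8 * (xs ! j) + s'"] inv j by (simp add: leaf_inv_def)
    next
      fix w assume w: "w < n" "w \<in> set xs \<union> snd ` set (take (Suc k) directed)"
      have "m4 (cell 8 (2 * w)) = Re (center w) \<and> m4 (cell 8 (Suc (2 * w))) = Im (center w)"
      proof (cases "w = v")
        case True
        have "center v = center u + 2 * cis a"
          using center_leaf(1)[OF v] center_spine[OF u(3)] by (simp add: u(1) a_def s_def algebra_simps)
        then show ?thesis using True cells[of 8 "2 * v"] cells[of 8 "Suc (2 * v)"] vB by (simp add: X_def Y_def)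
      next
        case False
        then have "w \<in> set xs \<union> snd ` set (take k directed)" using w(2) leafS by blast
        then have "m (cell 8 (2 * w)) = Re (center w) \<and> m (cell 8 (Suc (2 * w))) = Im (center w)"
          using inv w(1) unfolding leaf_inv_def by blast
        moreover have "2 * w \<noteq> Suc (2 * v)" "Suc (2 * w) \<noteq> 2 * v" by presburger+
        ultimately show ?thesis using False cells[of 8 "2 * w"] cells[of 8 "Suc (2 * w)"] lt_B(2,3)[OF w(1)] by simp
      qed
      then show "m4 (cell 8 (2 * w)) = Re (center w)" "m4 (cell 8 (Suc (2 * w))) = Im (center w)" by auto
    qed
    then show "ends (Block (leaf_slot @ leaf_parent @ leaf_shift @ leaf_store)) ?m0 21
       (\<lambda>m'. leaf_inv (Suc k) m' \<and> m' 12 = m 12)"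
      using r4 by - (rule ends_Block, rule ex, simp add: leaf_slot_def leaf_parent_def leaf_shift_def leaf_store_def, simp)
  next
    assume "?m0 0 < ?m0 17"
    then have "v \<in> set xs" using inv6[OF lt(2)] by (auto split: if_splits)
    then have "snd (directed ! k) \<in> set xs" by (simp only: v_def)
    then have "\<not> (fst (directed ! k) = w \<and> snd (directed ! k) \<notin> set xs)" for w by blast
    then have lb: "leaves_before (Suc k) w = leaves_before k w" for w
      by (simp only: leaves_before_Suc[OF k] if_False add_0_right)
    have ws: "set xs \<union> snd ` set (take (Suc k) directed) = set xs \<union> snd ` set (take k directed)"
      unfolding leafS using \<open>v \<in> set xs\<close> by (simp only: Un_insert_right insert_absorb UnI1)
    have "leaf_inv (Suc k) ?m0" using inv0 unfolding leaf_inv_def lb ws .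
    then show "ends (Block []) ?m0 21 (\<lambda>m'. leaf_inv (Suc k) m' \<and> m' 12 = m 12)"
      by - (rule ends_Block, rule exec.simps(1), simp, rule conjI, assumption, simp)
  qed simp_all
qed

lemma place_leaves:
  assumes "graph_ok m" "placed (length xs) m"
  shows "ends (for_edges place_leaf) m (80 * length es + 10)
    (\<lambda>m. const_regs m \<and> (\<forall>v<n. m (cell 8 (2 * v)) = Re (center v) \<and> m (cell 8 (Suc (2 * v))) = Im (center v)))"
proof -
  have "leaf_inv 0 m"
    unfolding leaf_inv_def
  proof (intro conjI)
    show "const_regs m" "has_edges m" using assms(1) by (simp_all add: graph_ok_def)
    show "arr 6 (\<lambda>v. if v \<in> set xs then real (cell 7 (8 * v + (card (spine_nbrs E v) + leaves_before 0 v))) else 0) m"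
      using assms(2) by (auto simp: arr_def placed_def ptr_def leaves_before_def in_set_conv_nth)
    show "\<forall>j<length xs. \<forall>s<5. m (cell 7 (8 * (xs ! j) + s)) = slot_angle j s" using assms(2) by (simp add: placed_def)
    show "\<forall>w<n. w \<in> set xs \<union> snd ` set (take 0 directed) \<longrightarrow>
        m (cell 8 (2 * w)) = Re (center w) \<and> m (cell 8 (Suc (2 * w))) = Im (center w)"
      using assms(2) by (auto simp: placed_def in_set_conv_nth center_spine)
  qed
  then have "ends (for_edges place_leaf) m (80 * length es + 10) (leaf_inv (length directed))"
  proof (rule for_edges_rule[where T = 30, rotated 3])
    show "leaf_inv k (m(r := v))" if "leaf_inv k m" "r \<in> {0, 12, 13, 14, 15, 16}" for k m r v
      using that by (intro leaf_inv_upd) auto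
    show "const_regs m \<and> has_edges m" if "leaf_inv k m" for k m using that unfolding leaf_inv_def by blast
  qed (simp, rule place_leaf_step)
  then show ?thesis
  proof (rule ends_mono[OF _ order_refl])
    fix m assume I: "leaf_inv (length directed) m"
    have "v \<in> set xs \<union> snd ` set (take (length directed) directed)" if "v < n" for v
    proof (cases "v \<in> set xs")
      case False
      then show ?thesis using pos[OF that False] by (metis UnI2 image_eqI nth_mem order_refl snd_conv take_all)
    qed simp
    then show "const_regs m \<and> (\<forall>v<n. m (cell 8 (2 * v)) = Re (center v) \<and> m (cell 8 (Suc (2 * v))) = Im (center v))"
      using I unfolding leaf_inv_def by blast
  qed
qed

end

theorem theorem1:
  "\<exists>(P :: instr list) (C :: nat). \<forall>n E es.
     caterpillar n E \<and> edge_list_of E es \<longrightarrow>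
     (\<exists>m. halts_within P (input_mem n es) (C * (n + length es + 1)) m \<and>
        (if UDC_graph n E
         then m 0 = 1 \<and> unit_disk_contact_rep n E (output_centers m) 1
         else m 0 = 0))"
proof (intro exI[of _ "compile 0 program @ [Halt]"] exI[of _ 1000] allI impI)
  fix n :: nat and E es assume "caterpillar n E \<and> edge_list_of E es"
  then have cat: "caterpillar n E" and es: "edge_list_of E es" by auto
  let ?good = "\<lambda>m. if UDC_graph n E then m 0 = 1 \<and> unit_disk_contact_rep n E (output_centers m) 1 else m 0 = 0"
  have graph: "graph_on n E" and n: "n \<ge> 1"
    using cat by (auto simp: caterpillar_def is_tree_def connected_graph_def)
  obtain xs where xs: "spine n E xs" "hd xs = start n E" using caterpillar_spine[OF cat] .
  interpret spine_machine n es "128 * n * n" E xs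
    using graph n es xs edge_list_bounds[OF graph es] by unfold_locales auto
  obtain m0 where m0: "exec (save @ constants) inp = Some m0" "const_regs m0" "saved m0"
    using exec_save_constants by blast
  let ?L = "length es"
  let ?D = "IfLe 1 23 (for_edges place_leaf ;; write_output) (Block [LoadConst 0 0])"
  have D: "ends ?D m (80 * ?L + 20 * n + 120) ?good"
    if m: "graph_ok m" "placed (length xs) m" "m 23 = of_bool (feasible E xs)" for m
  proof (rule ends_IfLe[where T = "80 * ?L + 20 * n + 110"])
    have one: "m 1 = 1" using m(1) by (simp add: graph_ok_def const_regs_def)
    show "ends (for_edges place_leaf ;; write_output) m (80 * ?L + 20 * n + 110) ?good" if "m 1 \<le> m 23"
    proof -
      have f: "feasible E xs" using that one m(3) by (cases "feasible E xs") auto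
      interpret feasible_machine n es "128 * n * n" E xs by unfold_locales (rule f)
      have udc: "UDC_graph n E" using contact_rep unfolding UDC_graph_def by blast
      show ?thesis
      proof (rule ends_Seq[OF ends_mono[OF place_leaves[OF m(1,2)] order_refl]])
        fix m1 assume m1: "const_regs m1 \<and> (\<forall>v<n. m1 (cell 8 (2 * v)) = Re (center v) \<and> m1 (cell 8 (Suc (2 * v))) = Im (center v))"
        show "ends write_output m1 (20 * n + 100) ?good"
        proof (rule ends_mono[OF write_output order_refl])
          show "const_regs m1" using m1 by simp
          fix m2 assume m2: "m2 0 = 1 \<and> (\<forall>j. 1 \<le> j \<longrightarrow> j \<le> 2 * n \<longrightarrow> m2 j = m1 (cell 8 (j - 1)))"
          have oc: "output_centers m2 v = (Re (center v), Im (center v))" if "v < n" for v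
            using m1 m2 that by (simp add: output_centers_def)
          have "unit_disk_contact_rep n E (output_centers m2) 1"
            unfolding unit_disk_contact_rep_iff
          proof (intro conjI allI impI)
            fix u v assume uv: "u < n" "v < n" "u \<noteq> v"
            then show "if (u, v) \<in> E then dist (output_centers m2 u) (output_centers m2 v) = 2 * 1
              else dist (output_centers m2 u) (output_centers m2 v) > 2 * 1"
              using contact_rep unfolding oc[OF uv(1)] oc[OF uv(2)] unit_disk_contact_rep_iff by blast
          qed simp
          then show "?good m2" using m2 udc by simp
        qed
      qed simp
    qed
    show "ends (Block [LoadConst 0 0]) m (80 * ?L + 20 * n + 110) ?good" if "m 23 < m 1"
    proof -
      have "\<not> feasible E xs" using that one m(3) by (cases "feasible E xs") auto
      then have "\<not> UDC_graph n E" using UDC_imp_feasible[OF xs(1)] by blast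
      then show ?thesis by - (rule ends_Block, simp, simp, simp)
    qed
  qed simp
  have 6: "ends (place_spine ;; ?D) m (80 * ?L + 102 * n + 150) ?good"
    if "graph_ok m" "zero_from 6 m" "m 18 = real (start n E)" for m
    by (rule ends_Seq[OF ends_mono[OF place_spine[OF that] order_refl D]]) auto
  have 5: "ends (find_start ;; place_spine ;; ?D) m (80 * ?L + 122 * n + 170) ?good"
    if "graph_ok m" "zero_from 6 m" for m
    by (rule ends_Seq[OF ends_mono[OF find_start[OF that] order_refl 6]]) auto
  have 4: "ends (for_edges count_spine ;; find_start ;; place_spine ;; ?D) m (128 * ?L + 122 * n + 180) ?good"
    if "const_regs m" "has_edges m" "deg_ok m" "zero_from 4 m" for m
    by (rule ends_Seq[OF ends_mono[OF count_spine[OF that] order_refl 5]]) (auto simp: graph_ok_def)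
  have 3: "ends (for_edges count_degree ;; for_edges count_spine ;; find_start ;; place_spine ;; ?D) m (156 * ?L + 122 * n + 190) ?good"
    if "const_regs m" "has_edges m" "zero_from 3 m" for m
    by (rule ends_Seq[OF ends_mono[OF count_degree[OF that] order_refl 4]]) auto
  have 2: "ends (duplicate_edges ;; for_edges count_degree ;; for_edges count_spine ;; find_start ;; place_spine ;; ?D) m0
      (196 * ?L + 122 * n + 230) ?good"
    by (rule ends_Seq[OF ends_mono[OF duplicate_edges[OF m0(2,3)] order_refl 3]]) auto
  have "length (save @ constants) \<le> 100"
    by (simp add: save_def constants_def length_concat comp_def sum_list_triv)
  then have "ends (Block (save @ constants)) inp 100
      (\<lambda>m. ends (duplicate_edges ;; for_edges count_degree ;; for_edges count_spine ;; find_start ;; place_spine ;; ?D) m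
      (196 * ?L + 122 * n + 230) ?good)"
    by - (rule ends_Block, rule m0(1), assumption, rule 2)
  \<comment> \<open>The passes add up to at most 196 steps per edge, 122 per vertex and 330 in
    addition, well below the factor 1000.\<close>
  then have "ends program inp (1000 * (n + length es + 1)) ?good"
    unfolding program_def by (rule ends_Seq) simp
  then show "\<exists>m. halts_within (compile 0 program @ [Halt]) (input_mem n es) (1000 * (n + length es + 1)) m \<and> ?good m"
    unfolding inp_def by (rule ends_halts) blast
qed

end
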